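(* Let $q\le5$ be a prime power. Every maximum scattered $\mathbb F_q$-linear set in $\mathrm{PG}(1,q^5)$ is either of pseudoregulus type or of LP type.
   Context: An $\mathbb F_q$-linear set of rank 5 in $\mathrm{PG}(1,q^5)$ is $L_U=\{\langle v\rangle_{\mathbb F_{q^5}}:v\in U\setminus\{0\}\}$ for a 5-dimensional $\mathbb F_q$-subspace $U\subseteq\mathbb F_{q^5}^2$; it is maximum scattered if it has $(q^5-1)/(q-1)$ points (rank 5 being the maximum possible for scattered linear sets in $\mathrm{PG}(1,q^5)$). It is of pseudoregulus type if it is $\mathrm{P\Gamma L}(2,q^5)$-equivalent to $\{\langle(x,x^{q^s})\rangle_{\mathbb F_{q^5}}:x\in\mathbb F_{q^5}^*\}$ with $\gcd(s,5)=1$, and of LP type if equivalent to $\{\langle(x,x^{q^s}+\delta x^{q^{5-s}})\rangle_{\mathbb F_{q^5}}:x\in\mathbb F_{q^5}^*\}$ with $\gcd(s,5)=1$, $\mathrm N_{q^5/q}(\delta)\notin\{0,1\}$, where $\mathrm N_{q^5/q}(x)=x^{1+q+q^2+q^3+q^4}$. *)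

theory Defs
  imports "HOL-Analysis.Cartesian_Space" "HOL-Number_Theory.Prime_Powers"
begin

text \<open>
  Throughout, \<open>'a\<close> is a finite field with \<open>q ^ 5\<close> elements. Its unique subfield with \<open>q\<close>
  elements is the set of roots of \<open>X ^ q - X\<close>. Points of the projective line over \<open>'a\<close> are the
  one-dimensional subspaces \<open>vec.span {v}\<close>, \<open>v \<noteq> 0\<close>, of \<open>'a ^ 2\<close>.
\<close>

definition Fq :: "nat \<Rightarrow> 'a::field set" where
  "Fq q = {x. x ^ q = x}"

definition Fq_subspace :: "nat \<Rightarrow> ('a::field ^ 'n) set \<Rightarrow> bool" where
  "Fq_subspace q U \<longleftrightarrow>
     0 \<in> U \<and> (\<forall>u\<in>U. \<forall>v\<in>U. u + v \<in> U) \<and> (\<forall>c\<in>Fq q. \<forall>u\<in>U. c *s u \<in> U)"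

definition Fq_independent :: "nat \<Rightarrow> ('a::field ^ 'n) set \<Rightarrow> bool" where
  "Fq_independent q B \<longleftrightarrow>
     (\<forall>c. (\<forall>b\<in>B. c b \<in> Fq q) \<and> (\<Sum>b\<in>B. c b *s b) = 0 \<longrightarrow> (\<forall>b\<in>B. c b = 0))"

definition Fq_subspace_of_dim :: "nat \<Rightarrow> nat \<Rightarrow> ('a::field ^ 'n) set \<Rightarrow> bool" where
  "Fq_subspace_of_dim q k U \<longleftrightarrow> Fq_subspace q U \<and>
     (\<exists>B. finite B \<and> card B = k \<and> Fq_independent q B \<and> Fq_subspace q hull B = U)"

definition linear_set :: "('a::field ^ 2) set \<Rightarrow> ('a ^ 2) set set" where
  "linear_set U = {vec.span {v} | v. v \<in> U - {0}}"

definition linear_set_of_rank :: "nat \<Rightarrow> nat \<Rightarrow> ('a::field ^ 2) set set \<Rightarrow> bool" where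
  "linear_set_of_rank q k L \<longleftrightarrow> (\<exists>U. Fq_subspace_of_dim q k U \<and> L = linear_set U)"

definition maximum_scattered :: "nat \<Rightarrow> ('a::field ^ 2) set set \<Rightarrow> bool" where
  "maximum_scattered q L \<longleftrightarrow>
     linear_set_of_rank q 5 L \<and> finite L \<and> card L = (q ^ 5 - 1) div (q - 1)"

definition field_automorphism :: "('a::field \<Rightarrow> 'a) \<Rightarrow> bool" where
  "field_automorphism \<sigma> \<longleftrightarrow>
     bij \<sigma> \<and> (\<forall>x y. \<sigma> (x + y) = \<sigma> x + \<sigma> y) \<and> (\<forall>x y. \<sigma> (x * y) = \<sigma> x * \<sigma> y)"

definition semilinear_bij :: "('a::field ^ 'n \<Rightarrow> 'a ^ 'n) \<Rightarrow> bool" where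
  "semilinear_bij f \<longleftrightarrow> bij f \<and> (\<forall>u v. f (u + v) = f u + f v) \<and>
     (\<exists>\<sigma>. field_automorphism \<sigma> \<and> (\<forall>c v. f (c *s v) = \<sigma> c *s f v))"

definition PGammaL_equivalent :: "('a::field ^ 2) set set \<Rightarrow> ('a ^ 2) set set \<Rightarrow> bool" where
  "PGammaL_equivalent L M \<longleftrightarrow> (\<exists>f. semilinear_bij f \<and> (\<lambda>P. f ` P) ` L = M)"

definition pseudoregulus_type :: "nat \<Rightarrow> ('a::field ^ 2) set set \<Rightarrow> bool" where
  "pseudoregulus_type q L \<longleftrightarrow>
     (\<exists>s::nat. coprime s 5 \<and>
        PGammaL_equivalent L {vec.span {vector [x, x ^ (q ^ s)]} | x. x \<noteq> 0})"

definition Fq5_norm :: "nat \<Rightarrow> 'a::field \<Rightarrow> 'a" where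
  "Fq5_norm q x = x ^ (1 + q + q ^ 2 + q ^ 3 + q ^ 4)"

text \<open>The bound \<open>s < 5\<close> keeps the truncated subtraction \<open>5 - s\<close> exact; \<open>s\<close> only matters modulo 5.\<close>

definition LP_type :: "nat \<Rightarrow> ('a::field ^ 2) set set \<Rightarrow> bool" where
  "LP_type q L \<longleftrightarrow>
     (\<exists>(s::nat) \<delta>. coprime s 5 \<and> s < 5 \<and> Fq5_norm q \<delta> \<notin> {0, 1} \<and>
        PGammaL_equivalent L
          {vec.span {vector [x, x ^ (q ^ s) + \<delta> * x ^ (q ^ (5 - s))]} | x. x \<noteq> 0})"

end

theory Submission
  imports Defs "HOL-Computational_Algebra.Polynomial"
begin

text \<open>
  Let \<open>u\<^sub>1, \<dots>, u\<^sub>5\<close> be a basis of the subspace \<open>U\<close>, and let \<open>F\<close> be the field with \<open>q ^ 5\<close> elements. The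
  four linear equations \<open>\<Sum> A\<^sub>i u\<^sub>i = 0\<close>, \<open>\<Sum> A\<^sub>i u\<^sub>i ^ q = 0\<close> have a non-zero solution \<open>A\<close> in \<open>F ^ 5\<close>, and
  \<open>z \<mapsto> \<Sum> Tr (A\<^sub>i z) u\<^sub>i\<close> maps \<open>F\<close> into \<open>U\<close>; the choice of \<open>A\<close> kills two of its five coefficients, so up to
  a substitution it is \<open>z \<mapsto> z c\<^sub>1 + z ^ q c\<^sub>2 + z ^ (q ^ 2) c\<^sub>3\<close>. If \<open>c\<^sub>1, c\<^sub>3\<close> are dependent, then \<open>U\<close> is of
  pseudoregulus type or of the form \<open>(x, x ^ q + \<delta> x ^ (q ^ 4))\<close>, and norm 1 of \<open>\<delta>\<close> contradicts
  scatteredness. Otherwise either the map is a bijection and \<open>U\<close> consists of the vectors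
  \<open>(z + a z ^ q, z ^ (q ^ 2) + b z ^ q)\<close> with \<open>a\<close> normalised to lie in the subfield of order \<open>q\<close>, or its
  kernel is a line, \<open>U\<close> contains \<open>(y, y ^ q)\<close> for all \<open>y\<close> of trace 0, and one parameter \<open>\<psi>\<close> describes \<open>U\<close>.

  For \<open>q \<le> 5\<close> these families are finite and small. For all but a few parameters explicit witnesses
  exhibit two vectors of \<open>U\<close> that are proportional over \<open>F\<close> but not over the subfield; the
  remaining parameters give sets of pseudoregulus type (\<open>a b = 1\<close>) or of LP type with \<open>s = 2\<close>.
\<close>

section \<open>Fields of order \<open>q ^ 5\<close>\<close>

text \<open>The coefficient of \<open>z ^ (q ^ k)\<close> in
  \<open>\<Sum> Tr (A\<^sub>i z) u\<^sub>i\<close> is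
  \<open>\<Sum> A\<^sub>i ^ (q ^ k) u\<^sub>i\<close>. For k = 0 it vanishes by the first equation;
  for k = 4 its q-th power is \<open>\<Sum> A\<^sub>i u\<^sub>i ^ q\<close>, because every A equals
  its own power with exponent q ^ 5. The obstacle is that the search runs in an abstract type with q
  ^ 5 elements, where nothing can be evaluated. So F is modelled by polynomials of degree at most 4
  in a generator, over a coefficient type given by explicit tables, and a stored witness reduces
  each parameter to a few multiplications. Symmetries keep the lists short. Moving a into the
  subfield needs fifth roots there, which exist because 5 is coprime to q - 1 for q = 2, 3, 4, 5.
  The parameter \<psi> is scaled by the subfield; squaring exchanges two values of a for q = 4; for
  q = 5 the Frobenius map clears one more coordinate.\<close>

lemma card_le_range_mult_kernel:
  fixes f :: "'a::{finite,ab_group_add} \<Rightarrow> 'b::ab_group_add"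
  assumes add: "\<And>x y. f (x + y) = f x + f y"
  shows "CARD('a) \<le> card (range f) * card {x. f x = 0}"
proof -
  have diff: "f (x - y) = f x - f y" for x y
    using add[of "x - y" y] by (simp add: algebra_simps)
  have fib: "card {x. f x = y} \<le> card {x. f x = 0}" if y: "y \<in> range f" for y
  proof -
    obtain x0 where x0: "y = f x0" using y by auto
    have "(\<lambda>x. x - x0) ` {x. f x = y} \<subseteq> {x. f x = 0}"
      by (auto simp: diff x0)
    then have "card ((\<lambda>x. x - x0) ` {x. f x = y}) \<le> card {x. f x = 0}"
      by (intro card_mono) auto
    then show ?thesis
      by (subst (asm) card_image) (auto simp: inj_on_def)
  qed
  have "UNIV = (\<Union>y\<in>range f. {x. f x = y})" by auto
  then have "CARD('a) = card (\<Union>y\<in>range f. {x. f x = y})" by simp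
  also have "\<dots> \<le> (\<Sum>y\<in>range f. card {x. f x = y})"
    by (intro card_UN_le) auto
  also have "\<dots> \<le> (\<Sum>y\<in>range f. card {x. f x = 0})"
    by (intro sum_mono fib)
  finally show ?thesis by simp
qed

section \<open>Determinants of pairs of plane vectors\<close>

lemma vec2_eq_iff: "u = v \<longleftrightarrow> u $ 1 = v $ 1 \<and> u $ 2 = v $ 2" for u v :: "'a ^ 2"
  by (simp add: vec_eq_iff forall_2)

lemma vector_scalar_add_ldistrib: "c *s (x + y) = c *s x + c *s y" for c :: "'a::field"
  by (simp add: vec_eq_iff algebra_simps)

lemma vector_scalar_diff_rdistrib: "(c - d) *s x = c *s x - d *s x" for c :: "'a::field"
  by (simp add: vec_eq_iff algebra_simps)

definition wedge :: "'a::field ^ 2 \<Rightarrow> 'a ^ 2 \<Rightarrow> 'a" where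
  "wedge u v = u $ 1 * v $ 2 - u $ 2 * v $ 1"

lemma wedge_zero_imp_multiple:
  assumes "wedge u v = 0" "u \<noteq> 0"
  shows "\<exists>c. v = c *s u"
proof (cases "u $ 1 = 0")
  case True
  then have "u $ 2 \<noteq> 0" using assms(2) by (auto simp: vec2_eq_iff)
  with True assms(1) show ?thesis
    by (intro exI[of _ "v $ 2 / u $ 2"]) (auto simp: vec2_eq_iff wedge_def)
next
  case False
  with assms(1) show ?thesis
    by (intro exI[of _ "v $ 1 / u $ 1"]) (auto simp: vec2_eq_iff wedge_def field_simps)
qed

text \<open>Cramer's rule, with denominators cleared first so that the two key equations are ring
  identities.\<close>

lemma wedge_nonzero_span:
  assumes "wedge u v \<noteq> 0"
  obtains a b where "w = a *s u + b *s v"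
proof
  have "w $ 1 * wedge u v = wedge w v * u $ 1 + wedge u w * v $ 1"
    "w $ 2 * wedge u v = wedge w v * u $ 2 + wedge u w * v $ 2"
    by (simp_all add: wedge_def algebra_simps)
  with assms show "w = (wedge w v / wedge u v) *s u + (wedge u w / wedge u v) *s v"
    by (auto simp: vec2_eq_iff divide_simps)
qed

lemma wedge_nonzero_independent:
  assumes "wedge u v \<noteq> 0" "a *s u + b *s v = a' *s u + b' *s v"
  shows "a = a' \<and> b = b'"
proof -
  have *: "a * u $ 1 + b * v $ 1 = a' * u $ 1 + b' * v $ 1"
    "a * u $ 2 + b * v $ 2 = a' * u $ 2 + b' * v $ 2"
    using assms(2) by (auto simp: vec2_eq_iff)
  have "(a - a') * wedge u v = 0" "(b - b') * wedge u v = 0"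
    using * unfolding wedge_def by algebra+
  with assms(1) show ?thesis by simp
qed

section \<open>Finite fields of order q ^ 5: Frobenius map, trace and norm\<close>

lemma power_card_field:
  fixes x :: "'a::{field,finite}"
  shows "x ^ CARD('a) = x"
proof (cases "x = 0")
  case False
  have "bij_betw ((*) x) (UNIV - {0}) (UNIV - {0})"
    using False by (intro bij_betwI[where g = "\<lambda>y. y / x"]) auto
  then have "(\<Prod>y\<in>UNIV - {0}. x * y) = \<Prod>(UNIV - {0})"
    by (rule prod.reindex_bij_betw)
  then have "x ^ (CARD('a) - 1) * \<Prod>(UNIV - {0}) = \<Prod>(UNIV - {0} :: 'a set)"
    by (simp add: prod.distrib card_Diff_singleton)
  moreover have "\<Prod>(UNIV - {0} :: 'a set) \<noteq> 0" by simp
  ultimately have "x ^ (CARD('a) - 1) = 1" by simp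
  moreover have "CARD('a) = Suc (CARD('a) - 1)" by simp
  ultimately show ?thesis by (metis mult.right_neutral power_Suc)
qed simp

lemma of_nat_card_field: "of_nat CARD('a::{field,finite}) = (0::'a)"
proof -
  have "(\<Sum>y\<in>(UNIV::'a set). y + 1) = \<Sum>UNIV"
    by (rule sum.reindex_bij_betw) (auto intro!: bij_betwI[where g = "\<lambda>y. y - 1"])
  then show ?thesis by (simp add: sum.distrib)
qed

locale quintic_field =
  fixes q :: nat and field_type :: "'a::{field,finite} itself"
  assumes primepow_q: "primepow q" and card_field: "CARD('a) = q ^ 5"
begin

definition frob :: "'a \<Rightarrow> 'a" where
  "frob x = x ^ q"

abbreviation "frob2 x \<equiv> frob (frob x)"
abbreviation "frob3 x \<equiv> frob (frob (frob x))"
abbreviation "frob4 x \<equiv> frob (frob (frob (frob x)))"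

lemma q_gt_1: "q > 1"
  using primepow_q by (simp add: primepow_gt_Suc_0)

lemma CHAR_eq:
  assumes "prime p" "q = p ^ k"
  shows "CHAR('a) = p"
proof -
  have "CHAR('a) dvd q ^ 5"
    using of_nat_card_field[where 'a = 'a] unfolding of_nat_eq_0_iff_char_dvd card_field .
  moreover have "prime CHAR('a)"
    using prime_CHAR_semidom[where ?'a = 'a] finite_imp_CHAR_pos[where ?'a='a] by simp
  ultimately show ?thesis
    using assms by (metis prime_dvd_power primes_dvd_imp_eq)
qed

lemma frob_add [simp]: "frob (x + y) = frob x + frob y"
proof -
  obtain p k where pk: "prime p" "q = p ^ k"
    using primepow_q unfolding primepow_def by auto
  show ?thesis
    unfolding frob_def
    by (rule freshmans_dream'[of "q" k]) (use CHAR_eq[OF pk] pk in auto)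
qed

lemma frob_mult [simp]: "frob (x * y) = frob x * frob y"
  by (simp add: frob_def power_mult_distrib)

lemma frob_0 [simp]: "frob 0 = 0"
  using q_gt_1 by (simp add: frob_def)

lemma frob_1 [simp]: "frob 1 = 1"
  by (simp add: frob_def)

lemma frob_minus [simp]: "frob (- x) = - frob x"
  using frob_add[of x "- x"] by (simp add: eq_neg_iff_add_eq_0 add.commute)

lemma frob_diff [simp]: "frob (x - y) = frob x - frob y"
  using frob_add[of x "- y"] by simp

lemma frob_divide [simp]: "frob (x / y) = frob x / frob y"
  by (simp add: frob_def power_divide)

lemma frob_sum: "frob (\<Sum>i\<in>I. f i) = (\<Sum>i\<in>I. frob (f i))"
  by (induction I rule: infinite_finite_induct) auto

lemma frob_eq_0_iff [simp]: "frob x = 0 \<longleftrightarrow> x = 0"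
  using q_gt_1 by (simp add: frob_def)

lemma power_q_power: "x ^ (q ^ k) = (frob ^^ k) x"
  by (induction k) (simp_all add: frob_def power_mult mult.commute[of q])

lemma frob5 [simp]: "frob (frob4 x) = x"
proof -
  have "x ^ (q ^ 5) = x"
    using power_card_field[of x] card_field by simp
  then show ?thesis unfolding power_q_power by (simp add: numeral_eq_Suc)
qed

lemma frob_eq_iff [simp]: "frob x = frob y \<longleftrightarrow> x = y"
  by (metis frob5)

lemma in_Fq_iff: "x \<in> Fq q \<longleftrightarrow> frob x = x"
  by (simp add: Fq_def frob_def)

text \<open>The exponents \<open>q ^ i\<close> are pairwise distinct, so one non-zero coefficient
  already makes the q-polynomial a non-zero ordinary polynomial of degree at most
  \<open>q ^ n\<close>.\<close>

lemma card_qpoly_roots_le: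
  fixes c :: "nat \<Rightarrow> 'a"
  assumes "i \<le> n" "c i \<noteq> 0"
  shows "card {x. (\<Sum>i\<le>n. c i * x ^ (q ^ i)) = 0} \<le> q ^ n"
proof -
  define p where "p = (\<Sum>i\<le>n. monom (c i) (q ^ i))"
  have "coeff p (q ^ i) = (\<Sum>j\<le>n. if j = i then c j else 0)"
    unfolding p_def coeff_sum using q_gt_1 by (intro sum.cong) auto
  then have "coeff p (q ^ i) = c i" using assms(1) by simp
  then have "p \<noteq> 0" using assms(2) by auto
  have "poly p x = (\<Sum>i\<le>n. c i * x ^ (q ^ i))" for x
    by (simp add: p_def poly_sum poly_monom)
  moreover have "degree p \<le> q ^ n"
    unfolding p_def
  proof (rule degree_sum_le)
    fix j assume "j \<in> {..n}"
    have "degree (monom (c j) (q ^ j)) \<le> q ^ j" by (rule degree_monom_le)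
    also have "\<dots> \<le> q ^ n" using \<open>j \<in> {..n}\<close> q_gt_1 by (intro power_increasing) auto
    finally show "degree (monom (c j) (q ^ j)) \<le> q ^ n" .
  qed simp
  ultimately show ?thesis
    using card_poly_roots_bound[OF \<open>p \<noteq> 0\<close>] by simp
qed

lemma card_qpoly5_roots_le:
  assumes "c0 \<noteq> 0 \<or> c1 \<noteq> 0 \<or> c2 \<noteq> 0 \<or> c3 \<noteq> 0 \<or> c4 \<noteq> 0"
  shows "card {x. c0 * x + c1 * frob x + c2 * frob2 x + c3 * frob3 x
    + c4 * frob4 x = 0} \<le> q ^ 4"
proof -
  define c where "c = (\<lambda>i::nat. [c0, c1, c2, c3, c4] ! i)"
  have "\<exists>i\<le>4. c i \<noteq> 0"
    using assms unfolding c_def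
    by (elim disjE) (rule exI[of _ 0] exI[of _ 1] exI[of _ 2] exI[of _ 3] exI[of _ 4]; simp)+
  then obtain i where "i \<le> 4" "c i \<noteq> 0" by auto
  from card_qpoly_roots_le[where c = c, OF this] show ?thesis
    by (simp add: power_q_power c_def numeral_eq_Suc)
qed

lemma card_qpoly3_roots_le:
  assumes "c0 \<noteq> 0 \<or> c1 \<noteq> 0 \<or> c2 \<noteq> 0"
  shows "card {x. c0 * x + c1 * frob x + c2 * frob2 x = 0} \<le> q ^ 2"
proof -
  define c where "c = (\<lambda>i::nat. [c0, c1, c2] ! i)"
  have "\<exists>i\<le>2. c i \<noteq> 0"
    using assms unfolding c_def
    by (elim disjE) (rule exI[of _ 0] exI[of _ 1] exI[of _ 2]; simp)+
  then obtain i where "i \<le> 2" "c i \<noteq> 0" by auto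
  from card_qpoly_roots_le[where c = c, OF this] show ?thesis
    by (simp add: power_q_power c_def numeral_eq_Suc)
qed

definition tr :: "'a \<Rightarrow> 'a" where
  "tr x = x + frob x + frob2 x + frob3 x + frob4 x"

lemma frob_tr [simp]: "frob (tr x) = tr x"
  by (simp add: tr_def)

lemma tr_diff: "tr (x - y) = tr x - tr y"
  by (simp add: tr_def)

lemma tr_0 [simp]: "tr 0 = 0"
  by (simp add: tr_def)

lemma tr_frob [simp]: "tr (frob x) = tr x"
  by (simp add: tr_def)

lemma tr_scale: "frob c = c \<Longrightarrow> tr (c * x) = c * tr x"
  by (simp add: tr_def algebra_simps)

lemma card_tr_kernel_le: "card {x. tr x = 0} \<le> q ^ 4"
  using card_qpoly5_roots_le[of 1 1 1 1 1] by (simp add: tr_def)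

text \<open>One count settles both claims. The additive map z -> z ^ q - z has the subfield as
  kernel, of size at most q as a root set, and its image lies in the kernel of the trace, of size at
  most q ^ 4. The product of the two sizes has to reach q ^ 5, so both bounds are attained.\<close>

lemma
  card_Fq: "card (Fq q :: 'a set) = q" and
  tr_kernel: "{x. tr x = 0} = range (\<lambda>z. frob z - z)"
proof -
  let ?f = "\<lambda>z. frob z - z"
  have ker: "{x. ?f x = 0} = Fq q" by (auto simp: in_Fq_iff)
  have "card {x. (\<Sum>i\<le>1. (if i = 0 then - 1 else 1) * x ^ (q ^ i)) = (0::'a)} \<le> q ^ 1"
    by (rule card_qpoly_roots_le[of 0]) auto
  moreover have "{x. (\<Sum>i\<le>1. (if i = 0 then - 1 else 1) * x ^ (q ^ i)) = (0::'a)} = Fq q"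
    by (auto simp: Fq_def)
  ultimately have le: "card (Fq q :: 'a set) \<le> q" by simp
  have sub: "range ?f \<subseteq> {x. tr x = 0}" by (auto simp: tr_diff)
  have main: "q ^ 5 \<le> card (range ?f) * card (Fq q :: 'a set)"
    using card_le_range_mult_kernel[of ?f] unfolding ker card_field by simp
  also have "\<dots> \<le> card (range ?f) * q" using le by simp
  finally have ge: "q ^ 4 \<le> card (range ?f)"
    using q_gt_1 by (simp add: numeral_eq_Suc)
  have "card {x. tr x = 0} \<le> card (range ?f)" using card_tr_kernel_le ge by linarith
  then show *: "{x. tr x = 0} = range ?f"
    using card_seteq[OF _ sub] by simp
  have "q ^ 5 \<le> q ^ 4 * card (Fq q :: 'a set)"
    using main card_tr_kernel_le * by (metis le_trans mult_le_mono1)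
  then have "q \<le> card (Fq q :: 'a set)"
    using q_gt_1 by (simp add: numeral_eq_Suc)
  with le show "card (Fq q :: 'a set) = q" by simp
qed

lemma tr_zero_imp_ex: "tr y = 0 \<Longrightarrow> \<exists>z. y = frob z - z"
  using tr_kernel by blast

lemma ex_tr_nonzero: "\<exists>x. tr x \<noteq> 0"
proof (rule ccontr)
  assume "\<nexists>x. tr x \<noteq> 0"
  then have "{x. tr x = 0} = UNIV" by auto
  then have "q ^ 5 \<le> q ^ 4" using card_tr_kernel_le card_field by simp
  then show False using q_gt_1 by simp
qed

definition nm :: "'a \<Rightarrow> 'a" where
  "nm x = x * frob x * frob2 x * frob3 x * frob4 x"

lemma Fq5_norm_eq: "Fq5_norm q x = nm x"
  unfolding Fq5_norm_def nm_def power_add power_q_power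
  by (simp add: numeral_eq_Suc frob_def)

text \<open>The sum \<open>?w\<close> is the usual resolvent. As a q-polynomial in x with a non-zero
  coefficient it has at most q ^ 4 roots, hence a non-zero value. Applying \<open>frob\<close> and
  multiplying by z shifts its terms cyclically; the term that wraps around picks up the factor
  \<open>nm z\<close>, which is 1.\<close>

lemma hilbert90:
  assumes "nm z = 1"
  shows "\<exists>w. w \<noteq> 0 \<and> w = z * frob w"
proof -
  let ?z1 = "frob z" let ?z2 = "frob ?z1" let ?z3 = "frob ?z2" let ?z4 = "frob ?z3"
  let ?w = "\<lambda>x. 1 * x + z * frob x + (z * ?z1) * frob2 x + (z * ?z1 * ?z2) * frob3 x
    + (z * ?z1 * ?z2 * ?z3) * frob4 x"
  have "card {x. ?w x = 0} \<le> q ^ 4"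
    by (rule card_qpoly5_roots_le) simp
  also have "\<dots> < CARD('a)" using card_field q_gt_1 by simp
  finally have "{x. ?w x = 0} \<noteq> UNIV" by auto
  then obtain x where x: "?w x \<noteq> 0" by auto
  have "z * frob (?w x) = ?w x + (nm z - 1) * x"
    by (simp add: nm_def algebra_simps)
  then have "?w x = z * frob (?w x)" using assms by simp
  with x show ?thesis by blast
qed

section \<open>Normal forms of scattered subspaces\<close>

text \<open>A condition on the vectors of U instead of on the points of the linear set. This is the
  form in which later contradictions arise: a proportionality factor outside the subfield.\<close>

definition scattered :: "('a ^ 2) set \<Rightarrow> bool" where
  "scattered U \<longleftrightarrow> (\<forall>u\<in>U. \<forall>c. u \<noteq> 0 \<and> c *s u \<in> U \<longrightarrow> c \<in> Fq q)"

section \<open>From a maximum scattered linear set to a trinomial in the subspace\<close>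

lemma Fq_subspace_sum:
  assumes "Fq_subspace q U" "\<And>i. i \<in> I \<Longrightarrow> f i \<in> U"
  shows "(\<Sum>i\<in>I. f i) \<in> U"
  using assms(2)
proof (induction I rule: infinite_finite_induct)
  case (insert i I)
  then show ?case using assms(1) by (auto simp: Fq_subspace_def)
qed (use assms(1) in \<open>auto simp: Fq_subspace_def\<close>)

text \<open>The combinations of B over the subfield form a subspace containing B, hence contain the
  hull. An upper bound suffices, since the number of points of the linear set supplies the matching
  lower bound.\<close>

lemma card_Fq_hull_le:
  fixes B :: "('a ^ 2) set"
  assumes "finite B"
  shows "card (Fq_subspace q hull B) \<le> q ^ card B"
proof -
  let ?C = "(\<lambda>c. \<Sum>b\<in>B. c b *s b) ` (B \<rightarrow>\<^sub>E Fq q)"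
  have C: "(\<Sum>b\<in>B. c b *s b) \<in> ?C" if "\<forall>b\<in>B. c b \<in> Fq q" for c
  proof (rule image_eqI)
    show "(\<Sum>b\<in>B. c b *s b) = (\<Sum>b\<in>B. restrict c B b *s b)" by (rule sum.cong) auto
    show "restrict c B \<in> B \<rightarrow>\<^sub>E Fq q" using that by auto
  qed
  have CE: "\<exists>c. (\<forall>b\<in>B. c b \<in> Fq q) \<and> u = (\<Sum>b\<in>B. c b *s b)" if "u \<in> ?C" for u
    using that by (auto simp: PiE_iff)
  have "Fq_subspace q ?C"
    unfolding Fq_subspace_def
  proof (intro conjI ballI)
    show "0 \<in> ?C" using C[of "\<lambda>_. 0"] by (simp add: in_Fq_iff)
  next
    fix u v assume "u \<in> ?C" "v \<in> ?C"
    then obtain c d where cd: "\<forall>b\<in>B. c b \<in> Fq q" "u = (\<Sum>b\<in>B. c b *s b)"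
        "\<forall>b\<in>B. d b \<in> Fq q" "v = (\<Sum>b\<in>B. d b *s b)"
      by (blast dest!: CE)
    have "u + v = (\<Sum>b\<in>B. (c b + d b) *s b)"
      by (simp add: cd sum.distrib vector_sadd_rdistrib)
    also have "\<dots> \<in> ?C" using cd by (intro C) (auto simp: in_Fq_iff)
    finally show "u + v \<in> ?C" .
  next
    fix k :: 'a and u assume "k \<in> Fq q" "u \<in> ?C"
    then obtain c where c: "\<forall>b\<in>B. c b \<in> Fq q" "u = (\<Sum>b\<in>B. c b *s b)"
      by (blast dest!: CE)
    have "k *s u = (\<Sum>b\<in>B. (k * c b) *s b)"
      by (simp add: c vec.scale_sum_right)
    also have "\<dots> \<in> ?C" using c \<open>k \<in> Fq q\<close> by (intro C) (auto simp: in_Fq_iff)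
    finally show "k *s u \<in> ?C" .
  qed
  moreover have "B \<subseteq> ?C"
  proof
    fix b assume "b \<in> B"
    then have "(\<Sum>b'\<in>B. (if b' = b then 1 else 0) *s b') = b"
      using assms by (simp add: if_distrib[of "\<lambda>k. k *s _"] cong: if_cong)
    then show "b \<in> ?C" using C[of "\<lambda>b'. if b' = b then 1 else 0"] by (simp add: in_Fq_iff)
  qed
  ultimately have "Fq_subspace q hull B \<subseteq> ?C" by (intro hull_minimal)
  then have "card (Fq_subspace q hull B) \<le> card ?C"
    using assms by (intro card_mono finite_imageI finite_PiE) auto
  also have "\<dots> \<le> card (B \<rightarrow>\<^sub>E (Fq q :: 'a set))"
    using assms by (intro card_image_le finite_PiE) auto
  also have "\<dots> = q ^ card B" using assms by (simp add: card_PiE card_Fq)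
  finally show ?thesis .
qed

lemma span_scale_eq:
  fixes u :: "'a ^ 2"
  assumes "k \<noteq> 0"
  shows "vec.span {k *s u} = vec.span {u}"
proof -
  have "l *s u \<in> range (\<lambda>m. m *s (k *s u))" for l
    using assms by (intro image_eqI[of _ _ "l / k"]) auto
  then show ?thesis unfolding vec.span_singleton by auto
qed

lemma repunit_mult: "(q ^ 5 - 1) div (q - 1) * (q - 1) = q ^ 5 - 1"
proof -
  obtain m where "q = Suc m" using q_gt_1 by (cases q) auto
  then have "q ^ 5 = (q - 1) * (q ^ 4 + q ^ 3 + q ^ 2 + q + 1) + 1"
    by (simp add: eval_nat_numeral algebra_simps)
  then show ?thesis by (metis add_diff_cancel_right' dvd_div_mult_self dvd_triv_left)
qed

text \<open>Each point of L carries at least q - 1 non-zero vectors of U, namely the subfield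
  multiples of one of them. With (q ^ 5 - 1) / (q - 1) points and at most q ^ 5 vectors, every
  inequality is tight: U has q ^ 5 elements, and no point carries any further vector, which is
  scatteredness.\<close>

lemma maximum_scattered_obtain:
  assumes "maximum_scattered q L"
  obtains U and B :: "('a ^ 2) set" where "L = linear_set U" "Fq_subspace q U" "finite B" "card B = 5"
    "B \<subseteq> U" "Fq_independent q B" "card U = q ^ 5" "scattered U"
proof -
  obtain U B where UB: "Fq_subspace q U" "finite B" "card B = 5" "Fq_independent q B"
      "Fq_subspace q hull B = U" "L = linear_set U"
    using assms unfolding maximum_scattered_def linear_set_of_rank_def Fq_subspace_of_dim_def by metis
  have cL: "card L = (q ^ 5 - 1) div (q - 1)"
    using assms by (simp add: maximum_scattered_def)
  have "B \<subseteq> U" using UB(5) hull_subset by metis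
  have cU: "card U \<le> q ^ 5" using card_Fq_hull_le[OF UB(2)] UB by simp
  have U0: "0 \<in> U" using UB(1) by (simp add: Fq_subspace_def)
  define fib where "fib = (\<lambda>P. {v \<in> U - {0}. vec.span {v} = P})"
  have Leq: "L = (\<lambda>v. vec.span {v}) ` (U - {0})"
    using UB(6) by (auto simp: linear_set_def)
  have "U - {0} = (\<Union>P\<in>L. fib P)" by (auto simp: Leq fib_def)
  then have sum_fib: "card (U - {0}) = (\<Sum>P\<in>L. card (fib P))"
    by (simp only:) (rule card_UN_disjoint, auto simp: fib_def)
  have fib_sub: "(\<lambda>k. k *s u) ` (Fq q - {0}) \<subseteq> fib (vec.span {u})" if "u \<in> U - {0}" for u
    using that UB(1) by (auto simp: fib_def Fq_subspace_def span_scale_eq)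
  have card_im: "card ((\<lambda>k. k *s u) ` (Fq q - {0})) = q - 1" if "u \<noteq> 0" for u :: "'a ^ 2"
  proof -
    have "inj_on (\<lambda>k. k *s u) (Fq q - {0})"
      using that by (auto simp: inj_on_def)
    then show ?thesis
      by (simp add: card_image card_Diff_singleton card_Fq in_Fq_iff)
  qed
  have fib_ge: "q - 1 \<le> card (fib P)" if P: "P \<in> L" for P
  proof -
    obtain u where u: "u \<in> U - {0}" "P = vec.span {u}" using P Leq by auto
    then have "card ((\<lambda>k. k *s u) ` (Fq q - {0})) \<le> card (fib P)"
      using fib_sub by (intro card_mono) auto
    then show ?thesis using card_im u by simp
  qed
  have total: "(\<Sum>P\<in>L. q - 1) = q ^ 5 - 1"
    using repunit_mult by (simp add: cL)
  have "card (U - {0}) = card U - 1" using U0 by (simp add: card_Diff_singleton)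
  moreover have "(\<Sum>P\<in>L. q - 1) \<le> card (U - {0})"
    unfolding sum_fib by (intro sum_mono fib_ge)
  moreover have "q ^ 5 \<ge> 1" "card U \<ge> 1" using q_gt_1 U0 by (auto simp: Suc_le_eq card_gt_0_iff)
  ultimately have cU': "card U = q ^ 5" and eq: "(\<Sum>P\<in>L. card (fib P)) = (\<Sum>P\<in>L. q - 1)"
    using cU total sum_fib by linarith+
  have "scattered U"
    unfolding scattered_def
  proof (intro ballI allI impI, elim conjE)
    fix u c assume u: "u \<in> U" "u \<noteq> 0" "c *s u \<in> U"
    let ?P = "vec.span {u}"
    have "?P \<in> L" using u Leq by auto
    have "card (fib ?P) = q - 1"
    proof (rule ccontr)
      assume "card (fib ?P) \<noteq> q - 1"
      then have "q - 1 < card (fib ?P)" using fib_ge \<open>?P \<in> L\<close> by fastforce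
      then have "(\<Sum>P\<in>L. q - 1) < (\<Sum>P\<in>L. card (fib P))"
        using \<open>?P \<in> L\<close> fib_ge by (intro sum_strict_mono_ex1) auto
      then show False using eq by simp
    qed
    then have fib: "fib ?P = (\<lambda>k. k *s u) ` (Fq q - {0})"
      using u card_im fib_sub[of u] by (intro card_subset_eq[symmetric]) auto
    show "c \<in> Fq q"
    proof (cases "c = 0")
      case False
      then have "c *s u \<in> fib ?P" using u by (auto simp: fib_def span_scale_eq)
      then obtain k where "k \<in> Fq q" "c *s u = k *s u" unfolding fib by blast
      then show ?thesis using u(2) by simp
    qed (simp add: in_Fq_iff)
  qed
  then show thesis
    using that UB \<open>B \<subseteq> U\<close> cU' by blast
qed

lemma trinomial_obtain:
  fixes B :: "('a ^ 2) set"
  assumes U: "Fq_subspace q U" and B: "finite B" "card B = 5" "B \<subseteq> U" "Fq_independent q B"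
  obtains c1 c2 c3 where "\<And>z. z *s c1 + frob z *s c2 + frob2 z *s c3 \<in> U"
    "\<exists>z. z *s c1 + frob z *s c2 + frob2 z *s c3 \<noteq> 0"
proof -
  define G where "G = (\<lambda>A. (\<Sum>b\<in>B. A b * b $ 1, \<Sum>b\<in>B. A b * b $ 2,
     \<Sum>b\<in>B. A b * frob (b $ 1), \<Sum>b\<in>B. A b * frob (b $ 2)))"
  \<comment> \<open>Pigeonhole instead of dimension theory: (q ^ 5) ^ 5 coefficient tuples meet only
    (q ^ 5) ^ 4 values of \<open>G\<close>. Extensional functions are used so that tuples indexed by
    B can be counted. The difference of two colliding tuples is the required solution.\<close>
  have "\<not> inj_on G (B \<rightarrow>\<^sub>E UNIV)"
  proof
    assume "inj_on G (B \<rightarrow>\<^sub>E UNIV)"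
    then have "card (B \<rightarrow>\<^sub>E (UNIV :: 'a set)) \<le> CARD('a \<times> 'a \<times> 'a \<times> 'a)"
      by (intro card_inj_on_le[of G]) auto
    then have "(q ^ 5) ^ 5 \<le> (q ^ 5) ^ 4"
      using B by (simp add: card_PiE card_field numeral_eq_Suc)
    moreover have "1 < q ^ 5" using q_gt_1 by (rule one_less_power) simp
    ultimately show False by (subst (asm) power_increasing_iff) auto
  qed
  then obtain A1 A2 where A12: "A1 \<in> B \<rightarrow>\<^sub>E UNIV" "A2 \<in> B \<rightarrow>\<^sub>E UNIV" "A1 \<noteq> A2" "G A1 = G A2"
    by (auto simp: inj_on_def)
  define A where "A = (\<lambda>b. A1 b - A2 b)"
  obtain b0 where b0: "b0 \<in> B" "A b0 \<noteq> 0"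
    using A12(1-3) unfolding A_def by (metis PiE_ext right_minus_eq)
  have A0: "(\<Sum>b\<in>B. A b * b $ i) = 0" and A1: "(\<Sum>b\<in>B. A b * frob (b $ i)) = 0" for i
    using A12(4) exhaust_2[of i] by (auto simp: G_def A_def left_diff_distrib sum_subtractf)
  \<comment> \<open>\<open>c k\<close> is the coefficient of \<open>(frob ^^ k) z\<close> in
    \<open>u z\<close>; the two linear equations are exactly what makes \<open>c 0\<close> and
    \<open>c 4\<close> vanish.\<close>
  define c where "c = (\<lambda>k. \<Sum>b\<in>B. (frob ^^ k) (A b) *s b)"
  define u where "u = (\<lambda>z. \<Sum>b\<in>B. tr (A b * z) *s b)"
  have c0: "c 0 = 0" using A0 by (simp add: c_def vec_eq_iff sum_component)
  have "frob (c 4 $ i) = 0" for i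
    using A1[of i] by (simp add: c_def sum_component frob_sum numeral_eq_Suc)
  then have c4: "c 4 = 0" by (simp add: vec_eq_iff)
  have u: "u z = frob z *s c 1 + frob2 z *s c 2 + frob3 z *s c 3" for z
  proof -
    have "u z = z *s c 0 + frob z *s c 1 + frob2 z *s c 2 + frob3 z *s c 3
        + frob4 z *s c 4"
    proof -
      have "tr (A b * z) *s b = z *s ((frob ^^ 0) (A b) *s b) + frob z *s ((frob ^^ 1) (A b) *s b)
          + frob2 z *s ((frob ^^ 2) (A b) *s b) + frob3 z *s ((frob ^^ 3) (A b) *s b)
          + frob4 z *s ((frob ^^ 4) (A b) *s b)" for b
        by (simp add: tr_def vec_eq_iff numeral_eq_Suc algebra_simps)
      then show ?thesis
        unfolding u_def c_def vec.scale_sum_right sum.distrib[symmetric] by (intro sum.cong) auto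
    qed
    then show ?thesis by (simp add: c0 c4)
  qed
  let ?v = "\<lambda>z. z *s c 1 + frob z *s c 2 + frob2 z *s c 3"
  \<comment> \<open>Replacing z by \<open>frob4 z\<close> lowers all three Frobenius exponents by
    one, since \<open>frob\<close> and \<open>frob4\<close> are inverse to each other.\<close>
  have v: "?v z = u (frob4 z)" for z by (simp add: u)
  have "u z \<in> U" for z
    unfolding u_def using U B(3) by (intro Fq_subspace_sum) (auto simp: Fq_subspace_def in_Fq_iff)
  then have "?v z \<in> U" for z unfolding v by blast
  moreover have "\<exists>z. ?v z \<noteq> 0"
  proof -
    \<comment> \<open>The basis is independent over the subfield and all the numbers
      \<open>tr (A b * z)\<close> lie in it, so it is enough to make the one belonging to
      \<open>b0\<close> non-zero.\<close>
    obtain x where x: "tr x \<noteq> 0" using ex_tr_nonzero by auto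
    let ?z = "x / A b0"
    have "u ?z \<noteq> 0"
    proof
      assume "u ?z = 0"
      then have "tr (A b0 * ?z) = 0"
        using B(4) b0(1) unfolding Fq_independent_def u_def
        by (auto simp: in_Fq_iff dest!: spec[of _ "\<lambda>b. tr (A b * ?z)"])
      then show False using x b0 by simp
    qed
    then have "?v (frob ?z) \<noteq> 0" by (simp only: v frob5) simp
    then show ?thesis by blast
  qed
  ultimately show thesis using that by blast
qed

section \<open>Normal forms relative to a basis of the plane\<close>

lemma scattered_line:
  assumes "scattered U" "S \<subseteq> U" "\<And>v. v \<in> S \<Longrightarrow> \<exists>k. v = k *s d"
  shows "card S \<le> q"
proof (cases "S \<subseteq> {0}")
  case True
  then have "card S \<le> card {0 :: 'a ^ 2}" by (intro card_mono) auto
  then show ?thesis using q_gt_1 by simp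
next
  case False
  then obtain u where u: "u \<in> S" "u \<noteq> 0" by auto
  obtain k where k: "u = k *s d" using assms(3) u by blast
  have "S \<subseteq> (\<lambda>c. c *s u) ` Fq q"
  proof
    fix v assume v: "v \<in> S"
    obtain l where l: "v = l *s d" using assms(3) v by blast
    have "v = (l / k) *s u" using k u l by auto
    moreover from this have "l / k \<in> Fq q"
      using assms(1,2) u v unfolding scattered_def by (metis subsetD)
    ultimately show "v \<in> (\<lambda>c. c *s u) ` Fq q" by blast
  qed
  then have "card S \<le> card ((\<lambda>c. c *s u) ` Fq q)" by (intro card_mono) auto
  also have "\<dots> \<le> q" using card_image_le[of "Fq q :: 'a set"] card_Fq by auto
  finally show ?thesis .
qed

text \<open>A non-zero trinomial of q-degree 2 has at most q ^ 2 zeros and hence takes at least q ^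
  3 values, whereas a scattered set has at most q vectors on a line through 0. This excludes the
  degenerate coefficient triples in the case analysis below.\<close>

lemma trinomial_not_in_line:
  assumes "scattered U" and U: "\<And>z. z *s c1 + frob z *s c2 + frob2 z *s c3 \<in> U"
    and nz: "\<exists>z. z *s c1 + frob z *s c2 + frob2 z *s c3 \<noteq> 0"
    and "c1 = k1 *s d" "c2 = k2 *s d" "c3 = k3 *s d"
  shows False
proof -
  let ?u = "\<lambda>z. z *s c1 + frob z *s c2 + frob2 z *s c3"
  have "\<exists>i. c1 $ i \<noteq> 0 \<or> c2 $ i \<noteq> 0 \<or> c3 $ i \<noteq> 0"
  proof (rule ccontr)
    assume "\<not> ?thesis"
    then have "c1 = 0" "c2 = 0" "c3 = 0" by (simp_all add: vec_eq_iff)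
    then show False using nz by simp
  qed
  then obtain i where i: "c1 $ i \<noteq> 0 \<or> c2 $ i \<noteq> 0 \<or> c3 $ i \<noteq> 0" by auto
  have "{z. ?u z = 0} \<subseteq> {z. c1 $ i * z + c2 $ i * frob z + c3 $ i * frob2 z = 0}"
    by (auto simp: vec_eq_iff mult.commute)
  then have "card {z. ?u z = 0} \<le> q ^ 2"
    using card_qpoly3_roots_le[OF i] by (meson card_mono finite_code le_trans)
  moreover have "card (range ?u) \<le> q"
  proof (rule scattered_line[OF assms(1)])
    show "range ?u \<subseteq> U" using U by auto
    show "\<exists>k. v = k *s d" if "v \<in> range ?u" for v
      using that assms(4-6) by (auto simp flip: vector_sadd_rdistrib)
  qed
  moreover have "CARD('a) \<le> card (range ?u) * card {z. ?u z = 0}"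
    by (rule card_le_range_mult_kernel) (simp add: vec_eq_iff algebra_simps)
  ultimately have "q ^ 5 \<le> q * q ^ 2"
    unfolding card_field by (meson le_trans mult_le_mono)
  then show False
    using q_gt_1 power_increasing_iff[of q 5 3] by (simp add: numeral_eq_Suc)
qed

lemma scattered_normal_forms:
  assumes sc: "scattered U" and U: "\<And>z. z *s c1 + frob z *s c2 + frob2 z *s c3 \<in> U"
    and nz: "\<exists>z. z *s c1 + frob z *s c2 + frob2 z *s c3 \<noteq> 0"
  shows "\<exists>d1 d2. wedge d1 d2 \<noteq> 0 \<and>
    ((\<exists>a b. \<forall>z. (z + a * frob z) *s d1 + (frob2 z + b * frob z) *s d2 \<in> U \<and>
        (z \<noteq> 0 \<longrightarrow> (z + a * frob z) *s d1 + (frob2 z + b * frob z) *s d2 \<noteq> 0))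
    \<or> (\<exists>\<delta>. \<delta> \<noteq> 0 \<and> (\<forall>x. x *s d1 + (frob x + \<delta> * frob4 x) *s d2 \<in> U))
    \<or> (\<forall>x. x *s d1 + frob x *s d2 \<in> U)
    \<or> (\<forall>x. x *s d1 + frob4 x *s d2 \<in> U)
    \<or> (\<forall>y. tr y = 0 \<longrightarrow> y *s d1 + frob y *s d2 \<in> U))"
    (is "\<exists>d1 d2. _ \<and> (?A d1 d2 \<or> ?B d1 d2 \<or> ?C d1 d2 \<or> ?D d1 d2 \<or> ?E d1 d2)")
proof -
  let ?u = "\<lambda>z. z *s c1 + frob z *s c2 + frob2 z *s c3"
  show ?thesis
  proof (cases "wedge c1 c3 = 0")
    case False
    then obtain a b where ab: "c2 = a *s c1 + b *s c3" using wedge_nonzero_span by blast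
    have u: "?u z = (z + a * frob z) *s c1 + (frob2 z + b * frob z) *s c3" for z
      by (simp add: ab vec_eq_iff algebra_simps)
    show ?thesis
    proof (cases "\<exists>z. z \<noteq> 0 \<and> ?u z = 0")
      case True
      then obtain z where z: "z \<noteq> 0" "?u z = 0" by auto
      \<comment> \<open>For y = t ^ q - t, subtracting \<open>frob t\<close> times the relation
        \<open>?u z = 0\<close> from \<open>?u (t * z)\<close> cancels the middle coefficient
        \<open>c2\<close>. What remains is -y z in direction \<open>c1\<close> and y ^ q z ^ (q ^ 2)
        in direction \<open>c3\<close>; the factors depending on z go into the new basis.\<close>
      let ?d1 = "(- z) *s c1" and ?d2 = "frob2 z *s c3"
      have "wedge ?d1 ?d2 = - z * frob2 z * wedge c1 c3"
        by (simp add: wedge_def algebra_simps)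
      then have "wedge ?d1 ?d2 \<noteq> 0" using False z by simp
      moreover have "y *s ?d1 + frob y *s ?d2 \<in> U" if y: "tr y = 0" for y
      proof -
        obtain t where t: "y = frob t - t" using tr_zero_imp_ex[OF y] by auto
        have "y *s ?d1 + frob y *s ?d2 = ?u (t * z) - frob t *s ?u z"
          by (simp add: t vec_eq_iff algebra_simps)
        then show ?thesis using U[of "t * z"] z by simp
      qed
      ultimately show ?thesis by blast
    next
      case F2: False
      have "?A c1 c3"
        using F2 U unfolding u by blast
      then show ?thesis using False by blast
    qed
  next
    case w0: True
    show ?thesis
    proof (cases "c1 = 0")
      case True
      have "wedge c2 c3 \<noteq> 0"
      proof
        assume w: "wedge c2 c3 = 0"
        show False
        proof (cases "c2 = 0")
          case True
          then show False
            using trinomial_not_in_line[OF sc U nz, of 0 c3 0 1] \<open>c1 = 0\<close> by simp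
        next
          case False
          then obtain k where "c3 = k *s c2" using wedge_zero_imp_multiple w by blast
          then show False
            using trinomial_not_in_line[OF sc U nz, of 0 c2 1 k] \<open>c1 = 0\<close> by simp
        qed
      qed
      moreover have "x *s c2 + frob x *s c3 \<in> U" for x
        using U[of "frob4 x"] \<open>c1 = 0\<close> by simp
      ultimately show ?thesis by blast
    next
      case False
      then obtain \<delta> where \<delta>: "c3 = \<delta> *s c1" using wedge_zero_imp_multiple w0 by blast
      have w: "wedge c2 c1 \<noteq> 0"
      proof
        assume "wedge c2 c1 = 0"
        then have "wedge c1 c2 = 0" by (simp add: wedge_def algebra_simps)
        then obtain k where "c2 = k *s c1" using wedge_zero_imp_multiple False by blast
        then show False
          using trinomial_not_in_line[OF sc U nz, of 1 c1 k \<delta>] \<delta> by simp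
      qed
      \<comment> \<open>At z = \<open>frob4 x\<close> the middle term carries x itself. Both outer
        coefficients are multiples of \<open>c1\<close>, so U becomes a graph over direction
        \<open>c2\<close>.\<close>
      have *: "x *s c2 + (frob4 x + \<delta> * frob x) *s c1 \<in> U" for x
      proof -
        have "?u (frob4 x) =
            x *s c2 + (frob4 x + \<delta> * frob x) *s c1"
          by (simp add: \<delta> vec_eq_iff algebra_simps)
        then show ?thesis using U by metis
      qed
      show ?thesis
      proof (cases "\<delta> = 0")
        case True
        then have "?D c2 c1" using * by simp
        then show ?thesis using w by blast
      next
        case False
        have "wedge c2 (\<delta> *s c1) = \<delta> * wedge c2 c1"
          by (simp add: wedge_def algebra_simps)
        then have "wedge c2 (\<delta> *s c1) \<noteq> 0" using w False by simp
        \<comment> \<open>Absorbing \<delta> into the second basis vector makes the coefficient of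
          \<open>frob x\<close> equal to 1; the parameter of the form is therefore 1 /
          \<delta>.\<close>
        moreover have "?B c2 (\<delta> *s c1)"
        proof (intro exI[of _ "1 / \<delta>"] conjI allI)
          show "1 / \<delta> \<noteq> 0" using False by simp
          fix x
          have "(frob x + 1 / \<delta> * frob4 x) *s (\<delta> *s c1)
              = (frob4 x + \<delta> * frob x) *s c1"
            using False by (simp add: vec_eq_iff field_simps)
          then show "x *s c2 + (frob x + 1 / \<delta> * frob4 x) *s (\<delta> *s c1) \<in> U"
            using *[of x] by (simp only:)
        qed
        ultimately show ?thesis by blast
      qed
    qed
  qed
qed

text \<open>Coordinates with respect to d1, d2 are given by Cramer's rule and are linear, so the
  identity serves as field automorphism. The graph already has q ^ 5 elements, which upgrades its
  containment in U to equality.\<close>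

lemma graph_equivalent:
  assumes w: "wedge d1 d2 \<noteq> 0" and cU: "card U = q ^ 5"
    and U: "\<And>x. x *s d1 + g x *s d2 \<in> U" and g0: "g 0 = 0"
  shows "PGammaL_equivalent (linear_set U) {vec.span {vector [x, g x]} | x::'a. x \<noteq> 0}"
proof -
  define h where "h = (\<lambda>x. x *s d1 + g x *s d2)"
  have inj: "inj h" using wedge_nonzero_independent[OF w] by (auto simp: inj_on_def h_def)
  have "range h \<subseteq> U" using U by (auto simp: h_def)
  moreover have "card U \<le> card (range h)" using cU inj by (simp add: card_image card_field)
  ultimately have Ueq: "U = range h" by (metis card_seteq finite_code)
  have h0: "h x = 0 \<longleftrightarrow> x = 0" for x
    using injD[OF inj, of x 0] by (auto simp: h_def g0)
  define f :: "'a ^ 2 \<Rightarrow> 'a ^ 2" where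
    "f = (\<lambda>v. vector [wedge v d2 / wedge d1 d2, wedge d1 v / wedge d1 d2])"
  have f_basis: "f (x *s d1 + y *s d2) = vector [x, y]" for x y
    using w by (simp add: f_def vec2_eq_iff wedge_def divide_simps) (simp add: algebra_simps)
  have f_add: "f (u + v) = f u + f v" for u v
    by (simp add: f_def vec2_eq_iff wedge_def algebra_simps add_divide_distrib diff_divide_distrib)
  have f_scale: "f (c *s v) = c *s f v" for c v
    by (simp add: f_def vec2_eq_iff wedge_def algebra_simps)
  have f_surj: "surj f"
  proof (rule surjI)
    fix v :: "'a ^ 2"
    show "f (v $ 1 *s d1 + v $ 2 *s d2) = v" by (simp add: f_basis vec2_eq_iff)
  qed
  then have "bij f" by (simp add: finite_UNIV_surj_inj bij_def)
  moreover have "field_automorphism (\<lambda>x::'a. x)" by (simp add: field_automorphism_def bij_id[unfolded id_def])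
  ultimately have "semilinear_bij f"
    unfolding semilinear_bij_def using f_add f_scale by blast
  moreover have f_span: "f ` vec.span {v} = vec.span {f v}" for v
    unfolding vec.span_singleton by (auto simp: f_scale image_iff)
  have "(\<lambda>P. f ` P) ` linear_set U = {vec.span {vector [x, g x]} | x::'a. x \<noteq> 0}"
  proof -
    have "U - {0} = h ` {x. x \<noteq> 0}"
      by (subst Ueq) (auto simp: h0)
    then have "linear_set U = (\<lambda>x. vec.span {h x}) ` {x. x \<noteq> 0}"
      unfolding linear_set_def by (simp only:) auto
    then have "(\<lambda>P. f ` P) ` linear_set U = (\<lambda>x. vec.span {f (h x)}) ` {x. x \<noteq> 0}"
      by (simp add: image_image f_span)
    also have "\<dots> = (\<lambda>x. vec.span {vector [x, g x]}) ` {x. x \<noteq> 0}"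
      by (simp add: h_def f_basis)
    finally show ?thesis by auto
  qed
  ultimately show ?thesis unfolding PGammaL_equivalent_def by blast
qed

section \<open>Criteria for the two types and obstructions to scatteredness\<close>

lemma pseudoregulus_typeI:
  assumes "wedge d1 d2 \<noteq> 0" "card U = q ^ 5" "coprime s 5"
    "\<And>x. x *s d1 + (frob ^^ s) x *s d2 \<in> U"
  shows "pseudoregulus_type q (linear_set U)"
proof -
  have "(frob ^^ s) 0 = 0" by (induction s) auto
  then show ?thesis
    unfolding pseudoregulus_type_def
    using assms graph_equivalent[of d1 d2 U "frob ^^ s"]
    by (intro exI[of _ s]) (simp add: power_q_power)
qed

lemma LP_typeI:
  assumes "wedge d1 d2 \<noteq> 0" "card U = q ^ 5" "coprime s 5" "s < 5" "nm \<delta> \<noteq> 0" "nm \<delta> \<noteq> 1"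
    "\<And>x. x *s d1 + ((frob ^^ s) x + \<delta> * (frob ^^ (5 - s)) x) *s d2 \<in> U"
  shows "LP_type q (linear_set U)"
proof -
  have "(frob ^^ k) 0 = 0" for k by (induction k) auto
  then show ?thesis
    unfolding LP_type_def
    using assms graph_equivalent[of d1 d2 U "\<lambda>x. (frob ^^ s) x + \<delta> * (frob ^^ (5 - s)) x"]
    by (intro exI[of _ s] exI[of _ \<delta>]) (simp add: power_q_power Fq5_norm_eq)
qed

text \<open>Put d = 1 / w. The left side is the determinant of the vectors of U with parameters d
  and t d, divided by d d ^ q d ^ (q ^ 2). Passing from d to w removes all denominators, so a
  witness can be checked by ring operations and Frobenius alone.\<close>

definition dependent_pair :: "'a \<Rightarrow> 'a \<Rightarrow> bool" where
  "dependent_pair a b \<longleftrightarrow> (\<exists>t w. w \<noteq> 0 \<and> frob t \<noteq> t \<and>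
     (let u = frob t - t in (u + frob u) * frob w + b * u * frob2 w + a * frob u * w = 0))"

text \<open>A zero determinant makes the vectors for d and t d proportional; scatteredness puts the
  factor c into the subfield. The parametrisation is linear over the subfield with trivial kernel,
  so t d = c d, and t = c contradicts \<open>frob t \<noteq> t\<close>.\<close>

lemma dependent_pair_not_scattered:
  assumes w: "wedge d1 d2 \<noteq> 0" and dep: "dependent_pair a b"
    and U: "\<And>z. (z + a * frob z) *s d1 + (frob2 z + b * frob z) *s d2 \<in> U"
    and nz: "\<And>z. z \<noteq> 0 \<Longrightarrow> (z + a * frob z) *s d1 + (frob2 z + b * frob z) *s d2 \<noteq> 0"
  shows "\<not> scattered U"
proof
  assume sc: "scattered U"
  let ?h = "\<lambda>z. (z + a * frob z) *s d1 + (frob2 z + b * frob z) *s d2"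
  obtain t w where tw: "w \<noteq> 0" "frob t \<noteq> t"
      "(frob t - t + frob (frob t - t)) * frob w + b * (frob t - t) * frob2 w
        + a * frob (frob t - t) * w = 0"
    using dep by (auto simp: dependent_pair_def Let_def)
  define d where "d = 1 / w"
  let ?e = "t * d"
  have d0: "d \<noteq> 0" using tw by (simp add: d_def)
  have wd: "w * d = 1" "frob w * frob d = 1" "frob2 w * frob2 d = 1"
    using tw(1) by (simp_all add: d_def)
  have "frob2 d * frob d * d * ((frob t - t + frob (frob t - t)) * frob w + b * (frob t - t) * frob2 w
        + a * frob (frob t - t) * w) =
      (d + a * frob d) * (frob2 ?e + b * frob ?e) - (frob2 d + b * frob d) * (?e + a * frob ?e)"
    (is "?L = ?R")
  proof -
    have "?L = (frob2 t - t) * (frob2 d * d) * (frob w * frob d)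
        + b * (frob t - t) * (frob d * d) * (frob2 w * frob2 d)
        + a * (frob2 t - frob t) * (frob2 d * frob d) * (w * d)"
      by (simp add: algebra_simps)
    also have "\<dots> = ?R" unfolding wd by (simp add: algebra_simps)
    finally show ?thesis .
  qed
  then have eq: "(d + a * frob d) * (frob2 ?e + b * frob ?e) - (frob2 d + b * frob d) * (?e + a * frob ?e) = 0"
    using tw(3) by simp
  have "wedge (?h d) (?h ?e) = ((d + a * frob d) * (frob2 ?e + b * frob ?e)
      - (frob2 d + b * frob d) * (?e + a * frob ?e)) * wedge d1 d2"
    by (simp add: wedge_def algebra_simps del: frob_mult)
  then have "wedge (?h d) (?h ?e) = 0" using eq by simp
  then obtain c where c: "?h ?e = c *s ?h d" using wedge_zero_imp_multiple nz[OF d0] by blast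
  have "c *s ?h d \<in> U" unfolding c[symmetric] by (rule U)
  then have "c \<in> Fq q" using sc U[of d] nz[OF d0] unfolding scattered_def by blast
  then have cf: "frob c = c" by (simp add: in_Fq_iff)
  have "?h (?e - c * d) = ?h ?e - c *s ?h d"
    by (simp add: cf vec_eq_iff algebra_simps)
  then have "?e - c * d = 0" using nz[of "?e - c * d"] c by auto
  then have "t = c" using d0 by simp
  then show False using cf tw(2) by simp
qed

text \<open>At most q ^ 4 vectors lie over the trace hyperplane, so U contains a further v =
  \<alpha> d1 + \<beta> d2. If \<alpha> has trace 0, subtracting the hyperplane vector over \<alpha>
  leaves a non-zero multiple of d2. Otherwise v generates the rest of U, and its deviation from
  (\<alpha>, \<alpha> ^ q), divided by the trace of \<alpha>, is -\<psi>.\<close>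

lemma trace_hyperplane_extension:
  assumes sub: "Fq_subspace q U" and cU: "card U = q ^ 5" and w: "wedge d1 d2 \<noteq> 0"
    and H: "\<And>y. tr y = 0 \<Longrightarrow> y *s d1 + frob y *s d2 \<in> U"
  shows "\<exists>\<psi>. (\<forall>x. x *s d1 + (frob x - \<psi> * tr x) *s d2 \<in> U) \<or> \<psi> \<noteq> 0 \<and> \<psi> *s d2 \<in> U"
proof -
  let ?H = "(\<lambda>y. y *s d1 + frob y *s d2) ` {y. tr y = 0}"
  have add: "u + v \<in> U" if "u \<in> U" "v \<in> U" for u v using sub that by (simp add: Fq_subspace_def)
  have scale: "c *s u \<in> U" if "u \<in> U" "frob c = c" for c u
    using sub that by (simp add: Fq_subspace_def in_Fq_iff)
  have "card ?H \<le> q ^ 4"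
    by (rule le_trans[OF card_image_le card_tr_kernel_le]) simp
  also have "\<dots> < card U" using cU q_gt_1 by simp
  finally have "\<not> U \<subseteq> ?H" using card_mono[of ?H U] by auto
  then obtain v where v: "v \<in> U" "v \<notin> ?H" by auto
  obtain \<alpha> \<beta> where ab: "v = \<alpha> *s d1 + \<beta> *s d2" using wedge_nonzero_span[OF w] by blast
  show ?thesis
  proof (cases "tr \<alpha> = 0")
    case True
    have "(\<beta> - frob \<alpha>) *s d2 = v + (-1) *s (\<alpha> *s d1 + frob \<alpha> *s d2)"
      by (simp add: ab vec_eq_iff algebra_simps)
    also have "\<dots> \<in> U" by (intro add scale v(1) H True) simp
    finally have "(\<beta> - frob \<alpha>) *s d2 \<in> U" .
    moreover have "\<beta> - frob \<alpha> \<noteq> 0" using v(2) True ab by auto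
    ultimately show ?thesis by blast
  next
    case False
    define \<psi> where "\<psi> = (frob \<alpha> - \<beta>) / tr \<alpha>"
    have "x *s d1 + (frob x - \<psi> * tr x) *s d2 \<in> U" for x
    proof -
      define k where "k = tr x / tr \<alpha>"
      have fk: "frob k = k" by (simp add: k_def)
      define y where "y = x - k * \<alpha>"
      have "tr y = 0" using False by (simp add: y_def tr_diff tr_scale fk) (simp add: k_def)
      have "\<psi> * tr x = k * (frob \<alpha> - \<beta>)" by (simp add: \<psi>_def k_def)
      then have "x *s d1 + (frob x - \<psi> * tr x) *s d2 = x *s d1 + (frob x - k * (frob \<alpha> - \<beta>)) *s d2"
        by simp
      also have "\<dots> = (y *s d1 + frob y *s d2) + k *s v"
        by (simp add: ab y_def fk vec_eq_iff algebra_simps)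
      also have "\<dots> \<in> U" by (intro add scale v(1) H \<open>tr y = 0\<close> fk)
      finally show ?thesis .
    qed
    then show ?thesis by blast
  qed
qed

text \<open>With these y and s, the multiple of (y, y ^ q) by s is (y s, (y s) ^ q - \<psi>). It
  lies in U when the trace of y s is 1 and U consists of the vectors (x, x ^ q - \<psi> tr x), or
  when that trace is 0 and U contains (0, \<psi>). For non-zero \<psi> the factor s is outside the
  subfield, so U is not scattered.\<close>

definition trace_witness :: "'a \<Rightarrow> 'a \<Rightarrow> bool" where
  "trace_witness \<psi> \<tau> \<longleftrightarrow> (\<exists>y s. tr y = 0 \<and> \<psi> = frob y * (frob s - s) \<and> tr (y * s) = \<tau>)"

text \<open>Scaling s by k allows \<psi> to be normalised by the subfield; the price is that targets
  \<tau> other than 0 and 1 have to be treated.\<close>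

lemma trace_witness_scale:
  assumes "trace_witness \<psi> \<tau>" "frob k = k"
  shows "trace_witness (k * \<psi>) (k * \<tau>)"
proof -
  obtain y s where "tr y = 0" "\<psi> = frob y * (frob s - s)" "tr (y * s) = \<tau>"
    using assms(1) by (auto simp: trace_witness_def)
  moreover have "tr (y * (k * s)) = k * tr (y * s)"
    using tr_scale[OF assms(2), of "y * s"] by (simp add: mult.left_commute)
  moreover have "k * (frob y * (frob s - s)) = frob y * (frob (k * s) - k * s)"
    using assms(2) by (simp add: algebra_simps)
  ultimately have "tr y = 0 \<and> k * \<psi> = frob y * (frob (k * s) - k * s) \<and> tr (y * (k * s)) = k * \<tau>"
    by simp
  then show ?thesis unfolding trace_witness_def by blast
qed

lemma trace_witness_not_scattered:
  assumes w: "wedge d1 d2 \<noteq> 0" and \<psi>: "\<psi> \<noteq> 0"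
    and H: "\<And>y. tr y = 0 \<Longrightarrow> y *s d1 + frob y *s d2 \<in> U"
    and wit: "\<exists>y s. tr y = 0 \<and> \<psi> = frob y * (frob s - s) \<and>
      (y * s) *s d1 + (frob (y * s) - \<psi>) *s d2 \<in> U"
  shows "\<not> scattered U"
proof
  assume sc: "scattered U"
  obtain y s where ys: "tr y = 0" "\<psi> = frob y * (frob s - s)"
      "(y * s) *s d1 + (frob (y * s) - \<psi>) *s d2 \<in> U"
    using wit by auto
  have "y \<noteq> 0" using \<psi> ys by auto
  then have nz: "y *s d1 + frob y *s d2 \<noteq> 0"
    using wedge_nonzero_independent[OF w, of y "frob y" 0 0] by auto
  have "(y * s) *s d1 + (frob (y * s) - \<psi>) *s d2 = s *s (y *s d1 + frob y *s d2)"
    by (simp add: ys(2) vec_eq_iff algebra_simps)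
  then have "s \<in> Fq q" using sc ys(3) H[OF ys(1)] nz unfolding scattered_def by metis
  then show False using \<psi> ys(2) by (simp add: in_Fq_iff)
qed

text \<open>Proportionality of the vectors for x and t x with factor t means v ^ q x ^ q = v
  \<delta> x ^ (q ^ 4) for v = t - t ^ (q ^ 4). Writing \<delta> by Hilbert 90 removes it through x
  = y \<nu>. The remaining equation v ^ q y ^ q = v y ^ (q ^ 4) is solved by v = y ^ q y ^ (q ^ 2) y
  ^ (q ^ 3), both sides being the product of the four proper conjugates of y; such a t exists once v
  has trace 0.\<close>

lemma nm_1_not_scattered:
  assumes y: "y \<noteq> 0" "tr (y * frob y * frob2 y) = 0" and w: "wedge d1 d2 \<noteq> 0" and \<delta>: "nm \<delta> = 1"
    and U: "\<And>x. x *s d1 + (frob x + \<delta> * frob4 x) *s d2 \<in> U"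
  shows "\<not> scattered U"
proof
  assume sc: "scattered U"
  let ?h = "\<lambda>x. x *s d1 + (frob x + \<delta> * frob4 x) *s d2"
  obtain \<mu> where \<mu>: "\<mu> \<noteq> 0" "\<mu> = \<delta> * frob \<mu>" using hilbert90[OF \<delta>] by auto
  \<comment> \<open>Chosen so that \<delta> \<nu> ^ (q ^ 4) = \<nu> ^ q: the two sides are \<delta>
    \<mu> ^ q \<mu> ^ (q ^ 3) and \<mu> \<mu> ^ (q ^ 3), and \<mu> = \<delta> \<mu> ^ q.\<close>
  define \<nu> where "\<nu> = frob4 \<mu> * frob2 \<mu>"
  have \<nu>0: "\<nu> \<noteq> 0" using \<mu> by (simp add: \<nu>_def)
  have \<nu>: "\<delta> * frob4 \<nu> = frob \<nu>"
  proof -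
    have "frob4 \<nu> = frob3 \<mu> * frob \<mu>" by (simp add: \<nu>_def)
    moreover have "frob \<nu> = \<mu> * frob3 \<mu>" by (simp add: \<nu>_def)
    ultimately show ?thesis using \<mu>(2) by (simp add: algebra_simps)
  qed
  define v where "v = frob (y * frob y * frob2 y)"
  have "tr v = 0" using y(2) by (simp only: v_def tr_frob)
  then obtain s where s: "v = frob s - s" using tr_zero_imp_ex by blast
  define t where "t = frob s"
  have t: "v = t - frob4 t" by (simp add: s t_def)
  have fv: "frob v = frob t - t" by (simp add: t)
  define x where "x = y * \<nu>"
  have x0: "x \<noteq> 0" using y \<nu>0 by (simp add: x_def)
  have vx: "frob v * frob x = v * (\<delta> * frob4 x)"
  proof -
    have "frob v * frob x = frob v * frob y * frob \<nu>" by (simp add: x_def)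
    also have "\<dots> = v * frob4 y * frob \<nu>" by (simp add: v_def)
    also have "\<dots> = v * frob4 y * (\<delta> * frob4 \<nu>)"
      by (simp only: \<nu>)
    also have "\<dots> = v * (\<delta> * frob4 x)"
      by (simp add: x_def)
    finally show ?thesis .
  qed
  have "frob (t * x) + \<delta> * frob4 (t * x) =
      t * (frob x + \<delta> * frob4 x)"
  proof -
    have "frob (t * x) + \<delta> * frob4 (t * x) - t * (frob x + \<delta> * frob4 x)
        = (frob t - t) * frob x - (t - frob4 t) * (\<delta> * frob4 x)"
      by (simp add: algebra_simps)
    also have "\<dots> = 0" by (simp only: fv[symmetric] t[symmetric] vx) simp
    finally show ?thesis by simp
  qed
  then have "?h (t * x) = t *s ?h x" by (simp only: vector_scalar_add_ldistrib vector_smult_assoc)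
  then have "t *s ?h x \<in> U" using U[of "t * x"] by (simp only:)
  moreover have "?h x \<noteq> 0"
    using wedge_nonzero_independent[OF w, of x "frob x + \<delta> * frob4 x" 0 0] x0 by auto
  ultimately have "t \<in> Fq q" using sc U[of x] unfolding scattered_def by blast
  then have "frob v = 0" using fv by (simp add: in_Fq_iff)
  then show False using y(1) by (simp add: v_def)
qed

section \<open>Normalised coefficients and the general classification\<close>

lemma frob_power: "frob (x ^ n) = frob x ^ n"
  by (induction n) simp_all

lemma nm_mult: "nm (x * y) = nm x * nm y"
  by (simp add: nm_def algebra_simps)

lemma frob_nm [simp]: "frob (nm x) = nm x"
  by (simp add: nm_def algebra_simps)

lemma nm_Fq: "frob c = c \<Longrightarrow> nm c = c ^ 5"
  by (simp add: nm_def numeral_eq_Suc)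

lemma nm_eq_0_iff [simp]: "nm x = 0 \<longleftrightarrow> x = 0"
  by (simp add: nm_def)

text \<open>Substituting \<open>l * z\<close> for \<open>z\<close> multiplies \<open>a\<close> by \<open>l ^ (q - 1)\<close>, hence by an arbitrary element
  of norm 1.\<close>
lemma normalize_coefficient:
  assumes "\<And>c. frob c = c \<Longrightarrow> (c ^ m) ^ 5 = c"
  obtains k l where "frob k = k" "l \<noteq> 0" "a * frob l = k * l" "a \<noteq> 0 \<Longrightarrow> k \<noteq> 0"
proof (cases "a = 0")
  case True
  then show thesis using that[of 0 1] by simp
next
  case False
  \<comment> \<open>A fifth root of the norm of a inside the subfield. There the norm is the fifth
    power, so k and a have equal norm and Hilbert 90 applies to a / k.\<close>
  define k where "k = nm a ^ m"
  have fk: "frob k = k" by (simp add: k_def frob_power)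
  have k0: "k \<noteq> 0" using False by (simp add: k_def)
  have "nm k = nm a" using assms[of "nm a"] by (simp add: nm_Fq[OF fk]) (simp add: k_def)
  have "k * (a / k) = a" using k0 by simp
  then have "nm k * nm (a / k) = nm a" by (metis nm_mult)
  then have "nm (a / k) = 1" using \<open>nm k = nm a\<close> False by simp
  then obtain l where "l \<noteq> 0" "l = a / k * frob l" using hilbert90 by blast
  then show thesis using that[of k l] fk k0 by (simp add: field_simps)
qed

text \<open>After the substitution \<rho> both coordinates are combinations of x and x ^ (q ^ 2) +
  \<delta> x ^ (q ^ 3), so the matrix of the \<open>m\<close> entries, moved into the basis,
  exhibits an LP graph with s = 2. As \<delta> is in the subfield, its norm is \<delta> ^ 5.\<close>

lemma LP_type_reparametrized:
  assumes w: "wedge d1 d2 \<noteq> 0" and cU: "card U = q ^ 5" and U: "\<And>z. P z *s d1 + Q z *s d2 \<in> U"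
    and P: "\<And>x. P (\<rho> x) = m11 * x + m12 * (frob2 x + \<delta> * frob3 x)"
    and Q: "\<And>x. Q (\<rho> x) = m21 * x + m22 * (frob2 x + \<delta> * frob3 x)"
    and det: "m11 * m22 - m12 * m21 \<noteq> 0" and \<delta>: "frob \<delta> = \<delta>" "\<delta> ^ 5 \<noteq> 0" "\<delta> ^ 5 \<noteq> 1"
  shows "LP_type q (linear_set U)"
proof (rule LP_typeI[where s = 2 and \<delta> = \<delta>])
  let ?d1 = "m11 *s d1 + m21 *s d2" and ?d2 = "m12 *s d1 + m22 *s d2"
  have "wedge ?d1 ?d2 = (m11 * m22 - m12 * m21) * wedge d1 d2"
    by (simp add: wedge_def algebra_simps)
  then show "wedge ?d1 ?d2 \<noteq> 0" using det w by simp
  show "card U = q ^ 5" "(2::nat) < 5" by (simp_all add: cU)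
  show "coprime 2 (5::nat)" by (simp add: coprime_iff_gcd_eq_1 gcd_non_0_nat)
  show "nm \<delta> \<noteq> 0" "nm \<delta> \<noteq> 1" using \<delta> by (simp_all add: nm_Fq)
  fix x
  have "x *s ?d1 + ((frob ^^ 2) x + \<delta> * (frob ^^ (5 - 2)) x) *s ?d2 = P (\<rho> x) *s d1 + Q (\<rho> x) *s d2"
    by (simp add: P Q numeral_eq_Suc vec_eq_iff algebra_simps)
  also have "\<dots> \<in> U" by (rule U)
  finally show "x *s ?d1 + ((frob ^^ 2) x + \<delta> * (frob ^^ (5 - 2)) x) *s ?d2 \<in> U" .
qed

text \<open>For x = z + a z ^ q the relations a b = 1 and a ^ q = a give b x ^ q = z ^ (q ^ 2) + b z
  ^ q, so U is a graph with s = 1 provided z -> x is onto. A kernel element satisfies z = -a z ^ q;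
  five iterations give z = (-a) ^ 5 z, and a ^ 5 \<noteq> -1 forces z = 0.\<close>

lemma pseudoregulus_inverse_coefficients:
  assumes w: "wedge d1 d2 \<noteq> 0" and cU: "card U = q ^ 5"
    and U: "\<And>z. (z + a * frob z) *s d1 + (frob2 z + b * frob z) *s d2 \<in> U"
    and a: "frob a = a" "a * b = 1" "a ^ 5 \<noteq> - 1"
  shows "pseudoregulus_type q (linear_set U)"
proof (rule pseudoregulus_typeI[where s = 1])
  have "wedge d1 (b *s d2) = b * wedge d1 d2" by (simp add: wedge_def algebra_simps)
  then show "wedge d1 (b *s d2) \<noteq> 0" using w a(2) by auto
  show "card U = q ^ 5" "coprime 1 (5::nat)" by (simp_all add: cU)
  let ?f = "\<lambda>z. z + a * frob z"
  have "inj ?f"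
  proof (rule injI)
    fix x y assume "?f x = ?f y"
    define z where "z = x - y"
    have z1: "z = (- a) * frob z" using \<open>?f x = ?f y\<close> by (simp add: z_def algebra_simps)
    have step: "frob v = (- a) * frob2 v" if "v = (- a) * frob v" for v
    proof -
      have "frob v = frob ((- a) * frob v)" by (rule arg_cong[OF that])
      then show ?thesis by (simp only: frob_mult frob_minus a(1))
    qed
    note z2 = step[OF z1]
    note z3 = step[OF z2]
    note z4 = step[OF z3]
    note z5 = step[OF z4]
    have "z = (- a) * ((- a) * ((- a) * ((- a) * ((- a) * frob (frob4 z)))))"
      by (simp only: z5[symmetric] z4[symmetric] z3[symmetric] z2[symmetric] z1[symmetric])
    also have "\<dots> = (- a) ^ 5 * z" by (simp add: numeral_eq_Suc)
    finally have "z = (- a) ^ 5 * z" .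
    moreover have "z * (a ^ 5 + 1) = z - (- a) ^ 5 * z" by (simp add: algebra_simps)
    ultimately have "z * (a ^ 5 + 1) = 0" by simp
    moreover have "a ^ 5 + 1 \<noteq> 0" using a(3) by (simp add: add_eq_0_iff2)
    ultimately show "x = y" by (simp add: z_def)
  qed
  then have "surj ?f" by (rule finite_UNIV_inj_surj[OF finite])
  fix x
  obtain z where z: "x = ?f z" using \<open>surj ?f\<close> by (auto dest: surjD)
  have "b * frob x = frob2 z + b * frob z"
  proof -
    have "b * frob x = b * frob z + (a * b) * frob2 z" using a(1) by (simp add: z algebra_simps)
    then show ?thesis using a(2) by (simp add: algebra_simps)
  qed
  then have "x *s d1 + (frob ^^ 1) x *s (b *s d2) = ?f z *s d1 + (frob2 z + b * frob z) *s d2"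
    by (simp add: z mult.commute)
  also have "\<dots> \<in> U" by (rule U)
  finally show "x *s d1 + (frob ^^ 1) x *s (b *s d2) \<in> U" .
qed

text \<open>Quantified over U and the basis so that the general classification can take the
  exceptional parameters as a hypothesis, to be discharged for each field separately.\<close>

definition LP_pair :: "'a \<Rightarrow> 'a \<Rightarrow> bool" where
  "LP_pair a b \<longleftrightarrow> (\<forall>U d1 d2. wedge d1 d2 \<noteq> 0 \<and> card U = q ^ 5 \<and>
     (\<forall>z. (z + a * frob z) *s d1 + (frob2 z + b * frob z) *s d2 \<in> U) \<longrightarrow> LP_type q (linear_set U))"

definition LP_trace :: "'a \<Rightarrow> bool" where
  "LP_trace \<psi> \<longleftrightarrow> (\<forall>U d1 d2. wedge d1 d2 \<noteq> 0 \<and> card U = q ^ 5 \<and>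
     (\<forall>x. x *s d1 + (frob x - \<psi> * tr x) *s d2 \<in> U) \<longrightarrow> LP_type q (linear_set U))"

text \<open>Substitute l z for z and absorb l and l ^ (q ^ 2) into the basis vectors. This
  multiplies a by l ^ (q - 1) and b by l ^ q / l ^ (q ^ 2).\<close>

lemma rescale_pair:
  assumes "l \<noteq> 0" "wedge d1 d2 \<noteq> 0"
    and U: "\<And>z. (z + a * frob z) *s d1 + (frob2 z + b * frob z) *s d2 \<in> U \<and>
        (z \<noteq> 0 \<longrightarrow> (z + a * frob z) *s d1 + (frob2 z + b * frob z) *s d2 \<noteq> 0)"
    and a': "a * frob l = a' * l" and b': "b * frob l = b' * frob2 l"
  obtains e1 e2 where "wedge e1 e2 \<noteq> 0"
    "\<And>z. (z + a' * frob z) *s e1 + (frob2 z + b' * frob z) *s e2 \<in> U"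
    "\<And>z. z \<noteq> 0 \<Longrightarrow> (z + a' * frob z) *s e1 + (frob2 z + b' * frob z) *s e2 \<noteq> 0"
proof -
  let ?e1 = "l *s d1" and ?e2 = "frob2 l *s d2"
  have "wedge ?e1 ?e2 = l * frob2 l * wedge d1 d2" by (simp add: wedge_def algebra_simps)
  then have "wedge ?e1 ?e2 \<noteq> 0" using assms(1,2) by simp
  moreover have eq: "(z + a' * frob z) *s ?e1 + (frob2 z + b' * frob z) *s ?e2 =
      (l * z + a * frob (l * z)) *s d1 + (frob2 (l * z) + b * frob (l * z)) *s d2" for z
  proof -
    have "(z + a' * frob z) * l = l * z + a * frob (l * z)"
      using a' by (simp add: algebra_simps)
    moreover have "(frob2 z + b' * frob z) * frob2 l = frob2 (l * z) + b * frob (l * z)"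
      using b' by (simp add: algebra_simps)
    ultimately show ?thesis by (simp only: vector_smult_assoc)
  qed
  ultimately show thesis
    using U[of "l * z" for z] assms(1) by (intro that[of ?e1 ?e2]) (simp_all only: eq, auto)
qed

text \<open>Everything that depends on the particular q is isolated in the hypotheses.
  \<open>root5\<close> says that raising to the power m inverts the fifth power on the
  subfield.\<close>

theorem classification:
  fixes L :: "('a ^ 2) set set"
  assumes max: "maximum_scattered q L"
    and root5: "\<And>c. frob c = c \<Longrightarrow> (c ^ m) ^ 5 = c"
    and pairs: "\<And>a b. frob a = a \<Longrightarrow> a \<noteq> 0 \<Longrightarrow>
      dependent_pair a b \<or> a * b = 1 \<and> a ^ 5 \<noteq> - 1 \<or> LP_pair a b"
    and pairs0: "\<And>b. frob b = b \<Longrightarrow> b \<noteq> 0 \<Longrightarrow> dependent_pair 0 b"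
    and trace1: "\<And>\<psi>. \<psi> \<noteq> 0 \<Longrightarrow> trace_witness \<psi> 1 \<or> LP_trace \<psi>"
    and trace0: "\<And>\<psi>. \<psi> \<noteq> 0 \<Longrightarrow> trace_witness \<psi> 0"
    and cubic: "\<exists>y. y \<noteq> 0 \<and> tr (y * frob y * frob2 y) = 0"
  shows "pseudoregulus_type q L \<or> LP_type q L"
proof -
  obtain U and B :: "('a ^ 2) set" where UB: "L = linear_set U" "Fq_subspace q U" "finite B" "card B = 5"
    "B \<subseteq> U" "Fq_independent q B" "card U = q ^ 5" "scattered U"
    using maximum_scattered_obtain[OF max] .
  note sub = UB(2) and cU = UB(7) and sc = UB(8)
  obtain c1 c2 c3 where c: "\<And>z. z *s c1 + frob z *s c2 + frob2 z *s c3 \<in> U"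
    "\<exists>z. z *s c1 + frob z *s c2 + frob2 z *s c3 \<noteq> 0"
    using trinomial_obtain[OF UB(2-6)] by blast
  obtain d1 d2 where w: "wedge d1 d2 \<noteq> 0" and cases:
    "(\<exists>a b. \<forall>z. (z + a * frob z) *s d1 + (frob2 z + b * frob z) *s d2 \<in> U \<and>
        (z \<noteq> 0 \<longrightarrow> (z + a * frob z) *s d1 + (frob2 z + b * frob z) *s d2 \<noteq> 0))
    \<or> (\<exists>\<delta>. \<delta> \<noteq> 0 \<and> (\<forall>x. x *s d1 + (frob x + \<delta> * frob4 x) *s d2 \<in> U))
    \<or> (\<forall>x. x *s d1 + frob x *s d2 \<in> U)
    \<or> (\<forall>x. x *s d1 + frob4 x *s d2 \<in> U)
    \<or> (\<forall>y. tr y = 0 \<longrightarrow> y *s d1 + frob y *s d2 \<in> U)"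
    using scattered_normal_forms[OF sc c] by (elim exE conjE) (rule that)
  have cop: "coprime (2::nat) 5" "coprime (4::nat) 5"
    by (simp_all add: coprime_iff_gcd_eq_1 gcd_non_0_nat)
  have "pseudoregulus_type q (linear_set U) \<or> LP_type q (linear_set U)"
    using cases
  proof (elim disjE exE conjE)
    fix a b
    assume ab: "\<forall>z. (z + a * frob z) *s d1 + (frob2 z + b * frob z) *s d2 \<in> U \<and>
        (z \<noteq> 0 \<longrightarrow> (z + a * frob z) *s d1 + (frob2 z + b * frob z) *s d2 \<noteq> 0)"
    show ?thesis
    proof (cases "a = 0")
      case a0: False
      obtain k l where kl: "frob k = k" "l \<noteq> 0" "a * frob l = k * l" "k \<noteq> 0"
        using normalize_coefficient[OF root5, of a] a0 by metis
      define b' where "b' = b * frob l / frob2 l"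
      obtain e1 e2 where e: "wedge e1 e2 \<noteq> 0"
        "\<And>z. (z + k * frob z) *s e1 + (frob2 z + b' * frob z) *s e2 \<in> U"
        "\<And>z. z \<noteq> 0 \<Longrightarrow> (z + k * frob z) *s e1 + (frob2 z + b' * frob z) *s e2 \<noteq> 0"
        using rescale_pair[OF kl(2) w ab[rule_format] kl(3), of b'] kl(2) unfolding b'_def by auto
      from pairs[OF kl(1,4), of b'] show ?thesis
      proof (elim disjE conjE)
        assume "dependent_pair k b'"
        from dependent_pair_not_scattered[OF e(1) this e(2,3)] show ?thesis using sc by simp
      next
        assume "k * b' = 1" "k ^ 5 \<noteq> - 1"
        from pseudoregulus_inverse_coefficients[OF e(1) cU e(2) kl(1) this] show ?thesis ..
      next
        assume "LP_pair k b'"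
        then show ?thesis using e(1,2) cU unfolding LP_pair_def by blast
      qed
    next
      case a0: True
      show ?thesis
      proof (cases "b = 0")
        case True
        \<comment> \<open>With a = b = 0 the vectors are (z, z ^ (q ^ 2)), so s = 2.\<close>
        have "pseudoregulus_type q (linear_set U)"
          by (rule pseudoregulus_typeI[OF w cU cop(1)])
            (use ab[rule_format] a0 True in \<open>simp add: numeral_eq_Suc\<close>)
        then show ?thesis ..
      next
        case False
        \<comment> \<open>For a = 0 the free factor l is spent on b. Normalising 1 / b gives b l = l
          ^ q / k; with l replaced by its inverse Frobenius image \<open>l'\<close> this is the
          relation that rescaling needs, with new coefficient 1 / k in the subfield.\<close>
        obtain k l where kl: "frob k = k" "l \<noteq> 0" "1 / b * frob l = k * l" "k \<noteq> 0"
          using normalize_coefficient[OF root5, of "1 / b"] False by (metis divide_eq_0_iff one_neq_zero)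
        define l' where "l' = frob4 l"
        have "l' \<noteq> 0" using kl by (simp add: l'_def)
        have "0 * frob l' = 0 * l'" by simp
        moreover have "b * frob l' = 1 / k * frob2 l'"
          using kl False by (simp add: l'_def field_simps)
        ultimately obtain e1 e2 where e: "wedge e1 e2 \<noteq> 0"
          "\<And>z. (z + 0 * frob z) *s e1 + (frob2 z + 1 / k * frob z) *s e2 \<in> U"
          "\<And>z. z \<noteq> 0 \<Longrightarrow> (z + 0 * frob z) *s e1 + (frob2 z + 1 / k * frob z) *s e2 \<noteq> 0"
          using rescale_pair[OF \<open>l' \<noteq> 0\<close> w ab[rule_format]] unfolding a0 by blast
        have "dependent_pair 0 (1 / k)" using kl by (intro pairs0) auto
        from dependent_pair_not_scattered[OF e(1) this e(2,3)] show ?thesis using sc by simp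
      qed
    qed
  next
    fix \<delta>
    assume \<delta>: "\<delta> \<noteq> 0" "\<forall>x. x *s d1 + (frob x + \<delta> * frob4 x) *s d2 \<in> U"
    obtain y where y: "y \<noteq> 0" "tr (y * frob y * frob2 y) = 0" using cubic by auto
    have "nm \<delta> \<noteq> 1"
      using nm_1_not_scattered[OF y w _ \<delta>(2)[rule_format]] sc by blast
    then have "LP_type q (linear_set U)"
      by (intro LP_typeI[OF w cU, of 1 \<delta>]) (use \<delta> in \<open>simp_all add: numeral_eq_Suc\<close>)
    then show ?thesis ..
  next
    assume "\<forall>x. x *s d1 + frob x *s d2 \<in> U"
    then have "pseudoregulus_type q (linear_set U)"
      by (intro pseudoregulus_typeI[OF w cU, of 1]) simp_all
    then show ?thesis ..
  next
    assume "\<forall>x. x *s d1 + frob4 x *s d2 \<in> U"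
    then have "pseudoregulus_type q (linear_set U)"
      by (intro pseudoregulus_typeI[OF w cU cop(2)]) (simp_all add: numeral_eq_Suc)
    then show ?thesis ..
  next
    assume "\<forall>y. tr y = 0 \<longrightarrow> y *s d1 + frob y *s d2 \<in> U"
    then have H: "\<And>y. tr y = 0 \<Longrightarrow> y *s d1 + frob y *s d2 \<in> U" by blast
    obtain \<psi> where \<psi>: "(\<forall>x. x *s d1 + (frob x - \<psi> * tr x) *s d2 \<in> U) \<or> \<psi> \<noteq> 0 \<and> \<psi> *s d2 \<in> U"
      using trace_hyperplane_extension[OF sub cU w H] by blast
    then show ?thesis
    proof (elim disjE conjE)
      assume x: "\<forall>x. x *s d1 + (frob x - \<psi> * tr x) *s d2 \<in> U"
      show ?thesis
      proof (cases "\<psi> = 0")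
        case True
        then have "pseudoregulus_type q (linear_set U)"
          using x by (intro pseudoregulus_typeI[OF w cU, of 1]) simp_all
        then show ?thesis ..
      next
        case False
        from trace1[OF this] show ?thesis
        proof
          assume "trace_witness \<psi> 1"
          then obtain y s where ys: "tr y = 0" "\<psi> = frob y * (frob s - s)" "tr (y * s) = 1"
            by (auto simp: trace_witness_def)
          then have "(y * s) *s d1 + (frob (y * s) - \<psi>) *s d2 \<in> U"
            using x[rule_format, of "y * s"] by (simp only: mult_1_right)
          then show ?thesis
            using trace_witness_not_scattered[OF w False H] ys(1,2) sc by blast
        next
          assume "LP_trace \<psi>"
          then show ?thesis using x w cU unfolding LP_trace_def by blast
        qed
      qed
    next
      assume \<psi>: "\<psi> \<noteq> 0" "\<psi> *s d2 \<in> U"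
      obtain y s where ys: "tr y = 0" "\<psi> = frob y * (frob s - s)" "tr (y * s) = 0"
        using trace0[OF \<psi>(1)] by (auto simp: trace_witness_def)
      have "(y * s) *s d1 + frob (y * s) *s d2 + (- 1) *s (\<psi> *s d2) \<in> U"
      proof -
        have "(- 1) *s (\<psi> *s d2) \<in> U"
          using sub \<psi>(2) unfolding Fq_subspace_def in_Fq_iff Ball_def by (metis frob_1 frob_minus)
        then show ?thesis using sub H[OF ys(3)] unfolding Fq_subspace_def by blast
      qed
      then have "(y * s) *s d1 + (frob (y * s) - \<psi>) *s d2 \<in> U"
        by (simp add: vector_scalar_diff_rdistrib add_diff_eq)
      then show ?thesis
        using trace_witness_not_scattered[OF w \<psi>(1) H] ys(1,2) sc by blast
    qed
  qed
  then show ?thesis by (simp add: UB(1))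
qed

end

section \<open>Coordinates and certificates\<close>

datatype 'c v5 = V 'c 'c 'c 'c 'c

text \<open>Bare operations without laws: the laws are inherited from the field through an injective
  homomorphism. \<open>minus1\<close> takes the place of subtraction; \<open>vmul\<close> and
  \<open>vfrob\<close> are parameters because they depend on the equation of the generator.\<close>

class quintic_coeff = zero + one + plus + times +
  fixes minus1 :: 'a
    and vmul :: "'a v5 \<Rightarrow> 'a v5 \<Rightarrow> 'a v5"
    and vfrob :: "'a v5 \<Rightarrow> 'a v5"
    and of_bits :: "bool \<Rightarrow> bool \<Rightarrow> bool \<Rightarrow> 'a"

fun vadd :: "'c::plus v5 \<Rightarrow> 'c v5 \<Rightarrow> 'c v5" where
  "vadd (V a b c d e) (V a' b' c' d' e') = V (a + a') (b + b') (c + c') (d + d') (e + e')"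

fun vscale :: "'c::times \<Rightarrow> 'c v5 \<Rightarrow> 'c v5" where
  "vscale k (V a b c d e) = V (k * a) (k * b) (k * c) (k * d) (k * e)"

fun vzero :: "'c::zero v5 \<Rightarrow> bool" where
  "vzero (V a b c d e) \<longleftrightarrow> a = 0 \<and> b = 0 \<and> c = 0 \<and> d = 0 \<and> e = 0"

definition vdelta :: "'c::quintic_coeff v5 \<Rightarrow> 'c v5" where
  "vdelta x = vadd (vfrob x) (vscale minus1 x)"

text \<open>The argument of each auxiliary function below is evaluated before the function is unfolded,
  which is how intermediate results are shared when the checks are run by the simplifier.\<close>

definition vtr3 :: "'c::quintic_coeff v5 \<Rightarrow> 'c v5" where "vtr3 x = vadd x (vfrob x)"
definition vtr2 :: "'c::quintic_coeff v5 \<Rightarrow> 'c v5" where "vtr2 x = vadd x (vtr3 (vfrob x))"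
definition vtr1 :: "'c::quintic_coeff v5 \<Rightarrow> 'c v5" where "vtr1 x = vadd x (vtr2 (vfrob x))"
definition vtr :: "'c::quintic_coeff v5 \<Rightarrow> 'c v5" where "vtr x = vadd x (vtr1 (vfrob x))"

definition pair_check2 where
  "pair_check2 a b u uq w wq \<longleftrightarrow> \<not> vzero u \<and> \<not> vzero w \<and>
     vzero (vadd (vmul (vadd u uq) wq) (vadd (vmul (vmul b u) (vfrob wq)) (vscale a (vmul uq w))))"
definition pair_check1 where
  "pair_check1 a b u w \<longleftrightarrow> pair_check2 a b u (vfrob u) w (vfrob w)"
definition pair_check :: "'c::quintic_coeff \<Rightarrow> 'c v5 \<Rightarrow> 'c v5 \<Rightarrow> 'c v5 \<Rightarrow> bool" where
  "pair_check a b t w \<longleftrightarrow> pair_check1 a b (vdelta t) w"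

definition trace_check1 where
  "trace_check1 \<tau> \<psi> y s \<longleftrightarrow> vzero (vadd (vmul (vfrob y) (vdelta s)) (vscale minus1 \<psi>)) \<and>
     vzero (vadd (vtr (vmul y s)) (V (minus1 * \<tau>) 0 0 0 0))"
text \<open>Taking y in the form z ^ q - z makes its trace 0 without a test. The first witness, here
  as in \<open>pair_check\<close>, is used only through \<open>vdelta\<close>, which does not change
  when a subfield constant is added; this is why certificates may fix its constant coordinate as
  0.\<close>

definition trace_check :: "'c::quintic_coeff \<Rightarrow> 'c v5 \<Rightarrow> 'c v5 \<Rightarrow> 'c v5 \<Rightarrow> bool" where
  "trace_check \<tau> \<psi> z s \<longleftrightarrow> trace_check1 \<tau> \<psi> (vdelta z) s"

definition cubic_check1 where
  "cubic_check1 y y1 \<longleftrightarrow> \<not> vzero y \<and> vzero (vtr (vmul (vmul y y1) (vfrob y1)))"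
definition cubic_check :: "'c::quintic_coeff v5 \<Rightarrow> bool" where
  "cubic_check y \<longleftrightarrow> cubic_check1 y (vfrob y)"

text \<open>A character encodes two coordinates in its bits 0--2 and 4--6, the value \<open>n\<close> standing for the
  coefficient number \<open>n - 3\<close>, which keeps all characters alphanumeric. A certificate spends five characters
  on each vector of the list: two for the first witness, whose constant coefficient is 0, and three for
  the second one.\<close>

fun low :: "char \<Rightarrow> 'c::quintic_coeff" where
  "low (Char b0 b1 b2 b3 b4 b5 b6 b7) = of_bits b0 b1 b2"

fun high :: "char \<Rightarrow> 'c::quintic_coeff" where
  "high (Char b0 b1 b2 b3 b4 b5 b6 b7) = of_bits b4 b5 b6"

fun certified :: "('c::quintic_coeff v5 \<Rightarrow> 'c v5 \<Rightarrow> 'c v5 \<Rightarrow> bool) \<Rightarrow> 'c v5 list \<Rightarrow> string \<Rightarrow> bool" where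
  "certified P [] cs \<longleftrightarrow> True"
| "certified P (v # vs) (c0 # c1 # c2 # c3 # c4 # cs) \<longleftrightarrow>
     P v (V 0 (low c0) (high c0) (low c1) (high c1)) (V (low c2) (high c2) (low c3) (high c3) (low c4)) \<and>
     certified P vs cs"
| "certified P vs cs \<longleftrightarrow> False"

lemma certified_imp: "certified P vs cs \<Longrightarrow> v \<in> set vs \<Longrightarrow> \<exists>t w. P v t w"
proof (induction P vs cs rule: certified.induct)
  case (2 P u us c0 c1 c2 c3 c4 cs)
  show ?case
  proof (cases "v = u")
    case True
    then show ?thesis using "2.prems"(1) by (simp only: certified.simps) blast
  next
    case False
    then show ?thesis using 2 by simp
  qed
qed simp_all

fun certified_rows :: "('c::quintic_coeff v5 \<Rightarrow> 'c v5 \<Rightarrow> 'c v5 \<Rightarrow> bool) \<Rightarrow> 'c v5 list list \<Rightarrow> string list \<Rightarrow> bool" where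
  "certified_rows P [] css \<longleftrightarrow> True"
| "certified_rows P (vs # vss) (cs # css) \<longleftrightarrow> certified P vs cs \<and> certified_rows P vss css"
| "certified_rows P vss css \<longleftrightarrow> False"

lemma certified_rowsD:
  "certified_rows P vss css \<Longrightarrow> \<exists>vs\<in>set vss. v \<in> set vs \<Longrightarrow> \<exists>t w. P v t w"
  by (induction P vss css rule: certified_rows.induct) (use certified_imp in auto)

text \<open>A row fixes c, d, e and runs through b and, fastest, a; among the rows c changes
  fastest. The certificate strings below follow this order, one string per row.\<close>

definition vectors :: "'c list \<Rightarrow> 'c list \<Rightarrow> 'c list \<Rightarrow> 'c list \<Rightarrow> 'c list \<Rightarrow> 'c v5 list list" where
  "vectors as bs cs ds es =
     concat (map (\<lambda>e. concat (map (\<lambda>d. map (\<lambda>c. concat (map (\<lambda>b. map (\<lambda>a. V a b c d e) as) bs)) cs) ds)) es)"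

lemma ex_vectors_iff: "(\<exists>vs\<in>set (vectors as bs cs ds es). V a b c d e \<in> set vs) \<longleftrightarrow>
    a \<in> set as \<and> b \<in> set bs \<and> c \<in> set cs \<and> d \<in> set ds \<and> e \<in> set es"
  by (auto simp: vectors_def image_iff)

context quintic_field
begin

text \<open>A polynomial over the subfield vanishing at \<theta> also vanishes at its conjugates.
  These are five distinct elements, because 5 is prime and \<theta> is not fixed by
  \<open>frob\<close>, while the degree is at most 4.\<close>

lemma power_basis_independent:
  assumes \<theta>: "frob \<theta> \<noteq> \<theta>" and c: "frob a = a" "frob b = b" "frob c = c" "frob d = d" "frob e = e"
    and eq: "a + b * \<theta> + c * \<theta> ^ 2 + d * \<theta> ^ 3 + e * \<theta> ^ 4 = 0"
  shows "a = 0 \<and> b = 0 \<and> c = 0 \<and> d = 0 \<and> e = 0"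
proof -
  define p where "p = [:a, b, c, d, e:]"
  have root: "poly p x = 0 \<Longrightarrow> poly p (frob x) = 0" for x
  proof -
    assume "poly p x = 0"
    then have "frob (poly p x) = 0" by simp
    then show ?thesis by (simp add: p_def c)
  qed
  have "poly p \<theta> = 0" using eq by (simp add: p_def algebra_simps numeral_eq_Suc)
  then have sub: "{\<theta>, frob \<theta>, frob2 \<theta>, frob3 \<theta>, frob4 \<theta>} \<subseteq> {x. poly p x = 0}"
    using root by auto
  have 2: "frob2 \<theta> \<noteq> \<theta>" using \<theta> by (metis frob5)
  have 3: "frob3 \<theta> \<noteq> \<theta>" using \<theta> by (metis frob5)
  have 4: "frob4 \<theta> \<noteq> \<theta>" using \<theta> by (metis frob5)
  have card5: "card {\<theta>, frob \<theta>, frob2 \<theta>, frob3 \<theta>, frob4 \<theta>} = 5"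
    using \<theta> 2 3 4 by (simp add: eq_commute[of \<theta>])
  have "p = 0"
  proof (rule ccontr)
    assume "p \<noteq> 0"
    have "5 \<le> card {x. poly p x = 0}"
      unfolding card5[symmetric] by (rule card_mono[OF _ sub]) simp
    also have "\<dots> \<le> degree p" using \<open>p \<noteq> 0\<close> by (rule card_poly_roots_bound)
    also have "\<dots> \<le> 4" by (simp add: p_def)
    finally show False by simp
  qed
  then show ?thesis by (simp add: p_def)
qed

lemma power_basis_spans:
  assumes \<theta>: "frob \<theta> \<noteq> \<theta>"
  obtains a b c d e where "frob a = a" "frob b = b" "frob c = c" "frob d = d" "frob e = e"
    "x = a + b * \<theta> + c * \<theta> ^ 2 + d * \<theta> ^ 3 + e * \<theta> ^ 4"
proof -
  let ?K = "Fq q :: 'a set"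
  let ?f = "\<lambda>(a, b, c, d, e). a + b * \<theta> + c * \<theta> ^ 2 + d * \<theta> ^ 3 + e * \<theta> ^ 4"
  have inj: "inj_on ?f (?K \<times> ?K \<times> ?K \<times> ?K \<times> ?K)"
  proof (rule inj_onI, clarify)
    fix a b c d e a' b' c' d' e' :: 'a
    assume K: "a \<in> ?K" "b \<in> ?K" "c \<in> ?K" "d \<in> ?K" "e \<in> ?K" "a' \<in> ?K" "b' \<in> ?K" "c' \<in> ?K" "d' \<in> ?K" "e' \<in> ?K"
      and eq: "a + b * \<theta> + c * \<theta> ^ 2 + d * \<theta> ^ 3 + e * \<theta> ^ 4 = a' + b' * \<theta> + c' * \<theta> ^ 2 + d' * \<theta> ^ 3 + e' * \<theta> ^ 4"
    have "(a - a') + (b - b') * \<theta> + (c - c') * \<theta> ^ 2 + (d - d') * \<theta> ^ 3 + (e - e') * \<theta> ^ 4 = 0"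
      using eq by (simp add: algebra_simps)
    then have "a - a' = 0 \<and> b - b' = 0 \<and> c - c' = 0 \<and> d - d' = 0 \<and> e - e' = 0"
      using K by (intro power_basis_independent[OF \<theta>]) (auto simp: in_Fq_iff)
    then show "a = a' \<and> (b, c, d, e) = (b', c', d', e')" by simp
  qed
  have "card (?f ` (?K \<times> ?K \<times> ?K \<times> ?K \<times> ?K)) = q ^ 5"
    unfolding card_image[OF inj] by (simp add: card_cartesian_product card_Fq numeral_eq_Suc)
  then have "?f ` (?K \<times> ?K \<times> ?K \<times> ?K \<times> ?K) = UNIV"
    using card_field by (intro card_seteq) auto
  then have "x \<in> ?f ` (?K \<times> ?K \<times> ?K \<times> ?K \<times> ?K)" by simp
  then obtain y where y: "x = ?f y" "y \<in> ?K \<times> ?K \<times> ?K \<times> ?K \<times> ?K" by (rule imageE)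
  obtain a b c d e where "y = (a, b, c, d, e)" by (cases y)
  with y show thesis by (intro that[of a b c d e]) (simp_all add: in_Fq_iff)
qed

end

fun ev5 :: "('c \<Rightarrow> 'a::field) \<Rightarrow> 'a \<Rightarrow> 'c v5 \<Rightarrow> 'a" where
  "ev5 \<phi> \<theta> (V a b c d e) = \<phi> a + \<phi> b * \<theta> + \<phi> c * \<theta> ^ 2 + \<phi> d * \<theta> ^ 3 + \<phi> e * \<theta> ^ 4"

text \<open>The bridge from tables to the field: \<phi> identifies the coefficient type with the
  subfield, and \<theta> generates the field over it. The last two assumptions are what allows a
  checked identity between coordinate vectors to be read in the field.\<close>

locale quintic_model = quintic_field q field_type
  for q and field_type :: "'a::{field,finite} itself" +
  fixes \<phi> :: "'c::quintic_coeff \<Rightarrow> 'a" and \<theta> :: 'a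
  assumes \<phi>_0: "\<phi> 0 = 0" and \<phi>_1: "\<phi> 1 = 1" and \<phi>_minus1: "\<phi> minus1 = - 1"
    and \<phi>_add: "\<phi> (x + y) = \<phi> x + \<phi> y" and \<phi>_mult: "\<phi> (x * y) = \<phi> x * \<phi> y"
    and \<phi>_Fq: "frob (\<phi> x) = \<phi> x" and \<phi>_surj: "frob z = z \<Longrightarrow> \<exists>x. z = \<phi> x"
    and \<phi>_inj: "\<phi> x = \<phi> y \<Longrightarrow> x = y"
    and \<theta>: "frob \<theta> \<noteq> \<theta>"
    and ev_vmul: "ev5 \<phi> \<theta> (vmul u v) = ev5 \<phi> \<theta> u * ev5 \<phi> \<theta> v"
    and ev_vfrob: "ev5 \<phi> \<theta> (vfrob u) = frob (ev5 \<phi> \<theta> u)"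
begin

abbreviation ev where "ev \<equiv> ev5 \<phi> \<theta>"

lemma ev_vadd: "ev (vadd u v) = ev u + ev v"
  by (cases u; cases v) (simp add: \<phi>_add algebra_simps)

lemma ev_vscale: "ev (vscale k v) = \<phi> k * ev v"
  by (cases v) (simp add: \<phi>_mult algebra_simps)

lemma \<phi>_eq_0_iff: "\<phi> x = 0 \<longleftrightarrow> x = 0"
  using \<phi>_inj[of x 0] \<phi>_0 by auto

lemma vzero_iff: "vzero v \<longleftrightarrow> ev v = 0"
proof (cases v)
  case (V a b c d e)
  have "ev v = 0 \<Longrightarrow> \<phi> a = 0 \<and> \<phi> b = 0 \<and> \<phi> c = 0 \<and> \<phi> d = 0 \<and> \<phi> e = 0"
    by (rule power_basis_independent[OF \<theta>]) (auto simp: \<phi>_Fq V)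
  then show ?thesis using V by (auto simp: \<phi>_eq_0_iff \<phi>_0)
qed

lemma ev_surj: "\<exists>v. x = ev v"
proof -
  obtain a b c d e where *: "frob a = a" "frob b = b" "frob c = c" "frob d = d" "frob e = e"
    "x = a + b * \<theta> + c * \<theta> ^ 2 + d * \<theta> ^ 3 + e * \<theta> ^ 4"
    using power_basis_spans[OF \<theta>, of x] .
  obtain a' b' c' d' e' where "a = \<phi> a'" "b = \<phi> b'" "c = \<phi> c'" "d = \<phi> d'" "e = \<phi> e'"
    using \<phi>_surj *(1-5) by metis
  then have "x = ev (V a' b' c' d' e')" using *(6) by simp
  then show ?thesis ..
qed

lemma ev_vdelta: "ev (vdelta x) = frob (ev x) - ev x"
  by (simp add: vdelta_def ev_vadd ev_vscale ev_vfrob \<phi>_minus1)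

lemma ev_vtr: "ev (vtr x) = tr (ev x)"
  by (simp add: vtr_def vtr1_def vtr2_def vtr3_def ev_vadd ev_vfrob tr_def)

lemma pair_check_sound: "pair_check a b t w \<Longrightarrow> dependent_pair (\<phi> a) (ev b)"
  unfolding pair_check_def pair_check1_def pair_check2_def vzero_iff dependent_pair_def Let_def
  by (rule exI[of _ "ev t"], rule exI[of _ "ev w"])
    (auto simp: ev_vdelta ev_vadd ev_vmul ev_vfrob ev_vscale algebra_simps)

lemma trace_check_sound: "trace_check \<tau> \<psi> z s \<Longrightarrow> trace_witness (ev \<psi>) (\<phi> \<tau>)"
  unfolding trace_check_def trace_check1_def vzero_iff trace_witness_def
  by (rule exI[of _ "ev (vdelta z)"], rule exI[of _ "ev s"])
    (auto simp: ev_vdelta ev_vadd ev_vmul ev_vfrob ev_vscale ev_vtr \<phi>_minus1 \<phi>_mult \<phi>_0 tr_diff)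

lemma cubic_check_sound: "cubic_check (v :: 'c v5) \<Longrightarrow> \<exists>y. y \<noteq> 0 \<and> tr (y * frob y * frob2 y) = 0"
  unfolding cubic_check_def cubic_check1_def vzero_iff
  by (intro exI[of _ "ev v"]) (auto simp: ev_vmul ev_vfrob ev_vtr)

lemma ex_inverse_coeff: "x \<noteq> 0 \<Longrightarrow> \<exists>k. k * x = 1" for x :: 'c
proof -
  assume x: "x \<noteq> 0"
  obtain k where k: "1 / \<phi> x = \<phi> k" using \<phi>_surj[of "1 / \<phi> x"] \<phi>_Fq by auto
  have "\<phi> (k * x) = \<phi> 1" using x by (simp add: \<phi>_mult k[symmetric] \<phi>_1 \<phi>_eq_0_iff)
  then show ?thesis using \<phi>_inj by blast
qed

lemma mult_0_coeff: "k * 0 = 0" for k :: 'c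
  using \<phi>_inj[of "k * 0" 0] by (simp add: \<phi>_mult \<phi>_0)

text \<open>Every non-zero vector is proportional to one whose last non-zero coordinate is 1.\<close>
lemma trace_witness_all:
  assumes "\<And>a b c d \<tau>. trace_witness (ev (V a b c d 1)) (\<phi> \<tau>)"
    "\<And>a b c \<tau>. trace_witness (ev (V a b c 1 0)) (\<phi> \<tau>)"
    "\<And>a b \<tau>. trace_witness (ev (V a b 1 0 0)) (\<phi> \<tau>)"
    "\<And>a \<tau>. trace_witness (ev (V a 1 0 0 0)) (\<phi> \<tau>)"
    and "\<psi> \<noteq> 0" "frob \<tau> = \<tau>"
  shows "trace_witness \<psi> \<tau> \<or> frob \<psi> = \<psi> \<and> \<not> trace_witness 1 (\<tau> / \<psi>)"
proof -
  obtain v where v: "\<psi> = ev v" using ev_surj by blast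
  have scale: "trace_witness \<psi> \<tau>" if k: "k \<noteq> 0" and W: "\<And>\<tau>. trace_witness (ev (vscale k v)) (\<phi> \<tau>)" for k
  proof -
    have k0: "\<phi> k \<noteq> 0" using k by (simp add: \<phi>_eq_0_iff)
    obtain \<tau>' where \<tau>': "\<phi> k * \<tau> = \<phi> \<tau>'" using \<phi>_surj[of "\<phi> k * \<tau>"] assms(6) \<phi>_Fq by auto
    have "trace_witness (1 / \<phi> k * ev (vscale k v)) (1 / \<phi> k * \<phi> \<tau>')"
      by (rule trace_witness_scale[OF W]) (simp add: \<phi>_Fq)
    then show ?thesis using k0 by (simp add: ev_vscale v \<tau>'[symmetric])
  qed
  have nz: "k \<noteq> 0" if "k * x = 1" for k x :: 'c
  proof
    assume "k = 0"
    then have "\<phi> (k * x) = 0" by (simp add: \<phi>_mult \<phi>_0)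
    then show False using that by (simp add: \<phi>_1)
  qed
  show ?thesis
  proof (cases v)
    case v5: (V a b c d e)
    consider "e \<noteq> 0" | "e = 0" "d \<noteq> 0" | "e = 0" "d = 0" "c \<noteq> 0" | "e = 0" "d = 0" "c = 0" "b \<noteq> 0"
      | "e = 0" "d = 0" "c = 0" "b = 0" by blast
    then show ?thesis
    proof cases
      case 1
      then obtain k where "k * e = 1" using ex_inverse_coeff by blast
      then show ?thesis using scale[OF nz] assms(1) by (simp add: v5)
    next
      case 2
      then obtain k where "k * d = 1" using ex_inverse_coeff by blast
      then show ?thesis using scale[OF nz] assms(2) 2 by (simp add: v5 mult_0_coeff)
    next
      case 3
      then obtain k where "k * c = 1" using ex_inverse_coeff by blast
      then show ?thesis using scale[OF nz] assms(3) 3 by (simp add: v5 mult_0_coeff)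
    next
      case 4
      then obtain k where "k * b = 1" using ex_inverse_coeff by blast
      then show ?thesis using scale[OF nz] assms(4) 4 by (simp add: v5 mult_0_coeff)
    next
      \<comment> \<open>For \<psi> in the subfield, scaling leads to \<psi> = 1 with target \<tau> /
        \<psi>. A witness may be missing there, so this case stays open in the conclusion.\<close>
      case 5
      then have \<psi>: "\<psi> = \<phi> a" by (simp add: v v5 \<phi>_0)
      have "trace_witness \<psi> \<tau>" if "trace_witness 1 (\<tau> / \<psi>)"
        using trace_witness_scale[OF that, of \<psi>] \<open>\<psi> \<noteq> 0\<close> \<psi> by (simp add: \<phi>_Fq)
      then show ?thesis using \<psi> by (auto simp: \<phi>_Fq)
    qed
  qed
qed

end

section \<open>Tables for the fields of order 2, 3, 4, 5 and their quintic extensions\<close>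

fun convolve where
  "convolve f (V a b c d e) (V a' b' c' d' e') = f (a * a') (a * b' + b * a') (a * c' + b * b' + c * a')
     (a * d' + b * c' + c * b' + d * a') (a * e' + b * d' + c * c' + d * b' + e * a')
     (b * e' + c * d' + d * c' + e * b') (c * e' + d * d' + e * c') (d * e' + e * d') (e * e')"

text \<open>Reduction of a product modulo \<open>\<theta> ^ 5 = \<theta> + 1\<close> and modulo \<open>\<theta> ^ 5 = \<theta> ^ 2 + 1\<close>, respectively.\<close>

definition reduce1 :: "'c::plus \<Rightarrow> 'c \<Rightarrow> 'c \<Rightarrow> 'c \<Rightarrow> 'c \<Rightarrow> 'c \<Rightarrow> 'c \<Rightarrow> 'c \<Rightarrow> 'c \<Rightarrow> 'c v5" where
  "reduce1 s0 s1 s2 s3 s4 s5 s6 s7 s8 =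
     V (s0 + s5) (s1 + s5 + s6) (s2 + s6 + s7) (s3 + s7 + s8) (s4 + s8)"

definition reduce2 :: "'c::plus \<Rightarrow> 'c \<Rightarrow> 'c \<Rightarrow> 'c \<Rightarrow> 'c \<Rightarrow> 'c \<Rightarrow> 'c \<Rightarrow> 'c \<Rightarrow> 'c \<Rightarrow> 'c v5" where
  "reduce2 s0 s1 s2 s3 s4 s5 s6 s7 s8 =
     V (s0 + s5 + s8) (s1 + s6) (s2 + s5 + s7 + s8) (s3 + s6 + s8) (s4 + s7)"

datatype gf2 = O2 | I2

definition gf2s :: "gf2 list" where
  "gf2s = [O2, I2]"

lemma set_gf2s: "x \<in> set gf2s"
  by (cases x) (simp_all add: gf2s_def)

instantiation gf2 :: "{plus, times}"
begin

fun plus_gf2 :: "gf2 \<Rightarrow> gf2 \<Rightarrow> gf2" where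
  "O2 + O2 = O2"
| "O2 + I2 = I2"
| "I2 + O2 = I2"
| "I2 + I2 = O2"

fun times_gf2 :: "gf2 \<Rightarrow> gf2 \<Rightarrow> gf2" where
  "O2 * O2 = O2"
| "O2 * I2 = O2"
| "I2 * O2 = O2"
| "I2 * I2 = I2"

instance ..

end

instantiation gf2 :: quintic_coeff
begin

definition "0 = O2"
definition "1 = I2"
definition "minus1 = I2"
definition "vmul_gf2 = (convolve reduce2 :: gf2 v5 \<Rightarrow> gf2 v5 \<Rightarrow> gf2 v5)"

text \<open>The map is linear over the coefficients, so it is determined by the reductions of the
  powers of \<theta> with exponents 0, q, 2q, 3q, 4q. The tables for q = 3 and q = 4 arise in the
  same way.\<close>

fun vfrob_gf2 :: "gf2 v5 \<Rightarrow> gf2 v5" where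
  "vfrob_gf2 (V a b c d e) = V (a + e) d (b + e) (d + e) c"

definition of_bits_gf2 :: "bool \<Rightarrow> bool \<Rightarrow> bool \<Rightarrow> gf2" where
  "of_bits_gf2 b0 b1 b2 = (if b2 then I2 else O2)"

instance ..

end

datatype gf3 = O3 | I3 | T3

definition gf3s :: "gf3 list" where
  "gf3s = [O3, I3, T3]"

lemma set_gf3s: "x \<in> set gf3s"
  by (cases x) (simp_all add: gf3s_def)

definition gf3_units :: "gf3 list" where
  "gf3_units = [I3, T3]"

lemma set_gf3_units: "x \<in> set gf3_units \<longleftrightarrow> x \<noteq> O3"
  by (cases x) (simp_all add: gf3_units_def)

instantiation gf3 :: "{plus, times}"
begin

fun plus_gf3 :: "gf3 \<Rightarrow> gf3 \<Rightarrow> gf3" where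
  "O3 + O3 = O3"
| "O3 + I3 = I3"
| "O3 + T3 = T3"
| "I3 + O3 = I3"
| "I3 + I3 = T3"
| "I3 + T3 = O3"
| "T3 + O3 = T3"
| "T3 + I3 = O3"
| "T3 + T3 = I3"

fun times_gf3 :: "gf3 \<Rightarrow> gf3 \<Rightarrow> gf3" where
  "O3 * O3 = O3"
| "O3 * I3 = O3"
| "O3 * T3 = O3"
| "I3 * O3 = O3"
| "I3 * I3 = I3"
| "I3 * T3 = T3"
| "T3 * O3 = O3"
| "T3 * I3 = T3"
| "T3 * T3 = I3"

instance ..

end

instantiation gf3 :: quintic_coeff
begin

definition "0 = O3"
definition "1 = I3"
definition "minus1 = T3"
definition "vmul_gf3 = (convolve reduce1 :: gf3 v5 \<Rightarrow> gf3 v5 \<Rightarrow> gf3 v5)"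

fun vfrob_gf3 :: "gf3 v5 \<Rightarrow> gf3 v5" where
  "vfrob_gf3 (V a b c d e) = V (a + d) (c + d) (c + e) (b + T3 * e) (d + e)"

definition of_bits_gf3 :: "bool \<Rightarrow> bool \<Rightarrow> bool \<Rightarrow> gf3" where
  "of_bits_gf3 b0 b1 b2 = (if b2 then if b0 then T3 else I3 else O3)"

instance ..

end

text \<open>\<open>W4\<close> stands for a primitive cube root of unity \<omega>, and
  \<open>X4\<close> for \<omega> + 1, which is the square of \<omega>.\<close>

datatype gf4 = O4 | I4 | W4 | X4

definition gf4s :: "gf4 list" where
  "gf4s = [O4, I4, W4, X4]"

lemma set_gf4s: "x \<in> set gf4s"
  by (cases x) (simp_all add: gf4s_def)

definition gf4_units :: "gf4 list" where
  "gf4_units = [I4, W4, X4]"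

lemma set_gf4_units: "x \<in> set gf4_units \<longleftrightarrow> x \<noteq> O4"
  by (cases x) (simp_all add: gf4_units_def)

instantiation gf4 :: "{plus, times}"
begin

fun plus_gf4 :: "gf4 \<Rightarrow> gf4 \<Rightarrow> gf4" where
  "O4 + O4 = O4"
| "O4 + I4 = I4"
| "O4 + W4 = W4"
| "O4 + X4 = X4"
| "I4 + O4 = I4"
| "I4 + I4 = O4"
| "I4 + W4 = X4"
| "I4 + X4 = W4"
| "W4 + O4 = W4"
| "W4 + I4 = X4"
| "W4 + W4 = O4"
| "W4 + X4 = I4"
| "X4 + O4 = X4"
| "X4 + I4 = W4"
| "X4 + W4 = I4"
| "X4 + X4 = O4"

fun times_gf4 :: "gf4 \<Rightarrow> gf4 \<Rightarrow> gf4" where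
  "O4 * O4 = O4"
| "O4 * I4 = O4"
| "O4 * W4 = O4"
| "O4 * X4 = O4"
| "I4 * O4 = O4"
| "I4 * I4 = I4"
| "I4 * W4 = W4"
| "I4 * X4 = X4"
| "W4 * O4 = O4"
| "W4 * I4 = W4"
| "W4 * W4 = X4"
| "W4 * X4 = I4"
| "X4 * O4 = O4"
| "X4 * I4 = X4"
| "X4 * W4 = I4"
| "X4 * X4 = W4"

instance ..

end

instantiation gf4 :: quintic_coeff
begin

definition "0 = O4"
definition "1 = I4"
definition "minus1 = I4"
definition "vmul_gf4 = (convolve reduce2 :: gf4 v5 \<Rightarrow> gf4 v5 \<Rightarrow> gf4 v5)"

fun vfrob_gf4 :: "gf4 v5 \<Rightarrow> gf4 v5" where
  "vfrob_gf4 (V a b c d e) = V (a + c + e) (d + e) (c + d) (c + d + e) (b + e)"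

definition of_bits_gf4 :: "bool \<Rightarrow> bool \<Rightarrow> bool \<Rightarrow> gf4" where
  "of_bits_gf4 b0 b1 b2 = (if b2 then if b1 then X4 else if b0 then W4 else I4 else O4)"

instance ..

end

datatype gf5 = O5 | I5 | T5 | H5 | F5

definition gf5s :: "gf5 list" where
  "gf5s = [O5, I5, T5, H5, F5]"

lemma set_gf5s: "x \<in> set gf5s"
  by (cases x) (simp_all add: gf5s_def)

definition gf5_units :: "gf5 list" where
  "gf5_units = [I5, T5, H5, F5]"

lemma set_gf5_units: "x \<in> set gf5_units \<longleftrightarrow> x \<noteq> O5"
  by (cases x) (simp_all add: gf5_units_def)

instantiation gf5 :: "{plus, times}"
begin

fun plus_gf5 :: "gf5 \<Rightarrow> gf5 \<Rightarrow> gf5" where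
  "O5 + O5 = O5"
| "O5 + I5 = I5"
| "O5 + T5 = T5"
| "O5 + H5 = H5"
| "O5 + F5 = F5"
| "I5 + O5 = I5"
| "I5 + I5 = T5"
| "I5 + T5 = H5"
| "I5 + H5 = F5"
| "I5 + F5 = O5"
| "T5 + O5 = T5"
| "T5 + I5 = H5"
| "T5 + T5 = F5"
| "T5 + H5 = O5"
| "T5 + F5 = I5"
| "H5 + O5 = H5"
| "H5 + I5 = F5"
| "H5 + T5 = O5"
| "H5 + H5 = I5"
| "H5 + F5 = T5"
| "F5 + O5 = F5"
| "F5 + I5 = O5"
| "F5 + T5 = I5"
| "F5 + H5 = T5"
| "F5 + F5 = H5"

fun times_gf5 :: "gf5 \<Rightarrow> gf5 \<Rightarrow> gf5" where
  "O5 * O5 = O5"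
| "O5 * I5 = O5"
| "O5 * T5 = O5"
| "O5 * H5 = O5"
| "O5 * F5 = O5"
| "I5 * O5 = O5"
| "I5 * I5 = I5"
| "I5 * T5 = T5"
| "I5 * H5 = H5"
| "I5 * F5 = F5"
| "T5 * O5 = O5"
| "T5 * I5 = T5"
| "T5 * T5 = F5"
| "T5 * H5 = I5"
| "T5 * F5 = H5"
| "H5 * O5 = O5"
| "H5 * I5 = H5"
| "H5 * T5 = I5"
| "H5 * H5 = F5"
| "H5 * F5 = T5"
| "F5 * O5 = O5"
| "F5 * I5 = F5"
| "F5 * T5 = H5"
| "F5 * H5 = T5"
| "F5 * F5 = I5"

instance ..

end

instantiation gf5 :: quintic_coeff
begin

definition "0 = O5"
definition "1 = I5"
definition "minus1 = F5"
definition "vmul_gf5 = (convolve reduce1 :: gf5 v5 \<Rightarrow> gf5 v5 \<Rightarrow> gf5 v5)"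

text \<open>Here \<theta> ^ 5 = \<theta> + 1, so the Frobenius map is the substitution of \<theta> +
  1 for \<theta>; the entries are binomial coefficients modulo 5.\<close>

fun vfrob_gf5 :: "gf5 v5 \<Rightarrow> gf5 v5" where
  "vfrob_gf5 (V a b c d e) = V (a + b + c + d + e) (b + T5 * c + H5 * d + F5 * e) (c + H5 * d + e) (d + F5 * e) e"

definition of_bits_gf5 :: "bool \<Rightarrow> bool \<Rightarrow> bool \<Rightarrow> gf5" where
  "of_bits_gf5 b0 b1 b2 = (if b2 then if b1 then if b0 then F5 else H5 else if b0 then T5 else I5 else O5)"

instance ..

end

lemma card_gf2: "card (UNIV :: gf2 set) = 2"
proof -
  have "(UNIV :: gf2 set) = set gf2s" using set_gf2s by auto
  then have "card (UNIV :: gf2 set) = card (set gf2s)" by (rule arg_cong)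
  then show ?thesis by (simp add: gf2s_def)
qed

lemma card_gf3: "card (UNIV :: gf3 set) = 3"
proof -
  have "(UNIV :: gf3 set) = set gf3s" using set_gf3s by auto
  then have "card (UNIV :: gf3 set) = card (set gf3s)" by (rule arg_cong)
  then show ?thesis by (simp add: gf3s_def)
qed

lemma card_gf4: "card (UNIV :: gf4 set) = 4"
proof -
  have "(UNIV :: gf4 set) = set gf4s" using set_gf4s by auto
  then have "card (UNIV :: gf4 set) = card (set gf4s)" by (rule arg_cong)
  then show ?thesis by (simp add: gf4s_def)
qed

lemma card_gf5: "card (UNIV :: gf5 set) = 5"
proof -
  have "(UNIV :: gf5 set) = set gf5s" using set_gf5s by auto
  then have "card (UNIV :: gf5 set) = card (set gf5s)" by (rule arg_cong)
  then show ?thesis by (simp add: gf5s_def)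
qed

lemma powers_reduce1:
  fixes \<theta> :: "'a::field"
  assumes "\<theta> ^ 5 = \<theta> + 1"
  shows "\<theta> ^ 6 = \<theta> ^ 2 + \<theta>" "\<theta> ^ 7 = \<theta> ^ 3 + \<theta> ^ 2" "\<theta> ^ 8 = \<theta> ^ 4 + \<theta> ^ 3"
    "\<theta> ^ 9 = \<theta> ^ 4 + \<theta> + 1" "\<theta> ^ 12 = \<theta> ^ 4 + 2 * \<theta> ^ 3 + \<theta> ^ 2"
  using assms by algebra+

text \<open>True over every field; the summands with an explicit factor 2 disappear in
  characteristic 2, where they are applied. Exponents 6 to 8 serve multiplication, and 6, 8, 12, 16
  serve the Frobenius maps for q = 2 and q = 4.\<close>

lemma powers_reduce2:
  fixes \<theta> :: "'a::field"
  assumes "\<theta> ^ 5 = \<theta> ^ 2 + 1"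
  shows "\<theta> ^ 6 = \<theta> ^ 3 + \<theta>" "\<theta> ^ 7 = \<theta> ^ 4 + \<theta> ^ 2" "\<theta> ^ 8 = \<theta> ^ 3 + \<theta> ^ 2 + 1"
    "\<theta> ^ 12 = \<theta> ^ 3 + \<theta> ^ 2 + \<theta> + 2 * \<theta> ^ 4"
    "\<theta> ^ 16 = \<theta> ^ 4 + \<theta> ^ 3 + \<theta> + 1 + 2 * (\<theta> ^ 3 + 2 * \<theta> ^ 2 + 1)"
  using assms by algebra+

lemma ev5_convolve_reduce1:
  assumes "\<And>x y. \<phi> (x + y) = \<phi> x + \<phi> y" "\<And>x y. \<phi> (x * y) = \<phi> x * \<phi> y" and t: "\<theta> ^ 5 = \<theta> + 1"
  shows "ev5 \<phi> \<theta> (convolve reduce1 u v) = ev5 \<phi> \<theta> u * ev5 \<phi> \<theta> v"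
proof -
  note p = powers_reduce1(1-3)[OF t]
  obtain a b c d e a' b' c' d' e' where uv: "u = V a b c d e" "v = V a' b' c' d' e'"
    by (cases u; cases v)
  have "ev5 \<phi> \<theta> u * ev5 \<phi> \<theta> v =
      \<phi> a * \<phi> a' + (\<phi> a * \<phi> b' + \<phi> b * \<phi> a') * \<theta> + (\<phi> a * \<phi> c' + \<phi> b * \<phi> b' + \<phi> c * \<phi> a') * \<theta> ^ 2
      + (\<phi> a * \<phi> d' + \<phi> b * \<phi> c' + \<phi> c * \<phi> b' + \<phi> d * \<phi> a') * \<theta> ^ 3
      + (\<phi> a * \<phi> e' + \<phi> b * \<phi> d' + \<phi> c * \<phi> c' + \<phi> d * \<phi> b' + \<phi> e * \<phi> a') * \<theta> ^ 4
      + (\<phi> b * \<phi> e' + \<phi> c * \<phi> d' + \<phi> d * \<phi> c' + \<phi> e * \<phi> b') * \<theta> ^ 5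
      + (\<phi> c * \<phi> e' + \<phi> d * \<phi> d' + \<phi> e * \<phi> c') * \<theta> ^ 6
      + (\<phi> d * \<phi> e' + \<phi> e * \<phi> d') * \<theta> ^ 7 + \<phi> e * \<phi> e' * \<theta> ^ 8"
    unfolding uv ev5.simps by algebra
  then show ?thesis
    unfolding p t by (simp add: uv reduce1_def assms algebra_simps)
qed

lemma ev5_convolve_reduce2:
  assumes "\<And>x y. \<phi> (x + y) = \<phi> x + \<phi> y" "\<And>x y. \<phi> (x * y) = \<phi> x * \<phi> y" and t: "\<theta> ^ 5 = \<theta> ^ 2 + 1"
  shows "ev5 \<phi> \<theta> (convolve reduce2 u v) = ev5 \<phi> \<theta> u * ev5 \<phi> \<theta> v"
proof -
  note p = powers_reduce2(1-3)[OF t]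
  obtain a b c d e a' b' c' d' e' where uv: "u = V a b c d e" "v = V a' b' c' d' e'"
    by (cases u; cases v)
  have "ev5 \<phi> \<theta> u * ev5 \<phi> \<theta> v =
      \<phi> a * \<phi> a' + (\<phi> a * \<phi> b' + \<phi> b * \<phi> a') * \<theta> + (\<phi> a * \<phi> c' + \<phi> b * \<phi> b' + \<phi> c * \<phi> a') * \<theta> ^ 2
      + (\<phi> a * \<phi> d' + \<phi> b * \<phi> c' + \<phi> c * \<phi> b' + \<phi> d * \<phi> a') * \<theta> ^ 3
      + (\<phi> a * \<phi> e' + \<phi> b * \<phi> d' + \<phi> c * \<phi> c' + \<phi> d * \<phi> b' + \<phi> e * \<phi> a') * \<theta> ^ 4
      + (\<phi> b * \<phi> e' + \<phi> c * \<phi> d' + \<phi> d * \<phi> c' + \<phi> e * \<phi> b') * \<theta> ^ 5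
      + (\<phi> c * \<phi> e' + \<phi> d * \<phi> d' + \<phi> e * \<phi> c') * \<theta> ^ 6
      + (\<phi> d * \<phi> e' + \<phi> e * \<phi> d') * \<theta> ^ 7 + \<phi> e * \<phi> e' * \<theta> ^ 8"
    unfolding uv ev5.simps by algebra
  then show ?thesis
    unfolding p t by (simp add: uv reduce2_def assms algebra_simps)
qed

section \<open>The prime field and the action of automorphisms on witnesses\<close>

context quintic_field
begin

lemma of_nat_char_0:
  assumes "prime p" "q = p ^ k"
  shows "of_nat p = (0::'a)"
  using CHAR_eq[OF assms] of_nat_CHAR[where 'a = 'a] by simp

lemma frob_numeral: "frob (numeral n) = numeral n"
proof -
  have "frob (of_nat m) = of_nat m" for m by (induction m) simp_all
  from this[of "numeral n"] show ?thesis by simp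
qed

lemma embedding_surj:
  fixes \<phi> :: "'c \<Rightarrow> 'a"
  assumes "card (UNIV :: 'c set) = q" "inj \<phi>" "\<And>x. frob (\<phi> x) = \<phi> x" "frob z = z"
  shows "\<exists>x. z = \<phi> x"
proof -
  have "range \<phi> = Fq q"
  proof (rule card_subset_eq)
    show "range \<phi> \<subseteq> Fq q" using assms(3) by (auto simp: in_Fq_iff)
    show "card (range \<phi>) = card (Fq q :: 'a set)" unfolding card_Fq using assms(1,2) by (simp add: card_image)
  qed simp
  then show ?thesis using assms(4) by (auto simp: set_eq_iff in_Fq_iff)
qed

text \<open>Apart from a and b the defining equation involves only ring operations and q-th powers,
  which every automorphism respects. It is applied to squaring for q = 4 and to \<open>frob\<close>
  for q = 5.\<close>

lemma dependent_pair_automorphism: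
  assumes \<sigma>: "field_automorphism \<sigma>" and "dependent_pair a b"
  shows "dependent_pair (\<sigma> a) (\<sigma> b)"
proof -
  have add: "\<sigma> (x + y) = \<sigma> x + \<sigma> y" and mult: "\<sigma> (x * y) = \<sigma> x * \<sigma> y" for x y
    using \<sigma> by (auto simp: field_automorphism_def)
  have z: "\<sigma> 0 = 0" using add[of 0 0] by (metis add_0_right add_left_imp_eq)
  have inj: "\<sigma> x = \<sigma> y \<longleftrightarrow> x = y" for x y
    using \<sigma> by (auto simp: field_automorphism_def bij_def inj_eq)
  have one: "\<sigma> 1 = 1" using mult[of 1 1] inj[of 1 0] z by simp
  have pow: "\<sigma> (x ^ n) = \<sigma> x ^ n" for x n by (induction n) (simp_all add: one mult)
  have fr: "\<sigma> (frob x) = frob (\<sigma> x)" for x by (simp add: frob_def pow)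
  have diff: "\<sigma> (x - y) = \<sigma> x - \<sigma> y" for x y
    using add[of "x - y" y] by (simp add: algebra_simps)
  obtain t w where tw: "w \<noteq> 0" "frob t \<noteq> t"
      "(frob t - t + frob (frob t - t)) * frob w + b * (frob t - t) * frob2 w
        + a * frob (frob t - t) * w = 0"
    using assms(2) by (auto simp: dependent_pair_def Let_def)
  have "\<sigma> w \<noteq> 0" "frob (\<sigma> t) \<noteq> \<sigma> t" using tw(1,2) inj z by (metis, metis fr)
  moreover have "\<sigma> ((frob t - t + frob (frob t - t)) * frob w + b * (frob t - t) * frob2 w
        + a * frob (frob t - t) * w) = 0" using tw(3) z by simp
  then have "(frob (\<sigma> t) - \<sigma> t + frob (frob (\<sigma> t) - \<sigma> t)) * frob (\<sigma> w)
      + \<sigma> b * (frob (\<sigma> t) - \<sigma> t) * frob2 (\<sigma> w) + \<sigma> a * frob (frob (\<sigma> t) - \<sigma> t) * \<sigma> w = 0"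
    by (simp only: add mult diff fr)
  ultimately show ?thesis unfolding dependent_pair_def Let_def by blast
qed

lemma field_automorphism_frob: "field_automorphism frob"
  unfolding field_automorphism_def bij_def
  by (auto simp: inj_on_def intro!: surjI[of _ "\<lambda>x. frob4 x"])

text \<open>\<open>frob\<close> has order five, so undoing it once amounts to applying it four more
  times.\<close>

lemma dependent_pair_frobD:
  assumes "frob a = a" "dependent_pair a (frob b)"
  shows "dependent_pair a b"
proof -
  have *: "dependent_pair a (frob x)" if "dependent_pair a x" for x
    using dependent_pair_automorphism[OF field_automorphism_frob that] assms(1) by simp
  have "dependent_pair a (frob (frob4 b))" by (intro * assms(2))
  then show ?thesis by simp
qed

lemma trace_witness_frobD:
  assumes "frob \<tau> = \<tau>" "trace_witness (frob \<psi>) \<tau>"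
  shows "trace_witness \<psi> \<tau>"
proof -
  have *: "trace_witness (frob x) \<tau>" if x: "trace_witness x \<tau>" for x
  proof -
    obtain y s where "tr y = 0" "x = frob y * (frob s - s)" "tr (y * s) = \<tau>"
      using x by (auto simp: trace_witness_def)
    then have "tr (frob y) = 0 \<and> frob x = frob2 y * (frob2 s - frob s) \<and> tr (frob y * frob s) = \<tau>"
      using tr_frob[of "y * s"] by simp
    then show ?thesis unfolding trace_witness_def by blast
  qed
  have "trace_witness (frob (frob4 \<psi>)) \<tau>" by (intro * assms(2))
  then show ?thesis by simp
qed

end

text \<open>Modulo 2, X ^ 31 - 1 is X - 1 times the six irreducible quintics, so x is a root of one
  of them. All six generate the field with 32 elements; hence each case has a polynomial in x that
  is a root of X ^ 5 - X ^ 2 - 1. The identities are stated over the integers, with the multiple of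
  2 displayed, so that they are plain ring identities.\<close>

lemma quintic_root_char2:
  fixes x :: "'a::field"
  assumes two: "(2::'a) = 0" and x: "x ^ 31 = 1" "x \<noteq> 1"
  shows "\<exists>\<theta>::'a. \<theta> ^ 5 = \<theta> ^ 2 + 1"
proof -
  have "(x - 1) * ((x ^ 5 + x ^ 2 + 1) * (x ^ 5 + x ^ 3 + 1) * (x ^ 5 + x ^ 3 + x ^ 2 + x + 1) * (x ^ 5 + x ^ 4 + x ^ 2 + x + 1) * (x ^ 5 + x ^ 4 + x ^ 3 + x + 1) * (x ^ 5 + x ^ 4 + x ^ 3 + x ^ 2 + 1)) =
      x ^ 31 - 1 + 2 * (x ^ 30 + 2 * x ^ 29 + 4 * x ^ 28 + 6 * x ^ 27 + 11 * x ^ 26 + 14 * x ^ 25 + 19 * x ^ 24 + 24 * x ^ 23 + 26 * x ^ 22 + 33 * x ^ 21 + 27 * x ^ 20 + 28 * x ^ 19 + 22 * x ^ 18 + 12 * x ^ 17 + 10 * x ^ 16 - 10 * x ^ 15 - 12 * x ^ 14 - 22 * x ^ 13 - 28 * x ^ 12 - 27 * x ^ 11 - 33 * x ^ 10 - 26 * x ^ 9 - 24 * x ^ 8 - 19 * x ^ 7 - 14 * x ^ 6 - 11 * x ^ 5 - 6 * x ^ 4 - 4 * x ^ 3 - 2 * x ^ 2 - x)"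
    by algebra
  then have "(x - 1) * ((x ^ 5 + x ^ 2 + 1) * (x ^ 5 + x ^ 3 + 1) * (x ^ 5 + x ^ 3 + x ^ 2 + x + 1) * (x ^ 5 + x ^ 4 + x ^ 2 + x + 1) * (x ^ 5 + x ^ 4 + x ^ 3 + x + 1) * (x ^ 5 + x ^ 4 + x ^ 3 + x ^ 2 + 1)) = 0"
    using two x(1) by simp
  then consider "x ^ 5 + x ^ 2 + 1 = 0" | "x ^ 5 + x ^ 3 + 1 = 0" | "x ^ 5 + x ^ 3 + x ^ 2 + x + 1 = 0" | "x ^ 5 + x ^ 4 + x ^ 2 + x + 1 = 0" | "x ^ 5 + x ^ 4 + x ^ 3 + x + 1 = 0" | "x ^ 5 + x ^ 4 + x ^ 3 + x ^ 2 + 1 = 0"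
    using x(2) by auto
  then show ?thesis
  proof cases
    case 1
    have "(x) ^ 5 - (x) ^ 2 - 1 =
        (x ^ 5 + x ^ 2 + 1) * (1) + 2 * (- (x ^ 2) - 1)"
      by algebra
    then show ?thesis using 1 two by (intro exI[of _ "x"]) (simp add: diff_diff_eq)
  next
    case 2
    have "(x ^ 2 + x) ^ 5 - (x ^ 2 + x) ^ 2 - 1 =
        (x ^ 5 + x ^ 3 + 1) * (x ^ 5 + 5 * x ^ 4 + 9 * x ^ 3 + 5 * x ^ 2 - 4 * x - 5) + 2 * (- (x ^ 4) - 3 * x ^ 3 - 3 * x ^ 2 + 2 * x + 2)"
      by algebra
    then show ?thesis using 2 two by (intro exI[of _ "x ^ 2 + x"]) (simp add: diff_diff_eq)
  next
    case 3
    have "(x ^ 4 + x) ^ 5 - (x ^ 4 + x) ^ 2 - 1 =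
        (x ^ 5 + x ^ 3 + x ^ 2 + x + 1) * (x ^ 15 - x ^ 13 + 4 * x ^ 12 - 4 * x ^ 10 + 7 * x ^ 9 + x ^ 8 - 7 * x ^ 7 + 6 * x ^ 6 + 3 * x ^ 5 - 7 * x ^ 4 + x ^ 3 + 5 * x ^ 2 - 3 * x - 3) + 2 * (2 * x ^ 4 + 3 * x + 1)"
      by algebra
    then show ?thesis using 3 two by (intro exI[of _ "x ^ 4 + x"]) (simp add: diff_diff_eq)
  next
    case 4
    have "(x + 1) ^ 5 - (x + 1) ^ 2 - 1 =
        (x ^ 5 + x ^ 4 + x ^ 2 + x + 1) * (1) + 2 * (2 * x ^ 4 + 5 * x ^ 3 + 4 * x ^ 2 + x - 1)"
      by algebra
    then show ?thesis using 4 two by (intro exI[of _ "x + 1"]) (simp add: diff_diff_eq)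
  next
    case 5
    have "(x ^ 3) ^ 5 - (x ^ 3) ^ 2 - 1 =
        (x ^ 5 + x ^ 4 + x ^ 3 + x + 1) * (x ^ 10 - x ^ 9 + x ^ 7 - 2 * x ^ 6 + x ^ 5 + 2 * x ^ 4 - 4 * x ^ 3 + 3 * x ^ 2 + x - 7) + 2 * (4 * x ^ 4 + 4 * x ^ 3 - 2 * x ^ 2 + 3 * x + 3)"
      by algebra
    then show ?thesis using 5 two by (intro exI[of _ "x ^ 3"]) (simp add: diff_diff_eq)
  next
    case 6
    have "(x ^ 2 + x) ^ 5 - (x ^ 2 + x) ^ 2 - 1 =
        (x ^ 5 + x ^ 4 + x ^ 3 + x ^ 2 + 1) * (x ^ 5 + 4 * x ^ 4 + 5 * x ^ 3 - 4 * x - 1) + 2 * (- (x ^ 3) + 2 * x)"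
      by algebra
    then show ?thesis using 6 two by (intro exI[of _ "x ^ 2 + x"]) (simp add: diff_diff_eq)
  qed
qed

text \<open>The same method with X ^ 11 - 1, since 11 divides 3 ^ 5 - 1; modulo 3 it is X - 1 times
  only two quintics.\<close>

lemma quintic_root_char3:
  fixes x :: "'a::field"
  assumes three: "(3::'a) = 0" and x: "x ^ 11 = 1" "x \<noteq> 1"
  shows "\<exists>\<theta>::'a. \<theta> ^ 5 = \<theta> + 1"
proof -
  have "(x - 1) * ((x ^ 5 + x ^ 4 + 2 * x ^ 3 + x ^ 2 + 2) * (x ^ 5 + 2 * x ^ 3 + x ^ 2 + 2 * x + 2)) =
      x ^ 11 - 1 + 3 * (x ^ 9 + x ^ 7 + x ^ 6 - x ^ 5 + x ^ 4 - 2 * x ^ 3 - 1)"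
    by algebra
  then have "(x - 1) * ((x ^ 5 + x ^ 4 + 2 * x ^ 3 + x ^ 2 + 2) * (x ^ 5 + 2 * x ^ 3 + x ^ 2 + 2 * x + 2)) = 0"
    using three x(1) by simp
  then consider "x ^ 5 + x ^ 4 + 2 * x ^ 3 + x ^ 2 + 2 = 0" | "x ^ 5 + 2 * x ^ 3 + x ^ 2 + 2 * x + 2 = 0"
    using x(2) by auto
  then show ?thesis
  proof cases
    case 1
    have "(x ^ 4 + 2 * x ^ 3 + 2 * x ^ 2) ^ 5 - (x ^ 4 + 2 * x ^ 3 + 2 * x ^ 2) - 1 =
        (x ^ 5 + x ^ 4 + 2 * x ^ 3 + x ^ 2 + 2) * (x ^ 15 + 9 * x ^ 14 + 39 * x ^ 13 + 102 * x ^ 12 + 171 * x ^ 11 + 176 * x ^ 10 + 82 * x ^ 9 - 43 * x ^ 8 - 101 * x ^ 7 - 77 * x ^ 6 + 2 * x ^ 5 + 89 * x ^ 4 + 70 * x ^ 3 - 48 * x ^ 2 - 27 * x + 49) + 3 * (- 42 * x ^ 4 - 71 * x ^ 3 + 15 * x ^ 2 + 18 * x - 33)"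
      by algebra
    then show ?thesis using 1 three by (intro exI[of _ "x ^ 4 + 2 * x ^ 3 + 2 * x ^ 2"]) (simp add: diff_diff_eq)
  next
    case 2
    have "(x ^ 2 + 2 * x + 2) ^ 5 - (x ^ 2 + 2 * x + 2) - 1 =
        (x ^ 5 + 2 * x ^ 3 + x ^ 2 + 2 * x + 2) * (x ^ 5 + 10 * x ^ 4 + 48 * x ^ 3 + 139 * x ^ 2 + 252 * x + 244) + 3 * (- 13 * x ^ 4 - 158 * x ^ 3 - 209 * x ^ 2 - 278 * x - 153)"
      by algebra
    then show ?thesis using 2 three by (intro exI[of _ "x ^ 2 + 2 * x + 2"]) (simp add: diff_diff_eq)
  qed
qed

lemma ex_power_neq_1:
  assumes "0 < n" "n < CARD('a) - 1"
  shows "\<exists>x::'a::{field,finite}. x \<noteq> 0 \<and> x ^ n \<noteq> 1"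
proof (rule ccontr)
  assume "\<not> ?thesis"
  then have sub: "UNIV - {0} \<subseteq> {x::'a. poly (monom 1 n - 1) x = 0}" by (auto simp: poly_monom)
  have "coeff (monom 1 n - 1 :: 'a poly) n = 1" using assms by simp
  then have nz: "monom 1 n - 1 \<noteq> (0 :: 'a poly)" by (metis coeff_0 zero_neq_one)
  have "CARD('a) - 1 = card (UNIV - {0::'a})" by (simp add: card_Diff_singleton)
  also have "\<dots> \<le> card {x::'a. poly (monom 1 n - 1) x = 0}" using sub by (intro card_mono) auto
  also have "\<dots> \<le> degree (monom 1 n - 1 :: 'a poly)" using nz by (rule card_poly_roots_bound)
  also have "\<dots> \<le> n" by (intro degree_diff_le) (auto intro: degree_monom_le)
  finally show False using assms by simp
qed

text \<open>The polynomial X ^ n - 1 has too few roots to contain all non-zero elements, so some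
  n-th power differs from 1; its m-th power is 1 because n m is the order of the multiplicative
  group.\<close>

lemma ex_root_of_unity:
  assumes "n * m = CARD('a) - 1" "1 < m" "0 < n"
  shows "\<exists>x::'a::{field,finite}. x ^ m = 1 \<and> x \<noteq> 1"
proof -
  have "n < CARD('a) - 1" using assms by (metis mult.right_neutral nat_mult_less_cancel1)
  then obtain x :: 'a where x: "x \<noteq> 0" "x ^ n \<noteq> 1" using ex_power_neq_1 assms(3) by blast
  have "x ^ (CARD('a) - 1) * x = 1 * x"
    using power_card_field[of x] by (simp flip: power_Suc2)
  then have "x ^ (CARD('a) - 1) = 1" using x(1) by simp
  then have "(x ^ n) ^ m = 1" by (simp add: assms(1) flip: power_mult)
  then show ?thesis using x(2) by blast
qed

section \<open>Certificates\<close>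

lemma pair_certificate_O2:
  "certified_rows (pair_check O2) (vectors [I2] [O2] [O2] [O2] [O2])
   [''433C4'']"
  by code_simp

lemma pair_certificate_I2:
  "certified_rows (pair_check I2) (vectors gf2s gf2s gf2s gf2s gf2s)
   [''434D343433433C443CD4'',
    ''C3D4343DD3434C343DC3'',
    ''4334343C34C333443DD4'',
    ''C3D33C3CD343C43C3C34'',
    ''43CC343CC443443C3CD4'',
    ''433C343DC443444C34D3'',
    ''D3DD443434D3D33443D3'',
    ''433D3C3CC343CD343D43'']"
  by code_simp

lemma trace_certificate_O2:
  "certified_rows (trace_check O2) (vectors gf2s gf2s gf2s gf2s [I2] @
     vectors gf2s gf2s gf2s [I2] [O2] @
     vectors gf2s gf2s [I2] [O2] [O2] @
     vectors gf2s [I2] [O2] [O2] [O2] @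
     vectors [I2] [O2] [O2] [O2] [O2])
   [''433D334CD443C44C4C44'',
    ''D4C43D43344C3D4D33D3'',
    ''4333434C4443CC3D4CD4'',
    ''C4C33D3C34C4C43CCC33'',
    ''433D4C33C443C4344C44'',
    ''44C34C3CC4C3344D3CC4'',
    ''C3C33D3343443C4C33D3'',
    ''43CC4C3CD3'',
    ''34344'']"
  by code_simp

lemma trace_certificate_I2:
  "certified_rows (trace_check I2) (vectors gf2s gf2s gf2s gf2s [I2] @
     vectors gf2s gf2s gf2s [I2] [O2] @
     vectors gf2s gf2s [I2] [O2] [O2] @
     vectors gf2s [I2] [O2] [O2] [O2] @
     vectors [I2] [O2] [O2] [O2] [O2])
   [''D43D4C33D4C3C34D3C33'',
    ''DCC44433C4C333443C33'',
    ''C3343D33D434343C3CC3'',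
    ''C3C4343343D4C3443CD4'',
    ''44C4344CC434CD3D3344'',
    ''3CC44433C3D333443C34'',
    ''D3CD343344C4CC443CD3'',
    ''34C4334C34'',
    ''D3CC3'']"
  by code_simp

lemma cubic_certificate_2: "cubic_check (V O2 I2 O2 O2 O2)"
  by code_simp

section \<open>Witnesses for q = 3\<close>

lemma pair_certificate_O3:
  "certified_rows (pair_check O3) (vectors gf3_units [O3] [O3] [O3] [O3])
   [''433D4C3344'']"
  by code_simp

text \<open>Only b = 1 is left out: a = b = 1 gives a set of pseudoregulus type.\<close>

lemma pair_certificate_I3:
  "certified_rows (pair_check I3) (vectors gf3s gf3s gf3s gf3s gf3_units @
     vectors gf3s gf3s gf3s gf3_units [O3] @
     vectors gf3s gf3s gf3_units [O3] [O3] @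
     vectors gf3s gf3_units [O3] [O3] [O3] @
     vectors [O3, T3] [O3] [O3] [O3] [O3])
   [''C3CE3C3C33C3CS443T54C3UD4E3E44U4T34C35S4434D4'',
    ''C3ES4D3CT4E4T44D3TE4E34D44334343C33C4TC4D3EE4'',
    ''43UE4C3E54C3S54E3D54C3UC44343343S54C3CE4C35D3'',
    ''C3S4343T43C3SU443CT4E34C4435U4E3DD343S44D3S44'',
    ''C3UC343T34D35C3D3DD343TS4E3EC343DS4C3S4443DC3'',
    ''433C4E4U3443EE3D33D3C3S34E354343SE4434E3C3U34'',
    ''433D44333443344C3TC4D343443U54434T443DE4C3343'',
    ''D34E4435E4D3U4343CD443TE3C3D4443444C34E4435C4'',
    ''43EE443ST443DT4C3ET443TC443434C34U4C3ED443544'',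
    ''434C343UU4435S443SD4C3DC4C3SE443SE3E3ES443DD3'',
    ''C3TU4D3ED3435T4C3TE343UE3U4TE443TU4C3DS443CC3'',
    ''D3UE443ET4C335443E34435E3E3433435D4E3SD334SD3'',
    ''43SS443TE4D35E3C3SC3E3CE34353443DC443TC343D33'',
    ''43UD4C35E4D34S4433S4434S443DD4C3334D3SD4C3CC4'',
    ''34E3434DC343T4443EC343ED4433C3434E443S34C3UT4'',
    ''C3TS443454433E4D35U4343U4C3DE343C43C3454C34D3'',
    ''43U4443SU443U34C33E3D3SE34344343E33D3CE343S43'',
    ''D334443DE3D35S4E3SD443SD3433E3E35C3C34C4D3UT4'',
    ''C3543D3E33C33D3D3C44D3US443UC4C3DE4434C4D33C4'',
    ''34DE443CS4C3EE343SC3C35C3E3S43D3ED4433T4D3ES4'',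
    ''43UD3435D334DU4E3SC3C3T34E33D3C44D3C3SC443D44'',
    ''C34E343D4343UT443CE343E4343U43C3DD3D34D343543'',
    ''34D3443US4C3E43C3TE4C3TD443354E3UC3C3D33434D3'',
    ''43C54E345443CU4D3TD443TD4C3T43E3ET443554C3C43'',
    ''D34E3E34C3C3433E3TS4C4443D3433435C343CC4C3UE3'',
    ''C3SS4D3D54C3C44344C343E54D3E44D3UD343UC343C34'',
    ''D3EC4C3CU4D3543D3U54D33T4C34C3'',
    ''43CD343D34'']"
  by code_simp

lemma pair_certificate_T3:
  "certified_rows (pair_check T3) (vectors gf3s gf3s gf3s gf3s gf3s)
   [''C34C44344343433D3EE3C3454D3UD4C3TD343C5443UU4'',
    ''C35C4C3DD4D3SC3D3SE443DT443ET434DD4D34C4C3S34'',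
    ''C3T3443DD343334D33E4C3TU4C3CE443CD343CD4D3EE4'',
    ''C3CD3434T443344C344443D4443E5443TE443ED3C3EC4'',
    ''43UD334CD3D3E44E3434C33U443TS4D3C34D3TT4435D3'',
    ''3454443U4343444E3S34E3EE3C3ES443UT4434E343SE3'',
    ''43US443UE334DC343DE4D3CS4C35E343ED4434S443534'',
    ''C4TD4C3E3343SD3C4C5443UC343T54C33D4D3ST4C3554'',
    ''C3ED3C3E3443TU4433D3433S443S34C3ET4C35T4E3543'',
    ''43U4434DS443T44433E343SE4E3DD3435S443S4443TE3'',
    ''D3CD4C333443S54435U443DE343CC3C35D3E3CU4C4E34'',
    ''C3354433C4C3CU443U54D334334DC443CS443SU443D34'',
    ''C3D44D34U4C3DC4C35E4C3EU4C33T4C3TT4E35S434444'',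
    ''D3SE343DC434UD3E3SU4D3U4343ES4E3U4443DC3435C3'',
    ''43TD343454E43C3C3E4343T43C3UD4C3C3443DU4433E4'',
    ''43EC4C33D3C3UD3D3S54434D443E43C3US4435T443U34'',
    ''34EE4C3D3434DE4E4CE443UE4E35E4433U443E34C3C33'',
    ''E35C443CC4C3UC3C3DD3C35S4D3554D3TE343EE343ST4'',
    ''43EC3D3ED3C3UU4C3DS443TC3C3TS4E3TE3C4D43E34D4'',
    ''D35C3C3SE443UD443543434D3C3CE3434E443DS4C3UE3'',
    ''C44C343EE443SD443SC4D3CE4D3CE334T43435C4E3454'',
    ''D34C3434U4433D4E35C3C33C334CT4C3TD4D35E343TC4'',
    ''43354E3C4343CT4C3CC4D33E34343443CE4D3454D35E4'',
    ''43C43433C343EU4C3CC343UC434T4443CE3C34U4434C3'',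
    ''43544C3DC343DD4E3ED4C3U43434C443S43C3D54C3SC4'',
    ''E3TE443343C3SE3D3T54C3EE4E3UE4D3DS4E3E3343SC3'',
    ''D3S43D3U4443D43D35D3U4E4343CU4435E3E3DE334T54'']"
  by code_simp

lemma trace_certificate_O3:
  "certified_rows (trace_check O3) (vectors gf3s gf3s gf3s gf3s [I3] @
     vectors gf3s gf3s gf3s [I3] [O3] @
     vectors gf3s gf3s [I3] [O3] [O3] @
     vectors gf3s [I3] [O3] [O3] [O3] @
     vectors [I3] [O3] [O3] [O3] [O3])
   [''C33434CCE3E3CE3D3S54E4S33E3SD5D43U4543T3E33C4'',
    ''D4SC4433T3C4CC5C3C5343ST454ST354CT543CT534SE4'',
    ''54CT3UC335T4SD4D3SE3343E3DCSD3C3S335CS4554ST4'',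
    ''34CS3TCCT4C3ST55C3S3D43S4T4355D33S3T4343SC3E4'',
    ''C4CT5E3CT5U4SE4C4335E3SS4C33U5D33C4E33U334SS5'',
    ''S43T4D4C54433D5DC3U3343S443SD3D33355C34343CD4'',
    ''43344C3CD4D43T443S4544CS54435343C433CSU45D334'',
    ''D3C43C4C55E4SU4T4CT5C3SE4D4SE444SS444C5534S43'',
    ''D3CT444CD5443S3E3S53343453C334E3345C33C4D4C34'',
    ''343D4C43D3C3SS5D3CT5C4SS3E4CT54DCC3C4C53DC334'',
    ''ECCE4433S5E33E5D3CD343SS3C33T5CECC343CS4E3SC3'',
    ''ECS544CCT3CCSE5D3C4434SD5E43D5UCCC34C3D4C3CU5'',
    ''D33S4CCSC454C35C3C4344ST444C354DSU454S3334C35'',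
    ''43S3454S35T4354'',
    ''44SE4'']"
  by code_simp

text \<open>The constant \<psi> = 1 is left out for target 1; it leads to a set of LP type.\<close>

lemma trace_certificate_I3:
  "certified_rows (trace_check I3) (vectors gf3s gf3s gf3s gf3s [I3] @
     vectors gf3s gf3s gf3s [I3] [O3] @
     vectors gf3s gf3s [I3] [O3] [O3] @
     vectors gf3s [I3] [O3] [O3] [O3])
   [''E4S35D4CD4U43U4443U544S4344CC4U4SD4CCS33C3S35'',
    ''E43C5TCCD3C3345CDCD334355EDS334434544SC3D3SD3'',
    ''E3CS444SU343C55E3SU34CSD543353E33T5D4SS443S54'',
    ''43CU44D3E5D33E4433U5S4SU3E3S4543SU3C3CS4E3334'',
    ''TC343C3ST4D3355S4CD4343C3E4C44TC3T33CCC44CCE4'',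
    ''34CC5TDSS5D33U3C4SC3C33U4D4ST4C4CU3SDS55ECCT4'',
    ''4C3C3DCSE454CD5543D4U43T3D3C33C33C354SD334ST5'',
    ''C3CD343CE3TCST3SCCD5433E4D3CS4543D543SE53CCU4'',
    ''34CT3C43E3SCSS4C3SE354SD5D3CC5S4SE3C4C3354CD4'',
    ''E33S3443S544S53E3CU5DDS43SC3U4E3ST4C3CU4D3CC3'',
    ''T4S35C3SS43CSE344CS434S4444SD3UCSE5C43E4D3C34'',
    ''34343E43D443C44ECSS3C33T44334544C54443D543S43'',
    ''C4SC443CD5C3335C4CU4433D3D33E5C434443SD4E4CC5'',
    ''EC3T5D4CU3D33U4'']"
  by code_simp

lemma trace_certificate_T3:
  "certified_rows (trace_check T3) (vectors gf3s gf3s gf3s gf3s [I3] @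
     vectors gf3s gf3s gf3s [I3] [O3] @
     vectors gf3s gf3s [I3] [O3] [O3] @
     vectors gf3s [I3] [O3] [O3] [O3] @
     vectors [I3] [O3] [O3] [O3] [O3])
   [''43SC4D3SC3C4S3443CC5C3C54C4CE4433C35E343C43T4'',
    ''34CU3D3S34EC335CCCU4E3S343CCE4CD3S5C3S34D4CT4'',
    ''T4C35C3344D43E4S4C35U43U5T4C53U4C35T4C4434SU5'',
    ''C4SD4E43T354345C33U3D334544ST5C435454C43T4SS4'',
    ''34C3443S33DC3T4D4CU443C3454343C3CS34333544S35'',
    ''C3ST34433444SE5E3SE3D33D4TCST5E33D5S43E334S33'',
    ''TD343C4SU4E3CU3E4CE5343D3C3SE55C3C4D3CU4E33S4'',
    ''34CD5D4CS4T43D5E4SU5T43C35C354T43E4D3CE5C33C5'',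
    ''4C3535C3T443SS5E4355D43D443CS3U43T4D3C53433S4'',
    ''43SE3D3C54S4S3343CE434ST33C343433E54C3U454SC4'',
    ''343T5D3CU554SC554CC4T43C5U4343C3CU3543C33DSU5'',
    ''C3SS3D3CE3DCST3TC3S4E3C3354SC354CC5E3S5534CT4'',
    ''343C4UCCU4E33U54CCT5E4CC4E3CT4S4SC3C3S54E3SS3'',
    ''T4ST5C3C44CC3T3'',
    ''T4SU4'']"
  by code_simp

lemma cubic_certificate_3: "cubic_check (V I3 O3 I3 O3 O3)"
  by code_simp

section \<open>Witnesses for q = 4\<close>

lemma pair_certificate_O4:
  "certified_rows (pair_check O4) (vectors gf4_units [O4] [O4] [O4] [O4])
   [''43C44E3SU4F3cf4'']"
  by code_simp

lemma pair_certificate_I4: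
  "certified_rows (pair_check I4) (vectors gf4s gf4s gf4s gf4s gf4s)
   [''43D4343433F3CU4E3Cf443CD3C3D4344TD444dD443dd4F3CV444Ve4C3Ed443TT4E3Ce4C3FT444eV4'',
    ''C3CD4433C3D3UC4D3fC443C44D3C33D3544D3644C3Ff4444F3C3fS4E34E4C3EU4444E3F34F4C3Uc4'',
    ''C3cU4F3d64D33T443ce4C3S54445C343cd4E3cD3435F443ef4F3fD364UC4C3e3443E44E3dU4D35V4'',
    ''C3Sf4E3T5443SV4D33d4C3c64446C3F3SD343ST4C3V3443F44D36e4F3Tf4436E443VU454fC4E3UD3'',
    ''4333443443F3SC4E3cC443C4343344D3ET4D3Fd4T4Cf4C3de4D3V34D3CS4T43D3C3TV4D3Cc4D3e34'',
    ''434D44334343Ce443CV443DD443D44E3cd4E3SD4C3e43C3Fe4644S4D33U4C3V43C3EV4D33f4544c4'',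
    ''43Cf4F3FS4F3cV4D3ES443dU4E34C343fE454TS4C35F4446E4C3TF3d46d4E3cC3D3eD36CdV454SE4'',
    ''43CU4E3Ec4D3Fc4E3Se443Tf4E3Dd464dc443UF4E3dF4D3VD3545C35CTe4C36E4445F4T45T4C3dE3'',
    ''43VD3d4VD3E3UU443fV4E3ec4433c4D3S54T4C3443CF3E3eF3D3TF343UT4D3FD4C33S443dD4C3ef4'',
    ''43Cd4F3D33D3454F3Dc4C3DT4E3Uc4F3dU4C3E4343S34C3VF343UE343eF3544E4C3fF3C3cc4T4EF3'',
    ''43EU4C35d4D3c44644U4C3EC3434f454f34D3V5443ed4F33c4E3C3443DF3C3c34C3CS443fT4C3fD3'',
    ''43Ee4F3Sf443TF3E3US4E3CT443dS4D36F34354443Te4E3F44C3C54F3CE4C3De4435D4C3f3443cE3'',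
    ''43eD3T4eD343Ue4F3ff4E3C44433S4T4VE4D3c64D3ED4C33c4C3VU443TD443CE3F3VE343fd4D3dE3'',
    ''43CT4E3D33E3DS4D3464C3Dd4F3fS4C3F43E3Tf454CE3C3UE3T4eE4C3SS443c34C3eE343VE343fF3'',
    ''43FV4E3cU4F3fc443dE3E3F3343Tc443644D35E3C3DV4436D443SF3C3U3443dV4E3fd4E3CF4C3C64'',
    ''43Ff4C36T4544f4D3S44C3FC3434U4D3e6464U34C3S34C3Cc4C3UD343Ud443VT4E33S443DE3E36T4'',
    ''443D4C3CC3U4UD3T4543C3D44D34D3C3cD3C3SD3C3E3343FC3D3U54446F4C3F3343EC3445E4D3f64'',
    ''43CC443D3454SC464cC44343443DD3C3E54C3F6454TF454D54C35D3D3fE364dE454F44D3UF3C36D3'',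
    ''44dV4D3UU4D3dF3E3Sc443U34C3dD343FD443f64C3f54434c464fE343E3443eD443Td4C3dC3F34T4'',
    ''44Te4D3ff4E3Sd4D3TE343f34C3TD343U5443ED443VD443dT4E34d4C3TC3C3U64434S443F3454UF3'',
    ''C3DD443DC3F3fF3E3UE343CC3C3DC3C3VC4C3eC4C3c43434E444cD3645F4C3S43434F4546E444SD3'',
    ''433D3C3D3343UD443fD4C3C34433D443dc443TS443fc443c54F3364F3DD443US443S64E3DD4E3354'',
    ''43f4343De4E3SF343SE3E3d4343F6443T64D33F443FD344SC4D3E54436D3D3fD3D35F444cf4446S4'',
    ''43U4343DV443cF3F3cE3F3T4343E54D33E443d54D3UD3D36E4445c444SU443ED344cC4435D3D3F64'',
    ''43Uc4F3Ue4433F3543V443D54C3T64CC6d443EF343Df443DF4D3TF443ec4F3Vd4436U443CF4F3CT4'',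
    ''C3FE343U44D3ST4E3E4443C54D3V64C3V54D3EV444D54E3DU4F3eC4433F4C35E4F33V4F3C33T4F64'',
    ''43SS4E3SU4C3FF4T4VT4433f4C3Fd4E33E4443F4C34F343EE343SC3C3VT464d44435d4545e4433T4'',
    ''C363454VF3F3D43E34D454D4343T34f4C4443DS454Ud4F3cF443e64F35C4D3F44D3eC443fF4F3SF3'',
    ''43fS4E3fV454eC3433E343D64C3d5443FE3CC5T4E3eT4435f4E3Cd443CE443DU443DE443VS4D3dE4'',
    ''C3EF343f44F3F44D3cd443C64D3e54D3Fe4C3e64C36F4E33e4U4TS4E3C3344D64F3Df4433E4E3VC4'',
    ''C353464eE3E34e4E3D43544D443d3443Dc4U4C44D3E44D3VC4E3cE343UE464fT4E3SE4E36C443V54'',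
    ''43cc4F3cf4U4D33C3EE4433U4C3ET4443E4F33F454T44436T4433d4646V4C34E343FF3C3ed443cC3'',
    ''444e4E3de4T4C4343e54436E3D35C4435E3C33T4C3364D3564D3Vd4F3CC3C3CF4D36S4435c4D3UT4'',
    ''43fD3D3TE4C3dU4E3Vc4C3SC4C366443643D3eF3C3DS454f54E3E34E3TV444eC46454443VC343Ve4'',
    ''C3T54C3Df443e43F3DC3D3d64543D3D3EU443FS4D34V4D3Ec443eS4F3cd443E43C3464F36F343UV4'',
    ''D336443f54E3FV443TD3D3Sc4C3FD44365443Fd4C36e4F3SF4645C3E334443dC3C34c44336443dE4'',
    ''F3cC3C36F3C36V4C3E34C3Ec4D3UE4436C3f4FD4D3dT4C3eF4D3SE344De4435C4E3DF343Uf4d4Te4'',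
    ''U45U4D3ce4F3Cf4D3D64C3CT4D3cT443Vd443eU4C3EE3D3S64F3dC343VE4444U4435E443V34E3664'',
    ''C3cV443d6443VV4D3SD34346443fE3D3c3464cf4C3VF443df4U4fF3434d443SU443VF4D3fE4C3eT4'',
    ''43de443cT4C36C343S4443SF4F3U43E3U3464S43D3U4343DT443CS454eC443d44D3F3444d4443554'',
    ''C3dF3d4d4343cD443TE3C3VC3E3VF343FF4D3FF3C3ES443Sf4f46S454F4343Ed4F3Tc443ff4C3SC3'',
    ''D3e43C3dD443SE4D3TD4D3cC443Fc4D34F3C33F444dE3C3Ce443FC4D3DS443634D36f4D3DF4D3FC3'',
    ''C3564f4Dd4D3d54D3FV4f43f4T436443S54C3f44C3fU45465443c43C3UU4D3VU4d4Ue443FU4E3454'',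
    ''U43V4C3fC3436e443E6444DF3C34E4C3dV443T43446c443Fe443SD3E3cc4D354364df4C3e54E33C3'',
    ''T4FC3F36E4D36V444TU4E3fc4435S443e44C3Cf4F3Uf4C3Ee4D3Vf443VF3C3fC4D3TD343VC4435U4'',
    ''C36f4C3S44E3UV4C3DE3D36E3D3U44C3FU4C3V44E35d4C3eD343TC4E3E54D3CF3C3SE3C35D4D3ED3'',
    ''C34U4436d4436V4F3D34C3fD4D3Dd4E3SS4C33V4C3fT464cT4C3Td454C44D3UC3C3E44C3SV444S34'',
    ''E3d5443TE4C34T4D33V443cC4F3f44433V4C3ee4C3df4E34C444cE443Se443UC4D3DE343fC3445C4'',
    ''444V4F3TV443V64U4dC4435F3D36C4C33d4436F3C3CE4D35c4D3fd4436S4C3354D3654E3CC3D3eT4'',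
    ''43UD3D3dF4E3DE3C3Tf4C3cC4C3554D3VE34354344VC45464443eV443eC3C3Dc464U64E3FS4F3F34'',
    ''D335443U6443dD3E3V64D3cS4C3ED443ET44356443TC3C34S443TF443354C35V4E3cE4E33D3546C3'',
    ''C3d64C3DU4E3DC343V43D3T5454EV443Ec4D3Ff443F43C345443fe4E35E3D34e4D3FS4E3ST443Vc4'',
    ''E3SC3C35E3C3F34C35e4C3FS4D3fF4U4ED4435C3436C4F3DE3T4dV443fU4D3Td4C3VE444DV4D3cF3'',
    ''T4EF4D3SV4D3D54E3CU4C3Cd4D3Sd443Vf443eT4444f4436F4E3cF343e34C3FF3D3c5443eF4E3TC3'',
    ''43TV443Sd443c44C35C343cE4E3f4354c43F3f3443T44D3E344366444T44D3f4343Dd4545V443Cc4'',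
    ''C3Se443T54D3cD343ee44345443UF354SU4D3S3443cf443eE4C3Vd4D3UF4C3eE443TU4434T4f4UE3'',
    ''d4EC3E35F444df4D35e4F3US4436c4C3CU443V44C3UC4D3dD3436f443eC4E3fU4C3FV443eE3D3eU4'',
    ''C35U4C3c44C3DF3E3E64D35F3D3f44C3e44C3Ef4D3CE3C3cF3D3FD3C36D4F36T4C3VD3F3F6443dC4'',
    ''F3T6443dF4D33e4C34d443SC4E3U44C3VV4433e443fC4D3DF3446C443UC3C3TU4F34C443cV444SF4'',
    ''C34f4435T4E3D34435e4C3UD4D3DT4C33e4F3cc4D3fC3C3F4444c34C3ce4C3Ud454Sd464C44C3dT4'',
    ''C3TE3T4T4343dF343SD4C3eC3F3eE3D3EE343EE443FT4E3dS4C3cC343UU4C3Fc443cU464E43U45c4'',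
    ''D3V43C3TD4D3dD443cF4D3SC443ES4C33E4D34E343534D35U4D3EC3D3DE444TF3C3CV4D3Dc443EC4'',
    ''f43e4C3UC343F54435V444DE3C34F443d43C3Te4D364354TU4F33C3C3V64445S443EV4F3SS443cD3'',
    ''C3654U4DT4D3Ee4D3T64U43U4d4354C3U4443c64D3ef4T4fV4E3V3443Ef4C3Uf464564C3ff443S43'']"
  by code_simp

text \<open>Only b = \<open>X4\<close>, the inverse of a, is left out. No list is kept for a =
  \<open>X4\<close>, because squaring carries a = \<open>W4\<close> to it.\<close>

lemma pair_certificate_W4:
  "certified_rows (pair_check W4) (vectors gf4s gf4s gf4s gf4s gf4_units @
     vectors gf4s gf4s gf4s gf4_units [O4] @
     vectors gf4s gf4s gf4_units [O4] [O4] @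
     vectors gf4s gf4_units [O4] [O4] [O4] @
     vectors [O4, I4, W4] [O4] [O4] [O4] [O4])
   [''44CS4T444443fF4E3V54C3TV4D3cC3E3ES4F35C3D3D6443eS443SC443Tc4E3Tc443dT443FT443554'',
    ''C3UD443Cd4435C443TE4D3cC443Td443FF343E6454dd4U4D4343VC4C3T44433V443dF343V3454TT4'',
    ''D3FU4E3DF3C3DE4436f44343443VU4D3VE4C3SS443T64C3C43C3Sc454F44544D4F3TE3D3UF4433E3'',
    ''433U4C3S34E3fE443C64D3FD3C3SD443f54E3FS443fC464CE35CF44C35F4C3564D33S4C3cD364f34'',
    ''C3cV443U43C34S443dC4C36f4f45V454D6443CC343FF464ST443544C3T43C3dD4U4V34C3F6443C54'',
    ''C3dS4D3FC343f43C3F43C346443VF3F3ED464SE343de444CF3C3EV443VD4E3D43E3f64433F3C3DS4'',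
    ''434c4C3eE443CE3C35F3C3Td444CD4E3fE3F3UF4D3SU4433D4E3DU4D3SE3433f4E3TD4E3fC4C33C3'',
    ''E34E364364D3ec4C3V43D34U4C3DC4F3DC4C35c4C3Cc4C3eV4D3eE343ce4D34T4C3F3343EE343454'',
    ''T4cT4E36E3C35D4D35F4D3DE4C3UC443eF3f4fT4F35c44336443VT4C3c64C3dU454Cc4F33S464433'',
    ''C3fC3C3D33F3FF4D3F3443Fc4E3C33D3ee443UE4D3d54C3C64C3Ed444C6443c64E3T34C3FD343eT4'',
    ''C33c4T4UU4543C443444C3DE3C33C4D3eU4E3FE4D3Se4C3UF3D35c4D3CD343fC3435F4E3544E3U43'',
    ''C3E54E3DE4D3EF443fE4E3Ud4D3ET4E33V4C3C4443C34C3cF443fF3435C3D3Ue443T54C3TE443eD4'',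
    ''F3c4443V43D3eF3D3cc443fd4E3UC343T43C3TC4544T4C3TC3C3e54D3f6443SF343EU443Sd4D35D4'',
    ''C3UV4d4V44E3Ve443FC3F3Fc443cd4E34d4D3UV4F3C34D3S5443Se443Ve443cD3D3CC4C3FS4C3dC3'',
    ''43DF3C3FD454VD3E3Vc4D33U4D3SF454SD443cF443EC3C35V4C3Ve4D3c44C3F44E3EE4436e4C36E3'',
    ''43fT4E3fF3D33V4F34T4C3fV443eD343fE343643445C443VV443d54F3cC3443D444US443SD4C3V44'',
    ''43UE3E3d4444eE3C3C54D344343S4454Cd4D3dE443eE4E3S54C34e4E36e443T4443ef4E36D3D3EF3'',
    ''F35V443ed443D54D3644D3V43C3SF343fD4C3cf443644D3cD3544d4C33S4D3eC4D3VD443FS443CC4'',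
    ''U44f443fc4C34T4C34C454CE3C3Ee4E3454F3dF4T4D44436F3D3FF3D3D33D3dD354DC443CE4E34D4'',
    ''C3TE343e64D3ef4435D343dD343S4354644544c4C3ce4E3U64C3fE4643C3T4VS4C3CC3D36F4C3644'',
    ''C3DU4C33D3F3ET4D3fU4C3Ce454DT4C3Cd4C3e43E3SD4D3cS4C33V4U4CC4C3dD3E3dE3433E443ET4'',
    ''F3cf4D3564C3Fe444E4443CF4D36E343Ud4F3dE4F364343Fe4C3f43C3S54F3f43E3cT4E3TE3F34f4'',
    ''433D343SU4C3cc4D3De4E35D344T64F3Tc4C3e6443dS464TS4C3c3443SF4C3FT443U5443Ff4D3dC3'',
    ''E3dd4C33T464cC343TU4D3Cc4D3S44436E4C336443UU443DE3D3cV443fS444e43E3Sc443DC3435F3'',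
    ''43f6443UD36C4e443dC344Cc4434d4546E4C3fd4f454443V64F3fc454fF4E3DD4D3Sf443UT4F3VD3'',
    ''43DT4F343343CT4434C4T4EE443V4443SV4D33E3C3C34D364344c5443dE444fT443UF4F34D3E3T44'',
    ''D3CF3D3FC4543D4C3TD3436V4E3eU443cE3T464343V54E3eE4T4F5464c43U44D343D64F3FD4C3TF4'',
    ''D3DD3E3C3454d5444Tf4C33U4E3Td4D36D343Cc444Ve4E3VF343VD343fU444TU4C3ED3D3V5444fF4'',
    ''D34e4C3Te4C3Fd4C3Sf443ST4C3U44C3cF3F3cd443E4344E43D3dD4f4TD343eC3U4cS4C3ef4C3de4'',
    ''54C6443D34CCSD4E3TV4C3Fc443CF344fU443EC443UD4E34F443UV4E3C43C33E443FU4D3FS4C36E4'',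
    ''43eU4D3Vd443cU4D3UE4E3dV4436D3C3fE3C3FU4C3T5443DD343US4D3Dd4E3U34C3F34T4dU4C3CS4'',
    ''43VE343eF4F36E3E3SU4E3Uf4E3S4454fc443Uc444V4364T43E3ED3433F444T43C3SC444fD3D3Td4'',
    ''43Ec4433d443f4443DS443S34434V444UV4D3E44C3FE443cS4D33T4D3Fe443F44C35T4D343343634'',
    ''E3464D34f4C364344ed4d45U4T4eC443FD343E4443dd4D3e34D3eD343TF3D3UE3E3dU4C3d34C3dE3'',
    ''E35C3C3Ec4C3543445e4D3CE3E3eF3C33f4C3df4T43d4D3de4543V464FD343TT443Vf443cT4E3e54'',
    ''544D343S54644e4C3CV444UE443EF443TC454f54646U4434E3435e4F3fE4C3Vd443433C3343D3ES4'',
    ''446T4F3Sd4D3cU4C34d443F3443Ed4C3C33C3E4443Ef4C3434F3DE443cE44333443VS4D3FT443SS4'',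
    ''434D4C3FV4C35S4E3E33C3cD4443E443D4443TC3C3cS4C3FC3E34T4E3Se4D3CT4E33f443Ee4E34F3'',
    ''D3fT4F355454eE34346454F3343U34F3U54E3T54F3FU4D3FD4C3fe454UD343TE3E33e4C3ed4C3T64'',
    ''43F64C3d4343TF4E3CD3C3CF3F3VC443cf443C43C3VF3D3444T4dV4C34E354Ce4C3UE3E3354D3Cf4'',
    ''44e4454D34435f4E3F54E3CE454UU4436T4E3343F3d6443SD343344C3ec4C3EF443CD443564C3ee4'',
    ''D3TE4E36C443Vd443Df4E3cE3E3cU4D3cE4D3dE3D3EE3435U4C35E3F35e443UC4C3Ue4F3E5443EF3'',
    ''D3Ud4C3EC4E3cF4434T4C334443DE4646E3F34F3434F443cC443SE4D3SF3D3fE343d6444cC4C3D64'',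
    ''43c34F3CC4C3DF4433c4U4fc443dE3D35E4C36S4C3eF4F33U4436C343Dd443cD4D3c5443443C33d4'',
    ''43fe4F3C44C3433E33U4D3fE4434F3C3EU4C3ff4D3UC354eV4443C443FD4444E3F3TD4E3eF443Ce4'',
    ''E3CC443TS4C3fc443e43C3DD3C3VS4D35F3D3dU4D3eT444Tc4C3d4443c44D3Vf4C3FE3D3Fc46C5e4'',
    ''43F43C3S43433C3D3V34F3FE4C3CU4D34C4D3f34C33e443SC3C3F5444Dd4F3VF4643S4C3SF443T34'',
    ''D3EE443C33C36e4435T4C3d64F3ff4F3eE443cF3435S443FE4C3D43C3TT4433S4C3Ff443S64E35e4'',
    ''43d34E3CU4E3eD4T4TE443e54D3Sd464644F3ee4D3fS4C34U4C3D3444Sd4E3EE343dU4C3544435V4'',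
    ''43354D3Tc464C64C3V6443d43E3Te4F3SD4E33C4433T4C34D4C3CE4E3CF3D3TC4434D3C3EF343E54'',
    ''434f4U4cC443Tf443eC443df4D3UF3F3EF4D36D4E34E4C3Ud4F3Sc4435E4E3644D36f4E3Tf443c43'',
    ''43dF4E3c6443fD3436D443TV4C3CT4E3SD3C3dE454Uf4C3De4T43C3D3cD443cC3F3UD4C3Tf444T34'',
    ''E3E34F36c4C3e44T4dd4C3eD3T4eT4C3fD3C34D3D3eC3544e444SC4F3ce4D3eS4C3eU4D3Ef4C3454'',
    ''U4643F3UF343343434E4C3f4443TD443Sf4C3Dc4F3FD3435c4D3VT4E3ee4C365443dV4434C3E3Dc4'',
    ''D36F343Fd4C3dd464SF443DD4D3eV4C3fS4C35C3E3V64E35U4D3Sc4E3TF3C3ES4C3SV464e34C3dV4'',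
    ''E3dE4E36V4F3CC3436E3D3E34E3Ue443f34D3TD454UE4F3eF443F54E3SE443cV4F3CU443Uf444VC4'',
    ''C35D343ED3E3eD3C35C443CD343543D3T64E3FC443ec4E3D3443Sc4C3VT4D3cf443D33D35E344UT4'',
    ''E3eT4F34C343eV4F33F4C3f64C3Vc443CU443ES4435D46CcD34366443e34C3CD4C353454DE443VF4'',
    ''F3dU4D33F343FE343eE343d44436C4E3Fd443e44E3TE443ED454cd443DU4C3UD343De4C3VE3E3c34'',
    ''C3cC3C35E4C3dT4C3UC3D3SD343VC3D3C54T4Sc4C35U4T4FT4434e4C3Uf4D3VE343ff4E36f4D3f43'',
    ''C3d54D3FE3435d4F3VS443ee4F34S443UF3D3EC3C3Vf4E3Vd443TD3435E3C3E3443DF4E3F4343dc4'',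
    ''64eT4F3TS4C3EE343dD4E3FD4D3C33C36c444dS4E35d443SE343U6443C4443Vc4D3c34C3US443cc4'',
    ''43Ue454E4464U43C3444F3fd4C3V3443F33C36D4E3VV443Cf443E33C3cT4D3E54E34C3D3C43434U4'',
    ''43VE444cf4C3CD3F3EE4D3SS4T4V6443UC3C36T4C3VC4D3554D354343D43'',
    ''E33D4F3SD3F3SF3'']"
  by code_simp

lemma trace_certificate_O4:
  "certified_rows (trace_check O4) (vectors gf4s gf4s gf4s gf4s [I4] @
     vectors gf4s gf4s gf4s [I4] [O4] @
     vectors gf4s gf4s [I4] [O4] [O4] @
     vectors gf4s [I4] [O4] [O4] [O4] @
     vectors [I4] [O4] [O4] [O4] [O4])
   [''D33D434334cDSV4SDce4C3CC3C3C34C3Cc5C3CS6DCSE3F3SF6D3SF434S56DCcF3E3cE534c65D3cE4'',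
    ''C3CC4C3C33C3Cc6C3CS5E33D6C4334C4365C4356c4S44ECCF5U4ST3TDS33S4c44FCCE6SD3F6f4cd3'',
    ''6ESe3D4CT564Cf6E3SF3643e5E4Sf4T4cF6UCC36F4c6564cd4TCS43SCCf4C3CC5C3C36C3Cc3C3CS4'',
    ''DESV6D4Cd6F3cE354CU5543V6F4cU4fCC35d4SE5C3CC6C3C35C3Cc4C3CS3E4S5654ST4VCST5TC3C3'',
    ''43C344334343c5643S65E3Cd5D3CD3SD3C4cD3C4F4CU3EEcS4D3SE3SC356E4Cf3VECT4SCcD5D3cF3'',
    ''C4CD354Sc4C4CF5C4CE643CD4433C343cF643SE5543e6F3cV564CU6T4cE3643V5E3Se6d4SF354Cf5'',
    ''EDcC4VDSV5F3SU45C353D4Cc6CDSC64C3F4c4CC643CU4433V343cS643ST5S43E56CcE4F4CC4V43D6'',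
    ''EDc36eDce66C363E3cf4D4CS5CDcC5S4CC54C3E4c43F65CSF4T4ce5E4CC443Cf4433e343cd643Sc5'',
    ''D33F6dCSV5E4c54E33V5V4CV6D3CE634cT554C35VC3U5343U4D3SD6D4CV534CV3c4cV554c53D3cC6'',
    ''3C3d3T4cd3F3C55f43C56CcV44C3C5S4cU33DcU6F43d4CDCF3E3cS6D4Cf6C4ST3C4SS4C4SV5C4SU6'',
    ''5CC66cCST6U4CE5F43U6DCcF5DD3654C3F53DcT3c4CU5F3364d4Sc6D4C63E4cC5E3CU3V43C5f4Cc5'',
    ''T4cD56CS46SD3E364SE3E3ST464cF4U4Se5c43T5643C5S4CT35CcE5D4CF4TCCV54Dcf464CD6eC3c3'',
    ''D33E5TCce6F33e6F4S64e4Ce5D3CF564C3634Sd634Ce3S4Se6D3SC564S63eC3f6343f4D4Ce6D3cD5'',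
    ''3C3T3d4ST3U43C6E3C665CSe44C3C63DSf5c4Sf3C4cd3C4cc4C4cf5C4ce6E43T4CDCE3D4CU5F3Sc5'',
    ''d4SD65Cc4554cF3cD3F3E3c4354SE4S43d6f4cV6dCCe64DSU4VC3S354CD5543C6c4Cd3D4CE46CSF6'',
    ''6CC55SCcd5E43f5f4CF6DCSE6DD3563DSd34C3E6F4SC6F3Cf3U4CS6e43C6S4Cf6E3354D4C53T4cS5'',
    ''D334434CC4V4355e4366343D3D3C34C4CE5C4CF6f4SF4E3SV3D3S6434cE6U4cE4F3ce334SF5D3c54'',
    ''E3CS44C344FCC44ECC4444CC4D4343e4Sc4V4cS444SF5CCcV6c4CC5F4Se344cE6CCSe5E4cV3S4CC6'',
    ''F4ST53DCF654cE6443T6U4SU454SF5CC3F6E3cU5V4Cd6E4c34S4SD6F33d5543D3VCC53T43D544cU3'',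
    ''E4cd63DCE5443d564SF5f4cf464cE6F3Sf6CC3E5643D3eCC6344Sf3d43D6e4CT5F4S34E33T6c4cD5'',
    ''D43C4443C4d43C4T43C4433D343CC443SF543cE6DFcS4E3c64S4C535D3c4DESc4F3S546D3S4c4C63'',
    ''44C44D3C4364C4454C44'',
    ''43C44'']"
  by code_simp

lemma trace_certificate_I4:
  "certified_rows (trace_check I4) (vectors gf4s gf4s gf4s gf4s [I4] @
     vectors gf4s gf4s gf4s [I4] [O4] @
     vectors gf4s gf4s [I4] [O4] [O4] @
     vectors gf4s [I4] [O4] [O4] [O4] @
     vectors [I4] [O4] [O4] [O4] [O4])
   [''433C443CD343SE643cF5D3CD4D43D33CcE43CSF444cE5S4CE4FDcC6D3SE444SF6V4ST4D3cF4EDSC5'',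
    ''C43C4343C4C43E6C43F54334443C3343S6643c55V4C6544c56E3cf534SE6e4C5644S6534cF5F3SU6'',
    ''E43S5U43S544Cc5e43S5F3cV354CT6443d6V4cE3433e443Cf343Sc643cd554cV4E3Cd444Sf4fCCF3'',
    ''F43c6f43c6V43c644CS6E3Se364Cd5e4SF3443T564Se4F3CT4UCCE344cU4433V443CU343ST643cS5'',
    ''C3343C33D4C33T5C33d6D3CC3443C364cU354Sf3c4C3644cF6E3SF6D3SF3S4C3544SE5D3cE3F3cE5'',
    ''34C33U4CU6F3CC6E3CC5C3344C33D3C33T6C33d544c65d43c534c55VDC4344S56T43S6eDC4334S66'',
    ''D43S6VCcS54CCF344Cd6E3cE4V4cC5ECSV5443c5C3345C33D6C33T3C33d4UDcU3U4ce6VCSS344Se3'',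
    ''D43c5eCSc644CT54CCE3F3SF4e4SC6443S6FCce6TDCT5S4S4544cV3eCcc3C3346C33D5C33T4C33d3'',
    ''F4c53D33E644CE5S4Cd3D3CF63C3d4443F6E4CD5e4cc34Ecd544cC3D3SC6fCc54E3c46D3cD6D43f5'',
    ''UCSS654C665EcS634Sc6E3355f434434cd54436554c44F3cd6C4Se644c3434Cf3F4cV6E4CS344S43'',
    ''44Ce3DCc56F3Sc3E3S34443f4T43f3F4cc4FCcV344cc564CF5UDcC6SDSE644Sd6d43F44DS46643E6'',
    ''E4Ce644CU4TCSE64CCE6FCCE3443V3S4Sc3e4SE4CDc5544cS6E3C63F4cD5TDcC544ST5dDcd3F33e4'',
    ''E4S63D33F5c4CT344CF6D3CE53C3T4F4CD6443E5UCS64F3S45D43U6D3SD5V4SS3DECU4D3cC544SC3'',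
    ''fCcc564C5534cS5UECE4F3366U43444435634ST634CU3E4Se544c43F4Cc364S44E3ST544S34C4cV5'',
    ''F4CV544Cf44CCF5dCcF5ECCF3443e3V4cF4c4cS3VDST544cd6E33V4TDST3CDS6644Sc5E4SD6F3C53'',
    ''44CV3DCS65F3c34E3cS3443U4d43U3ECSe3E4SS444cT5T43E4543F54Dc4544SS654CE6cDcF5fDSC5'',
    ''43CC3433D443cE543SF6C3CD3C3C44C3Cd5C3CT6V4c66T4c66S4c66D3S54e4S55d4S55D3c64c4S55'',
    ''C3CD4C3C43C3Cd6C3CT543C434333443c6543S56CCcV5e43d3T4cF5F3c63CCSe6V43T3E3S53U43V6'',
    ''F3S56D4CT664cC5U4Sf664SD6F4Cf3e4CF4CC3F543Ce3433f443cc543Sd6C3CD5C3C46C3Cd3C3CT4'',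
    ''E3c65D4Cd5f4cU554SC654cD5E4CU3CC3E6U4CF6C3CD6C3C45C3Cd4C3CT343CV3433U443cT543SS6'',
    ''343C354C53f4ST6U4cd5D4C3434CD4F33d3E33T354c35FC3f434SE5TCCS464S36EC3U4dCCc434cF6'',
    ''D3C33C43C3C43F6C43E5'',
    ''D3343'']"
  by code_simp

text \<open>The constant \<psi> = 1 is left out for the targets \<open>W4\<close> and
  \<open>X4\<close>. Scaled to target 1 they correspond to \<psi> = \<open>X4\<close> and \<psi> =
  \<open>W4\<close>, which give sets of LP type.\<close>

lemma trace_certificate_W4:
  "certified_rows (trace_check W4) (vectors gf4s gf4s gf4s gf4s [I4] @
     vectors gf4s gf4s gf4s [I4] [O4] @
     vectors gf4s gf4s [I4] [O4] [O4] @
     vectors gf4s [I4] [O4] [O4] [O4])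
   [''64ce6E4C36D33F4S4cT4F3C546CSF564Sf5D3CE4D3SD4D4cT3E3ST364Cc4T4SS3D3cC4DCCf5d4CF5'',
    ''eCSe354cT5FCSD4E3CU4f4cF4eCCe554SS6c4CV454CV3F3c336CC566DcT3C43V5C43U6C43T3543U4'',
    ''6Ccd3343S4F3S46CDSf6E3cS5DDSV35CcS4VCCS6f4Sf4D4c45DDCV334SU6S4CU4T4S3534cV5E4CE3'',
    ''SDcF5FDcf3c4cU4FCC644Dc554DcF6E4CV5V4Sf33CSF5D4cD63C3D5U4cf6e4cC6E33V6T4SC6F3365'',
    ''e4Sd4EEc45D33E3E33536CCC6d4Ce5E4SE4D3CF3D3SC3F3Sc4V43S3U4Sd5D4cc4D3cD3dC3f6ECCF4'',
    ''T4S446ESE6c4Cc6FCCT3F33e3e4356DCSc6d4CU6C4Cf5C4Ce6E3c44C4Cc4D4cS34CSC6DC3e6E4SV6'',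
    ''34Cc36C3e4T4Sd5U4c45F43f5343d4d4CE35CCU3E4S35S4Cc534ce55DSf4D4cC6E3C654CSF6F3Cf6'',
    ''cC363E4Sd3F3cd5543f4E3S36643S33DSF5U43T564cV6F43E454Sd63CC35D4c3554cc564SU5e4cF3'',
    ''d4CT5eCSf4D33D6D4c65E3CC33DCV54ECT6D3CC6D3SF6S4c53DDCT5V43T4C3ce3C3cU4C3cE5C3c56'',
    ''FCc46643F3F4CE5D4cF6C4S65C4S56C4S4364CE4C3ce4C3cU3C3cE6C3c5564cC6E3SF4V4c65F3SF3'',
    ''UCcC4V4CE354S5634S36C3ce5C3cU6C3cE3C3c54T4SE534354E33D55433434C63UCCE44CSF3ECCd5'',
    ''C3ce6C3cU5C3cE4C3c53F4CS6fCSd35DCd4cDS64c4c65F3CC53C3d5T4S56S4363e4cD55CSe5E4334'',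
    ''43cS443ST343CU6433V5f43D5EDC35D4cE6D3CD5D3SE554cE5d4C354D354S4cC6D3cF554SF6F3cV4'',
    ''C4cF5C4cE6F3CT3C4cC443cd443Sc343Cf6433e5c4CD36Cc33dC3f4U43e3V4c434CSC4eDCV6ECC56'',
    ''cCSd4E4cV434cC5E3Se564c465CST5D4ce434SD643c5443S6343C3643345f4c45343F44CSF464C64'',
    ''FCcV5DE364F4cf3U4C53F3SU5UCCd6D4cU3eCCc3E4cE6S43D6E3Cd6d4Cc443cF443SE343CD6433C5'',
    ''F33V5cC3C5D3364d4cC6T4CU4U4cc5e4c44D3C54D3S4454cF4c4cd5cCcf3C4Ce5D3c34E3cC5C4Cd4'',
    ''TC3T6643E56Cce3e4Ce6E4354c4Se5DCSS6E33F6V4SU64CS4664SC3CCcV464cD4F3ST6DC3U65CCf3'',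
    ''E3SD334Cc4SEcc5E43T3343d3T4C56F3cS3V43f43CSE53CcF5F4c5434ce6e43C5D4SD634Sf5S4cf6'',
    ''c43f5CCC64V4cD5SCSU4VCS64S4Sd6T4CE5F4cV5UCc66E3CE4E43C5F3CU4FCCC6D4S45UC336f4cD3'',
    ''F3CF6VDC64TCc65E4cC6fDCc5SDCF3SC335F4C53D4Sc44CS45V4SS4d4cT5FCCe5U4c56E3Sc6S43S3'',
    ''5CCS3S4CU3CCCD6D3C63'']"
  by code_simp

lemma trace_certificate_X4:
  "certified_rows (trace_check X4) (vectors gf4s gf4s gf4s gf4s [I4] @
     vectors gf4s gf4s gf4s [I4] [O4] @
     vectors gf4s gf4s [I4] [O4] [O4] @
     vectors gf4s [I4] [O4] [O4] [O4])
   [''54SV5F4C35V4cV6D33E4E3C645CcE6D3CF454cU6d4cc3D3SC4T4CE6DCCU6D3cD4D4Sd354CS4F3cd3'',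
    ''VCcV364Sd6F3Cf4ECcD4U4SE4VCCV6S4Ce464cc5C43e6C43f5643f4C43d364Ce3E3S335DSd35CC65'',
    ''UD3d4EDSU3ECC54S4Sf44DS664DSE5e4cU3F4Ce6U4354F33e5E3356T4Ce43CcE6D4SD5f4SU53C3D6'',
    ''5CST3343c4CDcU5E3c45F3Sc6DDce3TCSf66CSc4T4CU3S4cd4F4CF334Se6U4cU4D4S4634cf5DDCe3'',
    ''V4cT4FFS46F3363D33F35CCC5T4CV6D3CE3F4cF4D4SS4D3SD3FCCE4TC3U5D3cC3E3cS4f4cT6e43c3'',
    ''d4c445FcF5ECCd3S4CS5E33V3V4365T4Cf5DCcS5D4Sc34CcC5E43c3DC3V5C4CU6C4CV5C4CS4F3S44'',
    ''SC353F4cT354Cd4E3ST6F3c35543c3S4ST53DcE6D4S3664SS6V4SE354cf654Se5E43F43CC3664cT5'',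
    ''34CS35C3V4f4S46d4cT6E43U6343T46CCf3T4CF3D4SC5F3C56E3CU54CcE5F4c36c4CS66DcU434SV6'',
    ''43Sc443cd3433e643Cf5U43D6FDC36D3CD6D4SF5c4SC5D3SE6E3Se464cE5D3cF664SF64D364T4C36'',
    ''C4SE6C4SF5C4SC4E3Cd343ST443cS3433V643CU5e4S434CcC4FCC65VDCe5S4CD35CS33f43V3TC3U4'',
    ''ECSe63EcE6f4C63E4SU3E3cf6fCCT5VCCS3D4Sf343SE443cF3433C643CD5F4SF5c43D5T4CS4F3CT5'',
    ''SCcT4F4Se4F3cV634SC654S456Ccd634cD5D4SV4U4S46343E454C544CcE443S6443c534334643C35'',
    ''T4Cd6VCcU4D4S56D33D5F3CC33DCe6D3CC5CEcd3C3SV3C3Sf4C3S65C3SF6D3cE5c4S63e43d4DDCd6'',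
    ''ECS45543E3D4SE5E4CF6C4c56C4c6554CF4C4c4354SC5F3cE4E3cE3e4S56C3SV4C3Sf3C3S66C3SF5'',
    ''C3SV5C3Sf6C3S63C3SF4E4Cc5UCcT3SDc546DCT4c4353V4SD6F43346CcV6S4S56E3CC6d4c653C3T6'',
    ''fCSC4e4CF334c3564c65C3SV6C3Sf5C3S64C3SF334C53fCCF4FCCT64CcE3V4Cf33436464334F33D6'',
    ''E33e6SC3C6T4SC5D3354d4Cf4f4SS6D3C64V4S44C4CV6D3S34C4CT4F3SC6D3c4464SE4SCSU3S4ST6'',
    ''dC3d5543F6V4CV55CSV3F4364S4cV6F33E5DCcc554SD4E3cd56CCU3DC3f5e4cf54Cc45CCSe454cC3'',
    ''S43U6CCC54cCcf4T4Sc3eCc54c4cT5E4Se6d4CF6ECCC5D4c46U4SD3eCC53fCS55F3CF4E3Cf4F43C6'',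
    ''F3cD334CS4F43d3TESF3343T3d4C65e43U4E3Sc3V43C6D4cD5S4CS634cU63CcF63CSE634SV5E4S64'',
    ''E3CE5SD3e4F4SC5dCS56UDCS6cDCE3E4C63cC336ECCV6f4S65U4cF4F3cS5D4cS44Cc46T4Sd6e4cc4'',
    ''6CCc3V4S66D3C53CCCD5'']"
  by code_simp

lemma cubic_certificate_4: "cubic_check (V O4 I4 I4 O4 O4)"
  by code_simp

section \<open>Witnesses for q = 5\<close>

lemma pair_certificate_O5:
  "certified_rows (pair_check O5) (vectors gf5_units [O5] [O5] [O5] [O5])
   [''5CDF454dw44343334DE4'']"
  by code_simp

text \<open>The coefficient below the leading one is always \<open>O5\<close>, which Frobenius
  conjugation of b permits. Constants are fixed by that map and are listed separately; only b = 1,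
  the inverse of a, is left out.\<close>

lemma pair_certificate_I5:
  "certified_rows (pair_check I5) (vectors gf5s gf5s gf5s [O5] gf5_units @
     vectors gf5s gf5s [O5] gf5_units [O5] @
     vectors gf5s [O5] gf5_units [O5] [O5] @
     vectors [O5] gf5_units [O5] [O5] [O5] @
     vectors [O5, T5, H5, F5] [O5] [O5] [O5] [O5])
   [''D3uV443de4w4g74E34g4F35D4G3eC3E3sF3433e4S4EC4G3s3443E34433u4d4wF3G3vw47CfU443D54d4D44G3wS4E3De4F3Tw4G3dF343W44C33D4G3fT4437v4'',
    ''43U44G4fD3C4Ev4C3vF334fE4436F4D3W43C3Uf443gS4C3Cc4C3U44G3U44C3s4443Dw4C3dF4D3643C3Tv4D3us4C3WW4C34s4D3tc454gt4C3tE4D3SD4E3c43'',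
    ''G36F4D3SE3C3gS4E3VS4E3dd4C3VG3437C3E3VT4C37S4E33F4F3sD3E3US4D3v4334U6454cg4C3dE3C3TV4D333434g7434D7443eW4D3cw454454G3FG3C3TE4'',
    ''C3D43C3GC3C3cc4G33S4F3SC3E3sE3d4UW454cT4C35V4G3ST454u43D3CG443Gt4C34d4D3gT4C3dS4C3cE343ft4d4We454Sc4C3dv443Fs4G34T4G33F3E3ud4'',
    ''34GE4C35T443Sg4G33g4SCse443g544367443s54E3ds464ds4G3WD4G3F44S4uS4C36v4E3VW443Ct4D3su454GG364Vu454F6443UC443fS4D34W443eV4C3cG4'',
    ''43tE3D3TW4D3DE3E34V4D3TC334334E3Ef443vE3F36u4C3ED3S4wU434354E37e4G34C4D3sG3G3wV4G3ED4646c4D3V6443u34D3tC4C3cF3T4vW4D3TG343dt4'',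
    ''434t4E3sF4434G3C3uV4434f4D3F74D3uS4d4de4E3FD3E3wc4E3V43E36V443SE3546f4E3ew4D3c64437w4D3Te4C34v454FT443FD3D33V4C4U64E3wE454WW4'',
    ''G3EF364ce4E3Tt443VC4D3D64G33C3E3DF4D3dF464es4C3VE3D353464d34D3ee4C3w43E334343uF443SS4D35c4C3ut4C3St4G4de464sg4E3Dc4F3vv443gT4'',
    ''D3u3434gE4D3EE4C33F4C3dW4C46v4C3Ut454cV4C3uT4G3vU4E34w4347g4D3UW4E3GE454Ue4G34E4546T4D3U34C3tE3G3gG434uu4436s4G4dF434U34C3354'',
    ''F3G74C3CE464t64G3eT4545E4435v4c4UG334DV4C3dc4C3CD343vF3G3T34E33444346443gC4C3ft4D3F54F3We4D3d5443uW443WC3D3DS443D44C3V34434d4'',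
    ''54ts4D3VG3436g4E3Cg443U4343WU443Wg4434w4F33V434vv4E3cv4435V4E3Vg4C3Tc443wG3G3eE3C3Gu443Ft4D3CF3433G343gt4E3Fu4C364464ET4G3DV4'',
    ''E3Ds4E3CW443Gw4D3754D35T4D3w5443Gu434fC4F3CF4D3VD443CG343Cu4F3ef4c4v34E3te4D3cE343fC3C4FF4S4GU4C3Ud4F3su4E3fe443S43F3cE4C4gd4'',
    ''43es4D3sF3D3UV434fT4C4CF3D3F43F3Vf443sw4G3uD443eD3D35f454fV4F3tD343Se434WG3D3t43D3Vw4E3V6443Su4E3Fv4E3WE334D44437E3C4wE3C3gt4'',
    ''E3sC443DT4D3gf4D3CV4C4e34E3TF3G34v4543f4436d443cd443VC343CF3C34E343ES4G3d54G33s443gF3E3Gd4C3dG343wT4D35d443fv4D3Ug443EV454dE4'',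
    ''F3wG3C3fU443sV4E3vt4D3sG4C4W54C3744C3fe4C3Fs4E3F4343S54C35C343uU443TD44357443gG3E3TC4F3wg4C4ST434Vc4C3cC3C3TG334fE3C3C43D3sV4'',
    ''43vg4E3VC443U6443F3343Fu454T43F3Dt443uD434G5443Vu4G3Ge4C3Sf4C3cV4C3eC3E3e5434T43C3V54C3TT4G3T4443Uu4C3FV4E3gF343tU4G3444C3f44'',
    ''D3TD334e4343Du443f64G3dD3C3v6454F54D3FG3D3Dt4G3FD3G3tV443Wv443S64E3fE464W54E3D4443d43C3G44C35v4D36T4G3wd434cd4547V443gV4E3gE4'',
    ''C3uD443wc4C34E454DU443ET4G3vC343DC4547s4D3tF3E3fG4E3GC3544F4E3U7443WF434ew4S4CD3D3uf4544t443Td4E3wG434Uw4C3GD4C3wD4F3CC443eC3'',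
    ''C3s74D3vC3D3dc4435g454Tt4E3Fe4G3GT4D34w4F3gd4C3Se443ee4c4Td4F3cW443uf4c4FG443vG4C3cG334743D3sD3E37G443VE3E3Ge4F33g4D35g4435D4'',
    ''C4gU4E33T4C3TS4C34t4D33v4G3sC4543W443cS4545S4435C3437U4F3TU4C3Wu4C33s443WE3435t4G3cC47CED4E3s3443vs4C3fW4F3C33C3d74D3444E3Uw4'',
    ''43uD3C4wT4G3wT4F3GU4G3gW4G3CF4C3cS4C3GW4D3EU4C3vG443fU4E3FF334764C3tf4D3fD443tV4D354443eF354654C4TE464V74C3gs443Tg4D3e44D3We4'',
    ''C36f4E3DC343UG343tc4C3sv443FD4C3Wc4F35t4D3WU443GV4E3Vf4G3tD3C3DU443W343Dgc443g44G4f34C3SG3E3644C3wV4C3Cs4D3fv4C3wS45C3E4E33U4'',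
    ''43t54F3eg4C3uG4D3f43D3sT4C3CG3E3tT4G3Wc4G4VD334G33C3sT4C4CD443Ew443FF443CT4D3eG343FE4D3fd4G3EG3433f4C3gu4C3fE3E3D43w4df443gF4'',
    ''C3TF343Cc4D3WW4F3uF343Ce4D3tG4G4vt464D3354Gt47Cts4D3wG4F3VS443D43F3fU434sF3345f4D37S443E4343TF443te4c4uu4G3FF3E3GG3C3fF454eg4'',
    ''D3sE3G363443Df4C3dF3C3VT4'',
    ''C4574F3ww4D3tv4c4We4D3DD3'',
    ''C3gv4C3D34347U4D3w64C3FC4'',
    ''43474436G4F3GC3C3tV4437E4'',
    ''F36d443Fe4D3Cs4F3sd4'',
    ''5CG744343354Ws45CUv4'']"
  by code_simp

text \<open>Among the constants b = 3, the inverse of a, and b = 4, of LP type, are left out. In the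
  next list, for a = 3, these are b = 2 and b = 3.\<close>

lemma pair_certificate_T5:
  "certified_rows (pair_check T5) (vectors gf5s gf5s gf5s [O5] gf5_units @
     vectors gf5s gf5s [O5] gf5_units [O5] @
     vectors gf5s [O5] gf5_units [O5] [O5] @
     vectors [O5] gf5_units [O5] [O5] [O5] @
     vectors [O5, I5, T5] [O5] [O5] [O5] [O5])
   [''43F3343g5443eG443Ee4E3d34E3F34E3Cw4D3wG4435D3G3S74G3Uf443ds4C3D3434Vd4D3SG4E3CE4F3ds4G37g4G3ds4G3vc4C3cU443vd4G3Tc4434s4C3V34'',
    ''G33G4E3st4D35d4D35W4C37W4D3UE4C3G74E35w4D36D434Vg443f3443W64C3f34C3eE4C3DG3435U443te4C3t64C3tC364tv4C3t3443tE4C3v4343Dv4D3uG4'',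
    ''E3FS464SG343Dd4E3uw4G3gE3435C443wV4F3f7464534G3TU443we454GW4D3Ff4E3W43T4FF4436V454WT443TW4C3F34C3FD4G3WG3F3d54D3Fg464g43E3ve4'',
    ''T4tW443EC3F3FE3S46g443u74E3Ee443V64C3gw4T4U34G3uG3E3tt4G3554435E4C3f74C3d43d4fe4G3dd443uW4C3WD3E3We4D3Eu4G3cW454SC3E3et4436D3'',
    ''D3WT4C3CG443W4443U64C3FG4S4sS464c6443E64D3Wu4G3FV4F3G64E3ec4C3Ws4C3Vg443t64C3gF4D35F4G3Sf443gE4433C3F3T34E3uf4G335454V54C4s54'',
    ''E3gU4D3eE3G4Wu434fF443G43G37F3C34C3346t443WD4G3TG443CD3F3vU443UC3C3dT4E334443eD4D3Ug4C3c34E3Vd4C3E3434fG4C3Uc434v64F3sF3C3UW4'',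
    ''C3uT4D3GF464cD3C3s64D3DF343e44G3343C3Fd4G4ES4C33c4F3SW4E36U4E3FF4T4GD4F3fV4c4tT4D3VG4E3fE464fE343v54S4c54C36W443T44D3W43G3Ve4'',
    ''T4Ce443F43G3v44G4s43E3eg443674E3Vg4G3uv443764F3Wc4G36S4C3Ge4E35C3F3sE4G3Wc464ts4C3u44D3FE354Ws4G4cF4434547CvE4G47s4G3WE3E3VE3'',
    ''C3Fc443C4343WC3547T4C3fD454w54434G443WW4C3Tc443574E3u54G3Tu4E3dv434Sf4E3tW4D33f4G3Vt4G3FT4F333443UT443Wf4G36F3C36G4D3F4343Fu4'',
    ''43T64T46s443G44F3v7443ut4C3S54F3dW4c4s34D3wt443Wc4D3sC4F3WE3F3We4E3G54C3Sg4E3de4D3Cu443Ue443uD3C3eG3G4wS4C35W4C3GF343t7454fc4'',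
    ''54fd4E3vF443sC443GG364Gu4G43E3d466443T3443sS4437f443Wv4C3VF364cG443dd4D3V4343vC3D36C4433v4344W4F3t74D3sf4F3dC3F3d43G36T443tC3'',
    ''43eE3G3WC443cG3E3ss4E34u4D36T4D3D3354gg4D3VD334ts4c45E454434C3vg4C3uv443t43F3Vf4E3GG4D34V4437d443754F3sf4C3tE343wG4D3dD3437w4'',
    ''434V443WS4D3t4443D34D3fg4G3gG4347e4G4CF4G3wF3C3EC3E3V44C4gf4C3et4546D3G3v5454SU443EG443wt4C3eU4D37e4C3tG3C3GD4gD37443cF3E3sG3'',
    ''E3eD443TF4D33E464s6443Gg4G36V4E36G3S4T64C3TD3F3CE3D3ts443Fw4G4vT4C3TS4C3fU4C3sW443vG4G3tS443dE4D3WC3C36T443Ef4D3GG3E3fg4C34f4'',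
    ''E36T4E3e7454Ut4E3cv4T4Tv4G3tf443d7443St443vf4E3gF443de4C3E33G3Gs4C3tc4G3cG3435F4F3G33G3VF3E3V43G3Tt4C3v6443SE4G3sG4C35f4D3wU4'',
    ''D3sw464gt443DS434G44543u4E3754E3d7443tf4G3eT4G3Cs4D37T4544s4D3et4E3dG3647S4G3gV4G35V4D3Et4D3e74C3W64G3w64F36D343V44c4EE343wF4'',
    ''34F64G3dG3C3F54C36S434DC3D3EF4G3SE4C3UD3437v4G37G3E3tC3436C4D3DE443C44C4CS4E3Sv443Uv434Gt4433E343TU4D3VV4C3ET4E3g4434ue4C3Eg4'',
    ''43wu443vv4D3674C3dE4C3Td4G3sD443cW4C3fS443gF454dc4G35w4D3cV4D3Ts4D3v4343dS4435C3D3cU4E3EF3D3gs4C33C3E33F3C3WC434cS4C3ws4C3ED3'',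
    ''E37V4C3u6434FC3F3E4343UE4F3ES4E3uW4C3364C37C4437t454d7434G64C3eD3D3GT4G3Dd47CVv4G3Ee4T4TT4E3uD3F3vS4E3De443GF3D3sU4E33T4F3UC4'',
    ''D3Dc4D3cs4C4v64E3tf4C3dS4D3u54F37f4D37t4C3gD343dD3F3WV443WD343g43E3f6443Vf4S4DE3F3fE3E3wC343SF443Cu4C3tf4D3ct4G3GV4D3U54E3u44'',
    ''C3DC4G36E4C4gu4F3CW4C35D4E3WG3C3FV443u3443sv4G4e7443sF3C3374E3t44D3eu4C3cV4C3W74F34u4C3574D3ef4D3CF3434D3D33D364SC4C3fd4D3V74'',
    ''G3t74D3GG4D3st4C4TG3F33e4D3gG3C3cD343cE443Gv4F35S4C3Gf4E3GG3D3uG343We4C3WD4C3vG3D33d4D3v54C3WG3E3GC343e64C3gU4G4gE3D3343D34G4'',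
    ''543F4D3TE4D3Ce4E3774E36C3C3FG343FF4c4fF443UU443wE4D3ED443Vg454SV4C47S4E3Vc4C3U6443uf4C3ud4T44C443TC3C3uG4C3sU4D3sT4F3gw4545F4'',
    ''G3tV4C3C4443Tt443uD4D3ff4D3TW44347443U346445443w34C4e43347v4C3gd4D3fG354CF4C35C3C3sf4435G3435W443334G333443g64G4SG3C3FS4C3DE3'',
    ''C4d64D354443GV4D3Vc4c4VG4'',
    ''G3Vv4F3tT4C3fe4F3UT443gG3'',
    ''43Sc4G34W443ws443vD4F37E4'',
    ''43DG343du4546c4C3Gu443Ss4'',
    ''43df4D3fS4G3f74E35f4'',
    ''54SD34343354cT4'']"
  by code_simp

lemma pair_certificate_H5:
  "certified_rows (pair_check H5) (vectors gf5s gf5s gf5s [O5] gf5_units @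
     vectors gf5s gf5s [O5] gf5_units [O5] @
     vectors gf5s [O5] gf5_units [O5] [O5] @
     vectors [O5] gf5_units [O5] [O5] [O5] @
     vectors [O5, I5, F5] [O5] [O5] [O5] [O5])
   [''54Gu454S74c4Wv4D3FW443c43F3S64D3CS4C3ss45CdW443654T4Vd4C33U4D3Ed4C3sC343cF4C3Vw4G3fv4434T4F3VE354Dg4C3sD4G3wD3G3G64C35c4C3sf4'',
    ''E3cU4D3Dd443fV4C3Tc464VD3G3Ws454VC343Sv434SG343wU4C3SV4d4uu4C35C4C3vw4437D364S64E3Ev443sG3434g4D3vD4D3CC4D3vW443g54G3GU443cu4'',
    ''54G33D3uW4C3DV434uE343574D3fs4F34u4E3cf4G3CV4C3uE3D3Ug4C3vD4E36C4T4Cv4G3654F3DD4434D3C3Cd4D3cE3437g454cE3c4Ut4C3GV4D3vC4E3eF3'',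
    ''54EC4E3U64S4cf443D43C33V443dw4C47D4435g443W44C3Sf4D3cT4E3Ud4D36v443CU4E35E4G3Uc443v34D3wC443wE334tF343e4334Eu4C3UG3C3de4G3WG4'',
    ''43E44G3v54C3Wv434cE4D3cd4E3eF454gD434Se443su4D36E4E3C4443cC4F3fU434Fv4C3ED3D3uE4E3fS434eV4G3EG3C3T54C35E3E3Gw4546c434c64G3gc4'',
    ''54Vv443uT4E3GE3437u4w4uv443S34E3G44C3e74G3eD4D3Se4D3Wd443G7434wF443gG3D3wE3gD6G443c64E3VV434VF343t3443GD3G3uD4C3fe443VW443Ew4'',
    ''C3t4464tU4E3De443uw4C4WD4G34C334tt454vg4G3364D3GC343st4E3344E3EG3C37d454uC4435t4433V4437F343U54C3tW454C43D36T434gV4D3Td4E3Sf4'',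
    ''E3d43G3tU464dE3E3Tc443w34D3VE4G3UT443wE4D3tW443WC3C3v6443eU4D34c4C3DC443tC443dC3C3sD3437v4E3ce4435F4C3Gv443sV443UD4C3D34C3TS4'',
    ''43Cw4G3F4354gv4D3C64D3TV4G33W464tw43473443De4C3us4C3SD3C3WF443fE464Ve4E3gS4G3v64G3wF443vG4D3T74C4Gt4E3G3443eE4D3G3343eg434cg4'',
    ''D3ED354sg4E3Cf4434s4C33t4F3wC4344t4C3ce443gE3D3fg4F3T54C3Ew4G3Dt4E3cu443Wv443GF4G3T44C3uG364uD343664D3Dc4C3Fg4C3uT4F3eU443W74'',
    ''D35S4D3Gv443F3343SC4D3te4C3sE4G3DC343fG343Vd443674436T434GW4E3CV443ED3D3d4443sc4F3Ce443gU4E3Gc4F36e4F3UE3G3tW4C3sE334Ws443TD3'',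
    ''43gC4C3GG443eF4E3UV4D3GV4D3Sg4D3vv4C3sc4C3TG334EU4D3W43F3tC3G3De4F3sc443Tf4E3DD4D3sc4647D443ds443tG4F3CD454SU4437C4347E443GT4'',
    ''43DG443e74D3dw443FD3C3GE3E3d74D36C3D3wF3D3VT4C35W4D3Sf4C3Gc454uw4E3Ct4F3574E36e443d34437D4D3WC3G3We454gG3D3FE4C3fU443wS4C3EW4'',
    ''C3gd4434C3G4fE364eS443U64C3Eg4C3DW4C3sS4G4et4C3vf4G3vD4437T4C3Ed4D3VU4D37V4C4df443f34D3vU443FE454Cg4C3D7443634D3t54G3CS4C3u64'',
    ''E3VD3D3W34C3GC4C36C3D3SD3C3uF343Ug443Gf443W43C3tC443sf4C36G364S74C3CW454GE3436t4E3DW4C3ev4F3ud4E3443E3S34437e4C34T434UE4G3Ew4'',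
    ''F37c4435C3D3CG3434F4T4uD3G3764D34V4G3cw4C3GE4C3sG3E3dc4E3VC3G3GT4C3V64433F4G35U443T5434e74F3VC4C3t54S4V744376434td4F3Ds4G3gE3'',
    ''43sC3D3CD3437w4G3fS4D3ut4G3sD4436v4C3u34D37S4E35W4C4Fv4C3T3443f54C4GE354EG3C3Fu434et4G3WW4E3vc4D3fE4E3VD4G3gG434wc4S4eD364u34'',
    ''T4sd4C3w44E3uW443vu4D3wt443gC3C3Tg4d4V74C3Ug4G35D4C3344D3Cu4D36u4C3Sg4C3tS4E33T4C3sW4D3Vg4E3tE4C47v443U4443vU4E3ts4C3dU4C3E74'',
    ''F3Tv443FT443wF343cE4E3UG4G3FE354uG364f6434Ge464VC4D3vG443CE4C344443EF354sV4C3T64D3E6443uc4C3cE343T6434T43G3f6464Cs4S4Fd4C3f43'',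
    ''D3Wv4434E464WS443vG3C3tE3G3734D37u4F3w5443CC3D35d443fe4D3g43D3GD3437W4D3fE343D64C36f4C3fd4C3Dc4E3vE364ud4347D3D35V443EC4C3GS4'',
    ''43G43C3df4C4wG4C3Ff4F3EU4D34F3G3EW4T4Us4c4Ft443Tc4D3FE3G43D3E34u434dg443fE3D3GE3w4Fd4F3EV4C34c4E3uU4C3v74T4TE364CE4C3EG3E35T4'',
    ''54U54F34E3F3EF3C3cG4G3uw443CD3E3CC4F3GG3D3FU443tG3C3ed4D3wc4T4ev4D36s4C3gT4D33D3S4uS464Td4E3Tt4E36w4D3Vd443DD443DV4D3wd443v74'',
    ''D3Ts443sU4C4543D3gu443FF4435E4c4fc4E3SU4G3C44D3Uu4S43u454EF4C34G3D3V64D3wU443s74D3dG3G3T4343Ts4G35W464DS4C4D44C33C4C3uD4433W4'',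
    ''F3DG3433w4F3WE4C4Fe443dF4E37V4E3SE4G4f74D3UD3C35w4C3Et443tg4F3dS4C36F443vt4C3EF4C3wC3G3sG3C3w74D3dc4D3WE3c4Fe443gv443TE454CD4'',
    ''C3g43D33W4F36c443Dc434374'',
    ''43644C3D64433t4434S4C3F44'',
    ''C3cD3433U4D34W4F3SW4D3g74'',
    ''C3Vv4G3uE4D3eE4D3gU454Ug4'',
    ''D3Ec4G3WG3C3464F3wG4'',
    ''43433546W454tt4'']"
  by code_simp

text \<open>Here b = 2, of LP type, is left out. The inverse b = 4 does occur: a = -1 gives a ^ 5 =
  -1, so the criterion for pseudoregulus type does not apply.\<close>

lemma pair_certificate_F5:
  "certified_rows (pair_check F5) (vectors gf5s gf5s gf5s [O5] gf5_units @
     vectors gf5s gf5s [O5] gf5_units [O5] @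
     vectors gf5s [O5] gf5_units [O5] [O5] @
     vectors [O5] gf5_units [O5] [O5] [O5] @
     vectors [O5, I5, H5, F5] [O5] [O5] [O5] [O5])
   [''43Cu4G4U74D36F4547F3E3Ft4D3SV4C3gT4G3wV4G3Ee4E3G74C3Es434tD3C3Sg443tG3C3cS4F3ws454UT443FD3435F443ct4D3wt4C3G64C3gf4G3ES4G3W34'',
    ''C4ue4D36c4C3Gc4E3UE4643W4C3TS443SW4D3V3454ts4D36V4C3sV454U44C3d64C3cg4C3t74C3D64T4VD3C34F4E3Sd4F3d3464uF4C3v34546v443Eg4C37t4'',
    ''34C4354sG4C3d54T4vC3D3cS443dF4F3ff4C3s5443T6464wW443EG3G3TF454FE4C37f443W44435t434W7454tS443g54c4vD4D3Ud4C3GD4C3vE343gC4435s4'',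
    ''E3gt443SC3F335443vC4E3sG334Fs443ce4E3wD3435u4T4cV4C3Ev4C3Wd4G33G443Wv44376443fD3C37G3C3Uu443vG454EV4G3Tg4C3gG3D3dv4D3Gd4E36c4'',
    ''D3SS464CF4C33W4C3wS434654S4SG4D3tu4E3sG4434c4434u443Es4C3eC4C3fg4G3gU4C3sT4C3cw4C4tw4E3Eu4C3tG4D3fF4C4Ew4E33t4D3dF4D3SE4F3fC3'',
    ''D3ST4D3gC3D3G6464F34D3eU443cD4G3Cu4G3vd434g7443d64F3u645CCC443G34F3fF4c4u64C3sg4C3Eg4D34W4C3ge4E37F443CE334SV454Ef4G3wT4C3CC4'',
    ''F3Ut443FE3C3774C3Vd4S4tu454EG443643G3DS4D34C454Fw4E3FT443WC3C3fG343Cg4E3eS4G3cE4G3c4343uC4G3dD443cG4C4vv443VE4E3S44C3vc47CvF3'',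
    ''D3sD4C3eF4C37D364eC4E3cD4D3644D3CT4E3Du443de4E3fD3C3uc443Te4C3cD4E3344D3GD454743D3D74D3we4C3Sf4C3uT4E3wu4437G3d4gW454EC3G3tU4'',
    ''34GV4C4E74G3wd4G36g434Ec4D3SC4C3ws4E3cs4C3WF343tv4E3sW443fT443g34E37t4T4GF4C3u43C3Cc443UD343uG443Sd4C3U54S4DU4E3gw4C3dD3435g4'',
    ''5437443sE343cC4C3se4E3GF454544C45S4F3wt434F33E3d74E3SV4C35D4C3gc4C4TF3G3cu443ec4E35w443eF3C3G43D3tU47CFF343e34C33D3C3C54F37f4'',
    ''F3EU464cw443ev4D3CW443FC443U44435w443U34T43C4F3c34C3fC343gg4C3V4464SU4436C3E3w43F3SW443uu4G3F644355443Gv4G36G3F3543F3FD3C3Te4'',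
    ''E3fE4D3st443gG4E3tg4C3ED3C3fU443VD3C3EG3545v4D3Vt4433E443gv4D3u7464Ff4G3tG334Wv443Dt4D3WC3E3UU4C3dv4D3w74G3F4443TE3F3vT4D3GF3'',
    ''43G64C3UC3D3TT4C37E354D43347U4E3EE443t54G4St443S74F3F64D3FF4C3ds4436e4C3TG3S4C34547D4C3eW443GG4D3Ww4C3uu4C4Ed443w43D3Fg4345G3'',
    ''D3dV443cC3C3Uw4C3FW4D3Gc4F37v4G3fV4E3vf4434s443Sw443u4443wC3G3DE4433f4F3Fv464UE343VU4G3UF4G3gD343GD4D36D343sv4D34C343DC3E3DG3'',
    ''64sD4F35C443wD4D3cE4S4u44D3UF454ES4FC474G3dF4C3D3443SG4C3cC443VF443ST443Fu443D74C47s454cT4C3wC3T46g4D3eD3E3gE3D3cF4d4E34C3EE4'',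
    ''E3W64T4E64E3g74E3gV4E3sF4G3sD443w74G33F443Eu4E3WG3D33F3G3v3443tc4G3EE4d4wW4G4wf4C3DS4434D443VT4C37W4G3Dt4F3643S4DE35CcF3434C4'',
    ''G3GT4C3WE3D3W43D3DF4C3Vs443543D3Gw4F3sT443sV454uT443We454UE4E33T443EE3D3WF4E3wF3E3Gu443CV443uW4D3WG3433G443434E33U4E3uW4C3fF4'',
    ''E37S4F3gs4G3fg4C3fD3S4G44D3W44E3se443gD443Ds4C3EU4G33u4C3te4d46F3D3DC454T34G3Fe4436E3C3374E34E3D3Tc434ST4C3V34C3Gu4F3DT4T4Dc4'',
    ''G3WG354GD354cC4G35W443S44c4Dg464fF343Ec443674434W4D3UC4E3vV4435C3C3E54D3EW4C3Ts4F33G4C3fe4437S4E3WD4S46S4D3SF443gG3435d4G3EC4'',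
    ''G3G7434ud4C33E3C36T4D36v443CT4G4sW4G3Ef46456454du4C35G3436S4G3cv454tE4C3ff4G3uD4S4544F3cD3E3V44G3uD3D3eg4G3UV4D3g44C4WE343US4'',
    ''C3Ew4C3G4443Sf443S64646w4c457454uS4D3TC4G3se443UC3F3tc443vs443CC3433S4E3ss464sG334t74C46D4C35V4F37F3D3VT443gT4E3dF343uF443sC3'',
    ''G3Ew4D3v74C3ew4F3cE3F3dT4C3t43D3VC454GE4347e4C3WC3G3Cv443UD4C37w4E3DC443F43D3ce4C3wG3T4654E3uE443C43D36F343tT443ET4G37u443VV4'',
    ''F3TF4D3EE4C3ts4G3E34643D443Ff4C36E3F3DW4D34U4G37t4E3ee4C3uG4D3cT4D3sT4C3cF3D3gv4E3uS4434G4543G3D3DD354S64E3Fc443FF443tf4C3Td4'',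
    ''D3Ge4G3G54E3u44D3WE4C4gc443eE4D3gF3D3wE3E3U34C3C33C33D4F3Su4E3fs4C3ct454wF343Gc4c4654UC7F4F3Wc4D3cV4E3CC4D36d443uc4434U4D3E33'',
    ''43WV443FU4D34S4D33u443Tu4'',
    ''43U64C3CT443Tg443C74F3D74'',
    ''C3wV4437v4G3F4354ET4C3sd4'',
    ''F3v43D3GG4F34G343534C3c74'',
    ''F3Ff4E3sU4F34C3433g4'',
    ''34v345Cde454TW443433'']"
  by code_simp

text \<open>For q = 5 the five lists for the five targets all include the constant \<psi> = 1, so no
  exceptional \<psi> arises.\<close>

lemma trace_certificate_O5:
  "certified_rows (trace_check O5) (vectors gf5s gf5s gf5s [O5] [I5] @
     vectors gf5s gf5s [O5] [I5] [O5] @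
     vectors gf5s [O5] [I5] [O5] [O5] @
     vectors [O5] [I5] [O5] [O5] [O5] @
     vectors [I5] [O5] [O5] [O5] [O5])
   [''74CG674ce47433774SV5G3335G3c35E4cE4dC3C344Ct3VCCw364ct3G3C35f4sg6dC3C44CS77343t3sEs53G3s35C43W7WCss4G4cd53D3e6SDSu3G3S356Cc46'',
    ''643t3GCST7d4S35G3c75v4CD5W4ss4TCCw3S43s7G43d5G3C75G3s7554st3vDce3cCSw55CCD574sV5G3S7574cG6743e474S37c4sT4vCCT5G33757CCg444ct3'',
    ''DC3U5d4s35G3C655CcW554Ct374Se474s3774CV5G3s65743G6443t3T4cs6u4sf7C4sW7G3S65G3365G4Sd5s4s34g4CF7UDsc4fCSw7G3c65F4s3634st3wCCf6'',
    ''d4C35G3s55VCSE5w4SU6G4sd564st3CCsS4G3S55F4C36u4Cf7s4C34f43g634Ct3G3355ECSe6TCcG7tD37554ct3W4cs4G3c55G3C5574SG674se474C3774cV5'',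
    ''G3S4534ct3DCCF7VD346d4c35543t3G3345SCCw3C4cW76C3G674c37743V5G3c4574sG674Ce4SEs56FCSv544st3G3C45F4c3664Ct3c43T4E4CE44Ccf7G3s45'',
    ''uDsU5f4St6443F77CCE6F43c7CDse66Csd7c4cf4W4S7764Sd5E4SD6T4S7534CU6TCst7cDsG5G4CV47FsE5u4ce6g4sS754cs4UCs77w4CC44Ccv5S4S74d43E5'',
    ''43CU343SU343cU343sU3433U3'',
    ''43S63'',
    ''43C33'']"
  by code_simp

lemma trace_certificate_I5:
  "certified_rows (trace_check I5) (vectors gf5s gf5s gf5s [O5] [I5] @
     vectors gf5s gf5s [O5] [I5] [O5] @
     vectors gf5s [O5] [I5] [O5] [O5] @
     vectors [O5] [I5] [O5] [O5] [O5] @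
     vectors [I5] [O5] [O5] [O5] [O5])
   [''sCcd3d4SU4E4Se5T4st5F3sc5W4St77DcE5F3Sc5TCSs4f43G7F33c5DC3e6G43S734Cf454SW5WCcF6C4c46sC376F3cc5S4ct4V4Ct6F3Cc5t4s44t4Sg7g4S45'',
    ''F3Cg5C434634cf464c4744SC6ECSS4T4Ct5f4SG7F3sg5WDSg7u4Cs3F3Sg5DCc376CS65W4st7t43s3t4cV6t4C44F4SF4F33g5G4SS7cD3G4F3cg55CC46g4s45'',
    ''cC3w3F3cf5ECsW66C3s5F4sF4f4sG74CST4u4cs3G4sS7F3Cf5t4Ss3C4S46F3sf5t4Cg7T4ct5F3Sf5343f4TCsC364347UCcT6E4Ce5FC374w43s3F33f5g4C45'',
    ''FEs645C3U6F33e5d4cU4u43s3F3ce544CC6S4st454cW5E4ce5F4CF4V4St6sECv4F3Ce5DCst4wCsT5F3se5T43t5w4Ss3EDSF7v4Cs3C4s46W4ct7dDSV6F3Se5'',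
    ''t4Cs3W43t7d43U4F3Sd5G4cS7FCCV3F33d5tCcd36CCW5dC3w4c4cc6cCCd4DE3S7S4Ct4F3cd55CSc6CCCg7F3Cd5E43e5v4cs3F3sd5543W544cC664s4734sf4'',
    ''433W743CW743SW743cW743sW743SU743cU743sU7433U743CU743sS7433S743CS743SS743cS743CV743SV743cV743sV7433V743cT743sT7433T743CT743ST7'',
    ''G4sw5V4S44d4sU75CS64WD3w6'',
    ''44sW6'',
    ''WCsV5'']"
  by code_simp

lemma trace_certificate_T5:
  "certified_rows (trace_check T5) (vectors gf5s gf5s gf5s [O5] [I5] @
     vectors gf5s gf5s [O5] [I5] [O5] @
     vectors gf5s [O5] [I5] [O5] [O5] @
     vectors [O5] [I5] [O5] [O5] [O5] @
     vectors [I5] [O5] [O5] [O5] [O5])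
   [''E33E5T4su4e4cC7e4s55G4SG4E3cE534SS5S4cu64DCU7dECg7E3CE564sD6TCs47u4c54F43T7E3sE5v4CW6SC3W444sg4C4Cf5E3SE57Ccs56C3T4E4C56DCCf4'',
    ''E3CD564CD6e4sV4c43w3C4cf5E3sD5cCS55E4c56FCCU544Cg4E3SD5TEcT4G4sG4S43u67CsW5E33D5w4cF5cDss754s57TC3D4E3cD5V4cu7gCcw7CDcf7tCse7'',
    ''E3SC5e4sw3d4cw3V43u7e4SC7E33C554C57SCC36WDSV5v43W6E3cC5fCsd6T4cu4eCcw534CS5E3CC564cD6eDcG4s4cc7S4Su6E3sC54Cs46W4Cu5SDsD6uCC35'',
    ''E3cG5W4cu5c4sw334cS5e4cV4E3CG5643D63ECV4G4cG4EC3G5E3sG5443g44CcU6DFce4FDcg6E3SG57FCG5F4CT7dC3V7sD3w5E33G5eCsd4DC3u7gDSc754c57'',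
    ''E3sF5S4Cu644Sg4F4cT7c4Cw3E3SF5GC3S46CSg47CSD5C4sf5E33F5wCSG454357VDsF5E4s56E3cF5G43G4343S5dECu63DCU4E3CF564SD6v4sW6T4Su4FC366'',
    ''g4s43w4C43E434334c43S4S4364c43e43v6e4Cc4V4S43e4cG5c4s43GDsv544c43F4343GCcD7743W674Su474sC774Cf574c43U4S4354c43U4S44U4S47G4343'',
    ''d4Cw6443v4fCsT6GCsg3UDC76'',
    ''w43t7'',
    ''64CS6'']"
  by code_simp

lemma trace_certificate_H5:
  "certified_rows (trace_check H5) (vectors gf5s gf5s gf5s [O5] [I5] @
     vectors gf5s gf5s [O5] [I5] [O5] @
     vectors gf5s [O5] [I5] [O5] [O5] @
     vectors [O5] [I5] [O5] [O5] [O5] @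
     vectors [I5] [O5] [O5] [O5] [O5])
   [''s4CS63EcD4d4CD7GCcu7D3st5U43v3D3St5U43v4U43v7U43v5w4Cd7CDs35SCcs4D33t564ST5D3ct554Sc4C4sC4W4Sv3E43U7S4cv36CCd3D3Ct544c67v4S64'',
    ''D3ss5S43v3C4CC4E4SU764sT5VCsg6g4se6D3Ss5DC35354sc4U4Sv3U4Sv6U4Sv4U4Sv7D33s5V4cv3D3cs5c4c65343E6GC3534CSC3f4sW4W4sv3D3Cs5uDCU3'',
    ''44S67D3sw5w43d7DE3C4FCcG55Ccw3g4Ce634SE6D3Sw5DCcS4D33w54CCd3C4cC4F4sg5dC357U4sv3U4sv6D3cw5U4sv764CT57CsV3VCCS554Cc4cC353D3Cw5'',
    ''3CSf73CcE7D3sv53C3S7V4Sv3W4cv3g4ce63CSC33Ccw3D3Sv554cc4D33v53C3g4S4sv3s4SS63CCs544s673Cc65D3cv5u4cG5D3Cv534sE6C43C4U4Cv7F4Cg5'',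
    ''U4cv3U4cv6U4cv4D3su5U4cv5D3Su5V4sv344C67G4S66cCCw434CE6u43G5D33u55CSC3W43v33DsU5tC3s7SC353c4s65D3cu5f43W4D3Cu5uEsD77Dsu3643T5'',
    ''E3cD3G33E3F3SG3D3cF3C3SC3D3CF3g4sw6G3cE3C33C3SC366E3sD3G4Ss5C3cC3F3cG3CCSW7E3SD3C3CC344SS6fCsT3D3SF3C3sC3D33F3v4Sc6E4sT4F3sG3'',
    ''S4S64UCsF3F4Sg7343T6FC354'',
    ''ECSV4'',
    ''sCcg3'']"
  by code_simp

lemma trace_certificate_F5:
  "certified_rows (trace_check F5) (vectors gf5s gf5s gf5s [O5] [I5] @
     vectors gf5s gf5s [O5] [I5] [O5] @
     vectors gf5s [O5] [I5] [O5] [O5] @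
     vectors [O5] [I5] [O5] [O5] [O5] @
     vectors [I5] [O5] [O5] [O5] [O5])
   [''D4S76D4CD4D43V744SU5C3SU5fCSC7DD3T454SF6C33U5c4sE7E4su35CsF4C3cU5S4cw5VCst5C4Su3C3CU5wC3S6ECSw3uCSv4C3sU5cCsw734s77F43u34C3W5'',
    ''C4su3W4sw664Sd4C3CT5d43f6T4Cw7c4CE7C3sT5UCcV3F4Su3D4Cc5C3ST5D4s76D4cD4D4SV7C33T5G4cu3dC3d4f437544sU554sF6s43C5WDS77dC3d5C3cT5'',
    ''34c774CcD5C33S5d4Sf6G43u344CU5C3cS5ECCu7E4cu3TC3v7C3CS5GCcW6g4CS454CF6UC347F4su3V43w464sd47Ccv6C3sS5D43D4D4sV7D4cc5C3SS5D4C76'',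
    ''GD3U3C3sW5d4sf6gC3d3CCSf4C3SW5D4c7664Cd4D4CV7D43c5cCc56TCC64G4Su3w4S74C33W56CCE7T43w7E43u3C3cW534377C4cu344cU5C3CW5V4Sw4eCc55'',
    ''C3cV5E4Su3FCcF7uCcT57DSu5C43u3u4sT6S4Cw534S77C3CV5FDcu3TEsT3443U5C3sV5EECf3D4cV7D4Sc5C3SV5D4376543F6G4su3C33V564cd4VCS36T4Sw7'',
    ''v4cG4WCS44wCcC654cE7W4S64S4S6764sT64CCF3fD3g5f4CD55EC46EC354g4se4T4S66s43d6FCcd4CCsD7UDcd5c43W7343c5cCcF7V4S6544Cw4gFcg5eDs54'',
    ''W4S75d43f454SU6TCs77VDsu7'',
    ''u4Cv7'',
    ''6Css4'']"
  by code_simp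

lemma cubic_certificate_5: "cubic_check (V I5 O5 O5 O5 O5)"
  by code_simp

section \<open>The fields of order at most \<open>5 ^ 5\<close>\<close>

lemmas certified_simps = bex_Un ex_vectors_iff set_gf2s set_gf3s set_gf3_units set_gf4s set_gf4_units set_gf5s set_gf5_units

context quintic_field
begin

lemma quintic_modelI:
  fixes \<phi> :: "'c::quintic_coeff \<Rightarrow> 'a"
  assumes "card (UNIV :: 'c set) = q" "\<phi> 0 = 0" "\<phi> 1 = 1" and m1: "\<phi> minus1 = - 1"
    and add: "\<And>x y. \<phi> (x + y) = \<phi> x + \<phi> y" and mult: "\<And>x y. \<phi> (x * y) = \<phi> x * \<phi> y"
    and Fq: "\<And>x. frob (\<phi> x) = \<phi> x" and nz: "\<And>x. x \<noteq> 0 \<Longrightarrow> \<phi> x \<noteq> 0"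
    and cancel: "\<And>x y :: 'c. x + minus1 * y = 0 \<Longrightarrow> x = y"
    and "frob \<theta> \<noteq> \<theta>" "\<And>u v. ev5 \<phi> \<theta> (vmul u v) = ev5 \<phi> \<theta> u * ev5 \<phi> \<theta> v"
    "\<And>u. ev5 \<phi> \<theta> (vfrob u) = frob (ev5 \<phi> \<theta> u)"
  shows "quintic_model q \<phi> \<theta>"
proof -
  have inj: "x = y" if "\<phi> x = \<phi> y" for x y
  proof -
    have "\<phi> (x + minus1 * y) = 0" using that by (simp add: add mult m1)
    then show ?thesis using nz cancel by blast
  qed
  then have "inj \<phi>" by (simp add: inj_on_def)
  then have "\<exists>x. z = \<phi> x" if "frob z = z" for z
    using embedding_surj[of \<phi> z] assms(1) Fq that by blast
  then show ?thesis
    using assms inj by unfold_locales auto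
qed

end

context quintic_model
begin

lemma ex_pair_check_sound: "\<exists>t w. pair_check a b t w \<Longrightarrow> dependent_pair (\<phi> a) (ev b)"
  by (elim exE) (rule pair_check_sound)

lemma ex_trace_check_sound: "\<exists>z s. trace_check \<tau> \<psi> z s \<Longrightarrow> trace_witness (ev \<psi>) (\<phi> \<tau>)"
  by (elim exE) (rule trace_check_sound)

text \<open>Restates the general classification in coordinates. The parameters \<psi> split into
  non-constant ones, scaled to last non-zero coordinate 1, and constants; scaling a constant to 1
  turns target 1 into its inverse, which explains \<open>trace1\<close>.\<close>

theorem classification_model:
  fixes L :: "('a ^ 2) set set" and y :: "'c v5"
  assumes max: "maximum_scattered q L"
    and root5: "\<And>c. frob c = c \<Longrightarrow> (c ^ m) ^ 5 = c"
    and pairs: "\<And>x v. x \<noteq> 0 \<Longrightarrow> dependent_pair (\<phi> x) (ev v) \<or>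
      \<phi> x * ev v = 1 \<and> \<phi> x ^ 5 \<noteq> - 1 \<or> LP_pair (\<phi> x) (ev v)"
    and pairs0: "\<And>x :: 'c. x \<noteq> 0 \<Longrightarrow> \<exists>t w. pair_check 0 (V x 0 0 0 0) t w"
    and trace: "\<And>a b c d \<tau>. trace_witness (ev (V a b c d 1)) (\<phi> \<tau>)"
      "\<And>a b c \<tau>. trace_witness (ev (V a b c 1 0)) (\<phi> \<tau>)"
      "\<And>a b \<tau>. trace_witness (ev (V a b 1 0 0)) (\<phi> \<tau>)"
      "\<And>a \<tau>. trace_witness (ev (V a 1 0 0 0)) (\<phi> \<tau>)"
    and trace1: "\<And>x. x \<noteq> 0 \<Longrightarrow> trace_witness 1 (1 / \<phi> x) \<or> LP_trace (\<phi> x)"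
    and trace0: "trace_witness 1 0"
    and cubic: "cubic_check y"
  shows "pseudoregulus_type q L \<or> LP_type q L"
proof (rule classification[OF max root5])
  fix a b :: 'a assume a: "frob a = a" "a \<noteq> 0"
  obtain x v where xv: "a = \<phi> x" "b = ev v" using \<phi>_surj[OF a(1)] ev_surj by blast
  have "x \<noteq> 0" using a(2) xv(1) by (auto simp: \<phi>_0)
  then show "dependent_pair a b \<or> a * b = 1 \<and> a ^ 5 \<noteq> - 1 \<or> LP_pair a b"
    using pairs xv by blast
next
  fix b :: 'a assume b: "frob b = b" "b \<noteq> 0"
  obtain x where x: "b = \<phi> x" using \<phi>_surj[OF b(1)] by blast
  then have "x \<noteq> 0" using b(2) by (auto simp: \<phi>_0)
  then have "dependent_pair (\<phi> 0) (ev (V x 0 0 0 0))" by (intro ex_pair_check_sound pairs0)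
  then show "dependent_pair 0 b" by (simp add: \<phi>_0 x)
next
  fix \<psi> :: 'a assume \<psi>: "\<psi> \<noteq> 0"
  have all: "trace_witness \<psi> \<tau> \<or> frob \<psi> = \<psi> \<and> \<not> trace_witness 1 (\<tau> / \<psi>)" if "frob \<tau> = \<tau>" for \<tau>
    by (rule trace_witness_all[OF trace \<psi> that])
  show "trace_witness \<psi> 0" using all[of 0] trace0 by simp
  show "trace_witness \<psi> 1 \<or> LP_trace \<psi>"
  proof (cases "frob \<psi> = \<psi>")
    case True
    then obtain x where x: "\<psi> = \<phi> x" using \<phi>_surj by blast
    then have "x \<noteq> 0" using \<psi> by (auto simp: \<phi>_0)
    then show ?thesis using all[of 1] trace1[of x] x by auto
  qed (use all[of 1] in auto)
next
  show "\<exists>y. y \<noteq> 0 \<and> tr (y * frob y * frob2 y) = 0"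
    by (rule cubic_check_sound[OF cubic])
qed

end

text \<open>The numerals that arise from the tables, the binomial coefficients and the fifth powers
  2 ^ 5, 3 ^ 5, 4 ^ 5 of the LP parameters.\<close>

lemma char5_numerals:
  assumes five: "(5::'a::field) = 0"
  shows "(6::'a) = 1" "(7::'a) = 2" "(8::'a) = 3" "(9::'a) = 4" "(12::'a) = 2" "(16::'a) = 1"
    "(32::'a) = 2" "(243::'a) = 3" "(1024::'a) = 4"
    "(2::'a) \<noteq> 0" "(3::'a) \<noteq> 0" "(4::'a) \<noteq> 0" "(2::'a) \<noteq> 1" "(3::'a) \<noteq> 1" "(4::'a) \<noteq> 1"
    "(1::'a) \<noteq> 4" "(2::'a) \<noteq> 4" "(3::'a) \<noteq> 4"
proof -
  have "(6::'a) = 5 + 1" "(7::'a) = 5 + 2" "(8::'a) = 5 + 3" "(9::'a) = 5 + 4" "(12::'a) = 5 * 2 + 2"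
    "(16::'a) = 5 * 3 + 1" "(32::'a) = 5 * 6 + 2" "(243::'a) = 5 * 48 + 3" "(1024::'a) = 5 * 204 + 4"
    by simp_all
  then show n: "(6::'a) = 1" "(7::'a) = 2" "(8::'a) = 3" "(9::'a) = 4" "(12::'a) = 2" "(16::'a) = 1"
    "(32::'a) = 2" "(243::'a) = 3" "(1024::'a) = 4"
    by (simp_all only: five mult_zero_left add_0_left)
  have "(2::'a) * 3 = 6" "(4::'a) * 4 = 16" by simp_all
  then have "(2::'a) * 3 = 1" "(4::'a) * 4 = 1" by (simp_all only: n)
  then show *: "(2::'a) \<noteq> 0" "(3::'a) \<noteq> 0" "(4::'a) \<noteq> 0" by force+
  have "(2::'a) - 1 = 1" "(3::'a) - 1 = 2" "(4::'a) - 1 = 3" "(4::'a) - 2 = 2" "(4::'a) - 3 = 1" by simp_all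
  then show "(2::'a) \<noteq> 1" "(3::'a) \<noteq> 1" "(4::'a) \<noteq> 1" "(1::'a) \<noteq> 4" "(2::'a) \<noteq> 4" "(3::'a) \<noteq> 4"
    using * by force+
qed

section \<open>Exceptional parameters of LP type\<close>

context quintic_field
begin

text \<open>The coefficients of \<open>?r\<close> are chosen so that, modulo 5, both coordinates
  lose their \<open>frob\<close> and \<open>frob4\<close> terms and keep \<open>frob2\<close> and
  \<open>frob3\<close> in the ratio 1 to \<delta>. Each identity holds over the integers with the
  discarded multiple of 5 written out. The next two lemmas use the same pattern with \<delta> = 4
  and \<delta> = 3.\<close>

lemma LP_pair_2_4:
  assumes five: "(5::'a) = 0"
  shows "LP_pair 2 4"
  unfolding LP_pair_def
proof (intro allI impI, elim conjE)
  fix U :: "('a ^ 2) set" and d1 d2 :: "'a ^ 2"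
  assume "wedge d1 d2 \<noteq> 0" "card U = q ^ 5"
    and U: "\<forall>z. (z + 2 * frob z) *s d1 + (frob2 z + 4 * frob z) *s d2 \<in> U"
  let ?r = "\<lambda>x. x + 3 * frob x + 2 * frob2 x + 2 * frob3 x + frob4 x"
  let ?k = "\<lambda>x. frob2 x + 2 * frob3 x"
  show "LP_type q (linear_set U)"
    using \<open>wedge d1 d2 \<noteq> 0\<close> \<open>card U = q ^ 5\<close>
  proof (rule LP_type_reparametrized[where P = "\<lambda>z. z + 2 * frob z" and Q = "\<lambda>z. frob2 z + 4 * frob z"
        and \<delta> = 2 and \<rho> = ?r and ?m11.0 = 3 and ?m12.0 = 3 and ?m21.0 = 1 and ?m22.0 = 3])
    fix x
    have "?r x + 2 * frob (?r x) = 3 * x + 3 * ?k x + 5 * (frob x + frob2 x + frob4 x)"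
      "frob2 (?r x) + 4 * frob (?r x) = 1 * x + 3 * ?k x + 5 * (x + frob x + 2 * frob2 x + frob3 x + 2 * frob4 x)"
      unfolding frob_add frob_mult frob_numeral frob5 by algebra+
    then show "?r x + 2 * frob (?r x) = 3 * x + 3 * ?k x"
      "frob2 (?r x) + 4 * frob (?r x) = 1 * x + 3 * ?k x"
      by (simp_all only: five mult_zero_left add_0_right)
  qed (use U in \<open>simp_all add: frob_numeral char5_numerals[OF five]\<close>)
qed

lemma LP_pair_3_3:
  assumes five: "(5::'a) = 0"
  shows "LP_pair 3 3"
  unfolding LP_pair_def
proof (intro allI impI, elim conjE)
  fix U :: "('a ^ 2) set" and d1 d2 :: "'a ^ 2"
  assume "wedge d1 d2 \<noteq> 0" "card U = q ^ 5"
    and U: "\<forall>z. (z + 3 * frob z) *s d1 + (frob2 z + 3 * frob z) *s d2 \<in> U"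
  let ?r = "\<lambda>x. x + 2 * frob x + 2 * frob2 x + frob3 x + 2 * frob4 x"
  let ?k = "\<lambda>x. frob2 x + 4 * frob3 x"
  show "LP_type q (linear_set U)"
    using \<open>wedge d1 d2 \<noteq> 0\<close> \<open>card U = q ^ 5\<close>
  proof (rule LP_type_reparametrized[where P = "\<lambda>z. z + 3 * frob z" and Q = "\<lambda>z. frob2 z + 3 * frob z"
        and \<delta> = 4 and \<rho> = ?r and ?m11.0 = 2 and ?m12.0 = 3 and ?m21.0 = 2 and ?m22.0 = 2])
    fix x
    have "?r x + 3 * frob (?r x) = 2 * x + 3 * ?k x + 5 * (x + frob x + frob2 x - frob3 x + frob4 x)"
      "frob2 (?r x) + 3 * frob (?r x) = 2 * x + 2 * ?k x + 5 * (x + frob x + frob2 x + frob4 x)"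
      unfolding frob_add frob_mult frob_numeral frob5 by algebra+
    then show "?r x + 3 * frob (?r x) = 2 * x + 3 * ?k x"
      "frob2 (?r x) + 3 * frob (?r x) = 2 * x + 2 * ?k x"
      by (simp_all only: five mult_zero_left add_0_right)
  qed (use U in \<open>simp_all add: frob_numeral char5_numerals[OF five]\<close>)
qed

lemma LP_pair_4_2:
  assumes five: "(5::'a) = 0"
  shows "LP_pair 4 2"
  unfolding LP_pair_def
proof (intro allI impI, elim conjE)
  fix U :: "('a ^ 2) set" and d1 d2 :: "'a ^ 2"
  assume "wedge d1 d2 \<noteq> 0" "card U = q ^ 5"
    and U: "\<forall>z. (z + 4 * frob z) *s d1 + (frob2 z + 2 * frob z) *s d2 \<in> U"
  let ?r = "\<lambda>x. x + frob x + 4 * frob2 x + 3 * frob3 x + 3 * frob4 x"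
  let ?k = "\<lambda>x. frob2 x + 3 * frob3 x"
  show "LP_type q (linear_set U)"
    using \<open>wedge d1 d2 \<noteq> 0\<close> \<open>card U = q ^ 5\<close>
  proof (rule LP_type_reparametrized[where P = "\<lambda>z. z + 4 * frob z" and Q = "\<lambda>z. frob2 z + 2 * frob z"
        and \<delta> = 3 and \<rho> = ?r and ?m11.0 = 3 and ?m12.0 = 3 and ?m21.0 = 4 and ?m22.0 = 3])
    fix x
    have "?r x + 4 * frob (?r x) = 3 * x + 3 * ?k x + 5 * (2 * x + frob x + frob2 x + 2 * frob3 x + 3 * frob4 x)"
      "frob2 (?r x) + 2 * frob (?r x) = 4 * x + 3 * ?k x + 5 * (x + frob x + 2 * frob4 x)"
      unfolding frob_add frob_mult frob_numeral frob5 by algebra+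
    then show "?r x + 4 * frob (?r x) = 3 * x + 3 * ?k x"
      "frob2 (?r x) + 2 * frob (?r x) = 4 * x + 3 * ?k x"
      by (simp_all only: five mult_zero_left add_0_right)
  qed (use U in \<open>simp_all add: frob_numeral char5_numerals[OF five]\<close>)
qed

lemma LP_trace_char3:
  assumes three: "(3::'a) = 0"
  shows "LP_trace 1"
  unfolding LP_trace_def
proof (intro allI impI, elim conjE)
  fix U :: "('a ^ 2) set" and d1 d2 :: "'a ^ 2"
  assume "wedge d1 d2 \<noteq> 0" "card U = q ^ 5"
    and U: "\<forall>x. x *s d1 + (frob x - 1 * tr x) *s d2 \<in> U"
  have "(4::'a) = 3 + 1" "(32::'a) = 3 * 10 + 2" by simp_all
  then have n: "(4::'a) = 1" "(32::'a) = 2" by (simp_all only: three mult_zero_left add_0_left)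
  have "(2::'a) * 2 = 1" using n(1) by simp
  then have nz: "(2::'a) \<noteq> 0" by force
  have "(2::'a) - 1 = 1" by simp
  then have n1: "(2::'a) \<noteq> 1" by force
  show "LP_type q (linear_set U)"
    using \<open>wedge d1 d2 \<noteq> 0\<close> \<open>card U = q ^ 5\<close>
  proof (rule LP_type_reparametrized[where P = "\<lambda>z. z" and Q = "\<lambda>z. frob z - 1 * tr z" and \<delta> = 2
        and \<rho> = "\<lambda>x. x + 2 * frob2 x + frob3 x" and ?m11.0 = 1 and ?m12.0 = 2 and ?m21.0 = 2 and ?m22.0 = 2])
    fix x
    have "x + 2 * frob2 x + frob3 x = 1 * x + 2 * (frob2 x + 2 * frob3 x) + 3 * (- frob3 x)"
      by algebra
    then show "x + 2 * frob2 x + frob3 x = 1 * x + 2 * (frob2 x + 2 * frob3 x)"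
      by (simp only: three mult_zero_left add_0_right)
    have "frob (x + 2 * frob2 x + frob3 x) - 1 * tr (x + 2 * frob2 x + frob3 x) =
        2 * x + 2 * (frob2 x + 2 * frob3 x) + 3 * (- 2 * x - frob x - 2 * frob2 x - 2 * frob3 x - frob4 x)"
      unfolding tr_def frob_add frob_mult frob_numeral frob5 by algebra
    then show "frob (x + 2 * frob2 x + frob3 x) - 1 * tr (x + 2 * frob2 x + frob3 x) = 2 * x + 2 * (frob2 x + 2 * frob3 x)"
      by (simp only: three mult_zero_left add_0_right)
  qed (use U in \<open>simp_all add: frob_numeral n nz n1\<close>)
qed

text \<open>Stated through the equation of \<psi> because it is applied to both primitive cube roots
  of unity in the field with 4 elements; \<delta> = \<psi> works for either.\<close>

lemma LP_trace_char2:
  assumes two: "(2::'a) = 0" and w: "\<psi> ^ 2 = \<psi> + 1" "frob \<psi> = \<psi>"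
  shows "LP_trace \<psi>"
  unfolding LP_trace_def
proof (intro allI impI, elim conjE)
  fix U :: "('a ^ 2) set" and d1 d2 :: "'a ^ 2"
  assume "wedge d1 d2 \<noteq> 0" "card U = q ^ 5"
    and U: "\<forall>x. x *s d1 + (frob x - \<psi> * tr x) *s d2 \<in> U"
  let ?r = "\<lambda>x. x + (\<psi> + 1) * frob2 x + frob3 x"
  show "LP_type q (linear_set U)"
    using \<open>wedge d1 d2 \<noteq> 0\<close> \<open>card U = q ^ 5\<close>
  proof (rule LP_type_reparametrized[where P = "\<lambda>z. z" and Q = "\<lambda>z. frob z - \<psi> * tr z" and \<delta> = \<psi>
        and \<rho> = ?r and ?m11.0 = 1 and ?m12.0 = "\<psi> + 1" and ?m21.0 = 1 and ?m22.0 = 1])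
    fix x
    have "?r x = 1 * x + (\<psi> + 1) * (frob2 x + \<psi> * frob3 x)
        + 2 * (- (\<psi> * frob3 x))"
      using w(1) by algebra
    then show "?r x = 1 * x + (\<psi> + 1) * (frob2 x + \<psi> * frob3 x)"
      by (simp only: two mult_zero_left add_0_right)
    have "frob (?r x) - \<psi> * tr (?r x) = 1 * x + 1 * (frob2 x + \<psi> * frob3 x)
        + 2 * (- x - frob2 x - 2 * \<psi> * tr x)"
      unfolding tr_def frob_add frob_mult frob_1 frob5 w(2) using w(1) by algebra
    then show "frob (?r x) - \<psi> * tr (?r x) = 1 * x + 1 * (frob2 x + \<psi> * frob3 x)"
      by (simp only: two mult_zero_left add_0_right)
  next
    show "1 * 1 - (\<psi> + 1) * 1 \<noteq> 0" using w(1) by auto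
    show "\<psi> ^ 5 \<noteq> 0" using w(1) by auto
    have "\<psi> ^ 5 = \<psi> + 1 + 2 * (2 * \<psi> + 1)" using w(1) by algebra
    then have "\<psi> ^ 5 = \<psi> + 1" by (simp only: two mult_zero_left add_0_right)
    then show "\<psi> ^ 5 \<noteq> 1" using w(1) by auto
  qed (use U w in simp_all)
qed

end

section \<open>The case q = 2\<close>

lemma pair_complete_I2: "\<exists>t w. pair_check I2 v t w"
  by (rule certified_rowsD[OF pair_certificate_I2], cases v, rename_tac a b c d e, case_tac a)
    (auto simp: certified_simps)

lemma pair_complete_O2:
  assumes "x \<noteq> O2"
  shows "\<exists>t w. pair_check O2 (V x O2 O2 O2 O2) t w"
  by (rule certified_rowsD[OF pair_certificate_O2]) (use assms in \<open>cases x; simp add: certified_simps\<close>)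

lemma trace_complete_2:
  assumes "v = V a b c d I2 \<or> v = V a b c I2 O2 \<or> v = V a b I2 O2 O2 \<or> v = V a I2 O2 O2 O2"
  shows "\<exists>z s. trace_check \<tau> v z s"
  using assms certified_rowsD[OF trace_certificate_O2, of v]
    certified_rowsD[OF trace_certificate_I2, of v]
  by (cases \<tau>) (auto simp: certified_simps)

lemma trace_unit_2: "\<exists>z s. trace_check \<tau> (V I2 O2 O2 O2 O2) z s"
  using certified_rowsD[OF trace_certificate_O2, of "V I2 O2 O2 O2 O2"]
    certified_rowsD[OF trace_certificate_I2, of "V I2 O2 O2 O2 O2"]
  by (cases \<tau>) (auto simp: certified_simps)

theorem classification_2:
  fixes L :: "('a::{field,finite} ^ 2) set set"
  assumes card: "CARD('a) = 2 ^ 5" and max: "maximum_scattered 2 L"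
  shows "pseudoregulus_type 2 L \<or> LP_type 2 L"
proof -
  interpret quintic_field 2 "TYPE('a)"
    by unfold_locales (use card in auto)
  have two: "(2::'a) = 0" using of_nat_char_0[of 2 1] by simp
  then have neg1: "(1::'a) = - 1" by (simp add: eq_neg_iff_add_eq_0)
  obtain x :: 'a where "x ^ 31 = 1" "x \<noteq> 1" using ex_root_of_unity[where 'a = 'a, of 1 31] card by auto
  then obtain \<theta> :: 'a where \<theta>: "\<theta> ^ 5 = \<theta> ^ 2 + 1" using quintic_root_char2[OF two] by blast
  define \<phi> :: "gf2 \<Rightarrow> 'a" where "\<phi> = case_gf2 0 1"
  have \<phi>: "\<phi> O2 = 0" "\<phi> I2 = 1" by (simp_all add: \<phi>_def)
  have nz: "(1::'a) \<noteq> 0" by simp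
  have add: "\<phi> (x + y) = \<phi> x + \<phi> y" for x y by (cases x; cases y) (simp_all add: \<phi> two)
  have mult: "\<phi> (x * y) = \<phi> x * \<phi> y" for x y by (cases x; cases y) (simp_all add: \<phi>)
  have Fq: "frob (\<phi> x) = \<phi> x" for x by (cases x) (simp_all add: \<phi>)
  interpret quintic_model 2 "TYPE('a)" \<phi> \<theta>
  proof (rule quintic_modelI)
    show "card (UNIV :: gf2 set) = 2" by (rule card_gf2)
    show "\<phi> 0 = 0" "\<phi> 1 = 1" by (simp_all add: \<phi> zero_gf2_def one_gf2_def)
    show "\<phi> minus1 = - 1" unfolding minus1_gf2_def \<phi> by (rule neg1)
    show "frob (\<phi> x) = \<phi> x" for x by (rule Fq)
    show "\<phi> x \<noteq> 0" if "x \<noteq> 0" for x using that by (cases x) (simp_all add: \<phi> zero_gf2_def nz)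
    show "x = y" if "x + minus1 * y = 0" for x y :: gf2
      using that by (cases x; cases y) (simp_all add: zero_gf2_def minus1_gf2_def)
    show "frob \<theta> \<noteq> \<theta>"
    proof
      assume "frob \<theta> = \<theta>"
      then have "\<theta> ^ 2 = \<theta>" by (simp add: frob_def)
      with \<theta> show False by algebra
    qed
    show "ev5 \<phi> \<theta> (vmul u v) = ev5 \<phi> \<theta> u * ev5 \<phi> \<theta> v" for u v
      unfolding vmul_gf2_def by (rule ev5_convolve_reduce2[OF add mult \<theta>])
    show "ev5 \<phi> \<theta> (vfrob u) = frob (ev5 \<phi> \<theta> u)" for u
    proof (cases u)
      case (V a b c d e)
      have fr: "frob \<theta> = \<theta> ^ 2" by (simp add: frob_def)
      have "(\<theta> ^ 2) ^ 2 = \<theta> ^ 4" "(\<theta> ^ 2) ^ 3 = \<theta> ^ 3 + \<theta>" "(\<theta> ^ 2) ^ 4 = \<theta> ^ 3 + \<theta> ^ 2 + 1"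
        using powers_reduce2[OF \<theta>] by (simp_all flip: power_mult)
      then show ?thesis by (simp add: V add frob_power fr Fq algebra_simps)
    qed
  qed (simp_all add: add mult)
  have unit: "trace_witness 1 (\<phi> \<tau>)" for \<tau>
  proof -
    have "\<exists>z s. trace_check \<tau> (V I2 O2 O2 O2 O2) z s"
      by (rule trace_unit_2)
    then have "trace_witness (ev (V I2 O2 O2 O2 O2)) (\<phi> \<tau>)" by (rule ex_trace_check_sound)
    then show ?thesis by (simp add: \<phi>)
  qed
  show ?thesis
  proof (rule classification_model[OF max, where m = 1])
    fix c :: 'a assume "frob c = c"
    then have "c ^ 2 = c" by (simp add: frob_def)
    moreover have "c ^ 5 = (c ^ 2 - c) * (c ^ 3 + c ^ 2 + c + 1) + c" by algebra
    ultimately have "c ^ 5 = c" by simp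
    then show "(c ^ 1) ^ 5 = c" by simp
  next
    fix x :: gf2 and v assume "x \<noteq> 0"
    \<comment> \<open>For q = 2 the only value of a is 1, and every b has a witness, also b = 1,
      where a ^ 5 = -1.\<close>
    then have "x = I2" by (cases x) (simp_all add: zero_gf2_def)
    then show "dependent_pair (\<phi> x) (ev v) \<or> \<phi> x * ev v = 1 \<and> \<phi> x ^ 5 \<noteq> - 1 \<or> LP_pair (\<phi> x) (ev v)"
      using ex_pair_check_sound[OF pair_complete_I2, of v] by simp
  next
    show "trace_witness 1 (1 / \<phi> x) \<or> LP_trace (\<phi> x)" if "x \<noteq> 0" for x
      using unit[of I2] that by (cases x) (simp_all add: \<phi> zero_gf2_def)
    show "\<exists>t w. pair_check 0 (V x 0 0 0 0) t w" if "x \<noteq> 0" for x :: gf2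
      using that unfolding zero_gf2_def by (rule pair_complete_O2)
    show "trace_witness (ev (V a b c d 1)) (\<phi> \<tau>)" "trace_witness (ev (V a b c 1 0)) (\<phi> \<tau>)"
      "trace_witness (ev (V a b 1 0 0)) (\<phi> \<tau>)" "trace_witness (ev (V a 1 0 0 0)) (\<phi> \<tau>)" for a b c d \<tau>
      unfolding one_gf2_def zero_gf2_def
      by (rule ex_trace_check_sound[OF trace_complete_2], blast)+
    show "trace_witness 1 0" using unit[of O2] by (simp add: \<phi>)
    show "cubic_check (V O2 I2 O2 O2 O2)" by (rule cubic_certificate_2)
  qed
qed

section \<open>The case q = 3\<close>

lemma pair_complete_I3: "v \<noteq> V I3 O3 O3 O3 O3 \<Longrightarrow> \<exists>t w. pair_check I3 v t w"
  by (rule certified_rowsD[OF pair_certificate_I3], cases v, rename_tac a b c d e, case_tac a)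
    (auto simp: certified_simps)

lemma pair_complete_T3: "\<exists>t w. pair_check T3 v t w"
  by (rule certified_rowsD[OF pair_certificate_T3], cases v, rename_tac a b c d e, case_tac a)
    (auto simp: certified_simps)

lemma pair_complete_O3:
  assumes "x \<noteq> O3"
  shows "\<exists>t w. pair_check O3 (V x O3 O3 O3 O3) t w"
  by (rule certified_rowsD[OF pair_certificate_O3]) (use assms in \<open>cases x; simp add: certified_simps\<close>)

lemma trace_complete_3:
  assumes "v = V a b c d I3 \<or> v = V a b c I3 O3 \<or> v = V a b I3 O3 O3 \<or> v = V a I3 O3 O3 O3"
  shows "\<exists>z s. trace_check \<tau> v z s"
  using assms certified_rowsD[OF trace_certificate_O3, of v]
    certified_rowsD[OF trace_certificate_I3, of v]
    certified_rowsD[OF trace_certificate_T3, of v]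
  by (cases \<tau>) (auto simp: certified_simps)

lemma trace_unit_3:
  assumes "\<tau> = O3 \<or> \<tau> = T3"
  shows "\<exists>z s. trace_check \<tau> (V I3 O3 O3 O3 O3) z s"
  using assms certified_rowsD[OF trace_certificate_O3, of "V I3 O3 O3 O3 O3"]
    certified_rowsD[OF trace_certificate_T3, of "V I3 O3 O3 O3 O3"]
  by (auto simp: certified_simps)

theorem classification_3:
  fixes L :: "('a::{field,finite} ^ 2) set set"
  assumes card: "CARD('a) = 3 ^ 5" and max: "maximum_scattered 3 L"
  shows "pseudoregulus_type 3 L \<or> LP_type 3 L"
proof -
  interpret quintic_field 3 "TYPE('a)"
    by unfold_locales (use card in auto)
  have three: "(3::'a) = 0" using of_nat_char_0[of 3 1] by simp
  have "(4::'a) = 3 + 1" by simp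
  then have four: "(4::'a) = 1" by (simp only: three add_0_left)
  then have "(2::'a) * 2 = 1" by simp
  then have nz: "(2::'a) \<noteq> 0" by force
  have "(2::'a) = 3 - 1" by simp
  then have neg1: "(2::'a) = - 1" by (simp only: three diff_0)
  \<comment> \<open>The factors come from 3 ^ 5 - 1 = 22 * 11.\<close>
  obtain x :: 'a where "x ^ 11 = 1" "x \<noteq> 1" using ex_root_of_unity[where 'a = 'a, of 22 11] card by auto
  then obtain \<theta> :: 'a where \<theta>: "\<theta> ^ 5 = \<theta> + 1" using quintic_root_char3[OF three] by blast
  define \<phi> :: "gf3 \<Rightarrow> 'a" where "\<phi> = case_gf3 0 1 2"
  have \<phi>: "\<phi> O3 = 0" "\<phi> I3 = 1" "\<phi> T3 = 2" by (simp_all add: \<phi>_def)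
  have add: "\<phi> (x + y) = \<phi> x + \<phi> y" for x y by (cases x; cases y) (simp_all add: \<phi> three four)
  have mult: "\<phi> (x * y) = \<phi> x * \<phi> y" for x y by (cases x; cases y) (simp_all add: \<phi> four)
  have Fq: "frob (\<phi> x) = \<phi> x" for x by (cases x) (simp_all add: \<phi> frob_numeral)
  interpret quintic_model 3 "TYPE('a)" \<phi> \<theta>
  proof (rule quintic_modelI)
    show "card (UNIV :: gf3 set) = 3" by (rule card_gf3)
    show "\<phi> 0 = 0" "\<phi> 1 = 1" by (simp_all add: \<phi> zero_gf3_def one_gf3_def)
    show "\<phi> minus1 = - 1" unfolding minus1_gf3_def \<phi> by (rule neg1)
    show "frob (\<phi> x) = \<phi> x" for x by (rule Fq)
    show "\<phi> x \<noteq> 0" if "x \<noteq> 0" for x using that by (cases x) (simp_all add: \<phi> zero_gf3_def nz)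
    show "x = y" if "x + minus1 * y = 0" for x y :: gf3
      using that by (cases x; cases y) (simp_all add: zero_gf3_def minus1_gf3_def)
    show "frob \<theta> \<noteq> \<theta>"
    proof
      assume "frob \<theta> = \<theta>"
      then have "\<theta> ^ 3 = \<theta>" by (simp add: frob_def)
      with \<theta> show False by algebra
    qed
    show "ev5 \<phi> \<theta> (vmul u v) = ev5 \<phi> \<theta> u * ev5 \<phi> \<theta> v" for u v
      unfolding vmul_gf3_def by (rule ev5_convolve_reduce1[OF add mult \<theta>])
    show "ev5 \<phi> \<theta> (vfrob u) = frob (ev5 \<phi> \<theta> u)" for u
    proof (cases u)
      case (V a b c d e)
      have fr: "frob \<theta> = \<theta> ^ 3" by (simp add: frob_def)
      have "(\<theta> ^ 3) ^ 2 = \<theta> ^ 2 + \<theta>" "(\<theta> ^ 3) ^ 3 = \<theta> ^ 4 + \<theta> + 1" "(\<theta> ^ 3) ^ 4 = \<theta> ^ 4 + 2 * \<theta> ^ 3 + \<theta> ^ 2"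
        using powers_reduce1[OF \<theta>] by (simp_all flip: power_mult)
      then show ?thesis by (simp add: V \<phi> add mult frob_power fr Fq algebra_simps)
    qed
  qed (simp_all add: add mult)
  have unit: "trace_witness 1 (\<phi> \<tau>)" if "\<tau> \<noteq> I3" for \<tau>
  proof -
    have "\<exists>z s. trace_check \<tau> (V I3 O3 O3 O3 O3) z s"
      by (rule trace_unit_3) (cases \<tau>; use that in simp)
    then have "trace_witness (ev (V I3 O3 O3 O3 O3)) (\<phi> \<tau>)" by (rule ex_trace_check_sound)
    then show ?thesis by (simp add: \<phi>)
  qed
  show ?thesis
  proof (rule classification_model[OF max, where m = 1])
    fix c :: 'a assume "frob c = c"
    then have "c ^ 3 = c" by (simp add: frob_def)
    moreover have "c ^ 5 = (c ^ 3 - c) * (c ^ 2 + 1) + c" by algebra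
    ultimately have "c ^ 5 = c" by simp
    then show "(c ^ 1) ^ 5 = c" by simp
  next
    fix x :: gf3 and v assume "x \<noteq> 0"
    then consider "x = I3" | "x = T3" by (cases x) (simp_all add: zero_gf3_def)
    then show "dependent_pair (\<phi> x) (ev v) \<or> \<phi> x * ev v = 1 \<and> \<phi> x ^ 5 \<noteq> - 1 \<or> LP_pair (\<phi> x) (ev v)"
    proof cases
      case 1
      show ?thesis
      proof (cases "v = V I3 O3 O3 O3 O3")
        case True
        moreover have "(1::'a) \<noteq> - 1" using nz by (simp add: eq_neg_iff_add_eq_0)
        ultimately show ?thesis using 1 by (simp add: \<phi>)
      next
        case False
        then show ?thesis using ex_pair_check_sound[OF pair_complete_I3, of v] 1 by simp
      qed
    next
      case 2
      then show ?thesis using ex_pair_check_sound[OF pair_complete_T3, of v] by simp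
    qed
  next
    fix x :: gf3 assume "x \<noteq> 0"
    then consider "x = I3" | "x = T3" by (cases x) (simp_all add: zero_gf3_def)
    then show "trace_witness 1 (1 / \<phi> x) \<or> LP_trace (\<phi> x)"
    proof cases
      case 1
      then show ?thesis using LP_trace_char3[OF three] by (simp add: \<phi>)
    next
      case 2
      have "1 / \<phi> T3 = \<phi> T3" using nz four by (simp add: \<phi> field_simps)
      then show ?thesis using unit[of T3] 2 by simp
    qed
  next
    show "\<exists>t w. pair_check 0 (V x 0 0 0 0) t w" if "x \<noteq> 0" for x :: gf3
      using that unfolding zero_gf3_def by (rule pair_complete_O3)
    show "trace_witness (ev (V a b c d 1)) (\<phi> \<tau>)" "trace_witness (ev (V a b c 1 0)) (\<phi> \<tau>)"
      "trace_witness (ev (V a b 1 0 0)) (\<phi> \<tau>)" "trace_witness (ev (V a 1 0 0 0)) (\<phi> \<tau>)" for a b c d \<tau>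
      unfolding one_gf3_def zero_gf3_def
      by (rule ex_trace_check_sound[OF trace_complete_3], blast)+
    show "trace_witness 1 0" using unit[of O3] by (simp add: \<phi>)
    show "cubic_check (V I3 O3 I3 O3 O3)" by (rule cubic_certificate_3)
  qed
qed

section \<open>The case q = 4\<close>

lemma pair_complete_I4: "\<exists>t w. pair_check I4 v t w"
  by (rule certified_rowsD[OF pair_certificate_I4], cases v, rename_tac a b c d e, case_tac a)
    (auto simp: certified_simps)

lemma pair_complete_W4: "v \<noteq> V X4 O4 O4 O4 O4 \<Longrightarrow> \<exists>t w. pair_check W4 v t w"
  by (rule certified_rowsD[OF pair_certificate_W4], cases v, rename_tac a b c d e, case_tac a)
    (auto simp: certified_simps)

lemma pair_complete_O4:
  assumes "x \<noteq> O4"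
  shows "\<exists>t w. pair_check O4 (V x O4 O4 O4 O4) t w"
  by (rule certified_rowsD[OF pair_certificate_O4]) (use assms in \<open>cases x; simp add: certified_simps\<close>)

lemma trace_complete_4:
  assumes "v = V a b c d I4 \<or> v = V a b c I4 O4 \<or> v = V a b I4 O4 O4 \<or> v = V a I4 O4 O4 O4"
  shows "\<exists>z s. trace_check \<tau> v z s"
  using assms certified_rowsD[OF trace_certificate_O4, of v]
    certified_rowsD[OF trace_certificate_I4, of v]
    certified_rowsD[OF trace_certificate_W4, of v]
    certified_rowsD[OF trace_certificate_X4, of v]
  by (cases \<tau>) (auto simp: certified_simps)

lemma trace_unit_4:
  assumes "\<tau> = O4 \<or> \<tau> = I4"
  shows "\<exists>z s. trace_check \<tau> (V I4 O4 O4 O4 O4) z s"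
  using assms certified_rowsD[OF trace_certificate_O4, of "V I4 O4 O4 O4 O4"]
    certified_rowsD[OF trace_certificate_I4, of "V I4 O4 O4 O4 O4"]
  by (auto simp: certified_simps)

theorem classification_4:
  fixes L :: "('a::{field,finite} ^ 2) set set"
  assumes card: "CARD('a) = 4 ^ 5" and max: "maximum_scattered 4 L"
  shows "pseudoregulus_type 4 L \<or> LP_type 4 L"
proof -
  have "primepow (4::nat)" unfolding primepow_def by (intro exI[of _ 2]) auto
  then interpret quintic_field 4 "TYPE('a)"
    by unfold_locales (use card in auto)
  have two: "(2::'a) = 0" using of_nat_char_0[of 2 2] by simp
  then have neg1: "(1::'a) = - 1" by (simp add: eq_neg_iff_add_eq_0)
  have dbl: "x + x = 0" "x + (x + y) = y" for x y :: 'a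
    using two by (metis mult_2 mult_zero_left, metis add.assoc add_0_left mult_2 mult_zero_left)
  \<comment> \<open>From 4 ^ 5 - 1 = 33 * 31. The root obtained satisfies an equation over the field
    with 2 elements, yet generates the extension of degree 5 over the field with 4 elements, since
    it is not in the latter.\<close>
  obtain x :: 'a where "x ^ 31 = 1" "x \<noteq> 1" using ex_root_of_unity[where 'a = 'a, of 33 31] card by auto
  then obtain \<theta> :: 'a where \<theta>: "\<theta> ^ 5 = \<theta> ^ 2 + 1" using quintic_root_char2[OF two] by blast
  have "\<exists>\<omega>::'a. \<omega> \<in> Fq 4 - {0, 1}"
  proof (rule ccontr)
    assume "\<not> ?thesis"
    then have "card (Fq 4 :: 'a set) \<le> card {0, 1 :: 'a}" by (intro card_mono) auto
    then show False by (simp add: card_Fq)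
  qed
  then obtain \<omega> :: 'a where \<omega>: "frob \<omega> = \<omega>" "\<omega> \<noteq> 0" "\<omega> \<noteq> 1" by (auto simp: in_Fq_iff)
  have w2: "\<omega> ^ 2 = \<omega> + 1"
  proof -
    have "\<omega> ^ 4 = \<omega>" using \<omega>(1) by (simp add: frob_def)
    moreover have "\<omega> * (\<omega> - 1) * (\<omega> ^ 2 + \<omega> + 1) = \<omega> ^ 4 - \<omega>" by algebra
    ultimately have "\<omega> * (\<omega> - 1) * (\<omega> ^ 2 + \<omega> + 1) = 0" by simp
    then have "\<omega> ^ 2 + \<omega> + 1 = 0" using \<omega> by simp
    then have "\<omega> ^ 2 = \<omega> + 1 - 2 * (\<omega> + 1)" by algebra
    then show ?thesis by (simp only: two mult_zero_left diff_0_right)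
  qed
  have w2': "\<omega> * \<omega> = \<omega> + 1" using w2 by (simp add: power2_eq_square)
  have nz: "\<omega> \<noteq> 0" "\<omega> + 1 \<noteq> 0" using \<omega> w2 by auto
  define \<phi> :: "gf4 \<Rightarrow> 'a" where "\<phi> = case_gf4 0 1 \<omega> (\<omega> + 1)"
  have \<phi>: "\<phi> O4 = 0" "\<phi> I4 = 1" "\<phi> W4 = \<omega>" "\<phi> X4 = \<omega> + 1" by (simp_all add: \<phi>_def)
  have add: "\<phi> (x + y) = \<phi> x + \<phi> y" for x y
    by (cases x; cases y) (simp_all add: \<phi> two dbl ac_simps)
  have mult: "\<phi> (x * y) = \<phi> x * \<phi> y" for x y
    by (cases x; cases y) (simp_all add: \<phi> two dbl w2' algebra_simps)
  have Fq: "frob (\<phi> x) = \<phi> x" for x by (cases x) (simp_all add: \<phi> \<omega>)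
  interpret quintic_model 4 "TYPE('a)" \<phi> \<theta>
  proof (rule quintic_modelI)
    show "card (UNIV :: gf4 set) = 4" by (rule card_gf4)
    show "\<phi> 0 = 0" "\<phi> 1 = 1" by (simp_all add: \<phi> zero_gf4_def one_gf4_def)
    show "\<phi> minus1 = - 1" unfolding minus1_gf4_def \<phi> by (rule neg1)
    show "frob (\<phi> x) = \<phi> x" for x by (rule Fq)
    show "\<phi> x \<noteq> 0" if "x \<noteq> 0" for x using that by (cases x) (simp_all add: \<phi> zero_gf4_def nz)
    show "x = y" if "x + minus1 * y = 0" for x y :: gf4
      using that by (cases x; cases y) (simp_all add: zero_gf4_def minus1_gf4_def)
    show "frob \<theta> \<noteq> \<theta>"
    proof
      assume "frob \<theta> = \<theta>"
      then have "\<theta> ^ 4 = \<theta>" by (simp add: frob_def)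
      moreover have "\<theta> ^ 5 = \<theta> ^ 4 * \<theta>" by algebra
      ultimately show False using \<theta> by (simp add: power2_eq_square)
    qed
    show "ev5 \<phi> \<theta> (vmul u v) = ev5 \<phi> \<theta> u * ev5 \<phi> \<theta> v" for u v
      unfolding vmul_gf4_def by (rule ev5_convolve_reduce2[OF add mult \<theta>])
    show "ev5 \<phi> \<theta> (vfrob u) = frob (ev5 \<phi> \<theta> u)" for u
    proof (cases u)
      case (V a b c d e)
      have fr: "frob \<theta> = \<theta> ^ 4" by (simp add: frob_def)
      have "(\<theta> ^ 4) ^ 2 = \<theta> ^ 3 + \<theta> ^ 2 + 1" "(\<theta> ^ 4) ^ 3 = \<theta> ^ 3 + \<theta> ^ 2 + \<theta>"
        "(\<theta> ^ 4) ^ 4 = \<theta> ^ 4 + \<theta> ^ 3 + \<theta> + 1"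
        using powers_reduce2[OF \<theta>] by (simp_all add: two flip: power_mult)
      then show ?thesis by (simp add: V add frob_power fr Fq algebra_simps)
    qed
  qed (simp_all add: add mult)
  have unit: "trace_witness 1 (\<phi> \<tau>)" if "\<tau> = O4 \<or> \<tau> = I4" for \<tau>
  proof -
    have "\<exists>z s. trace_check \<tau> (V I4 O4 O4 O4 O4) z s"
      by (rule trace_unit_4) (cases \<tau>; use that in simp)
    then have "trace_witness (ev (V I4 O4 O4 O4 O4)) (\<phi> \<tau>)" by (rule ex_trace_check_sound)
    then show ?thesis by (simp add: \<phi>)
  qed
  let ?sq = "\<lambda>x::'a. x ^ 2"
  have sq_root: "(x ^ 512) ^ 2 = x" for x :: 'a
    using power_card_field[of x] card by (simp flip: power_mult)
  have sq: "field_automorphism ?sq"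
  proof -
    have "surj ?sq" by (rule surjI[of _ "\<lambda>x. x ^ 512"]) (rule sq_root)
    then have "bij ?sq" by (simp add: bij_def finite_UNIV_surj_inj)
    moreover have "(x + y) ^ 2 = x ^ 2 + y ^ 2" for x y :: 'a
      by (simp add: power2_sum two)
    ultimately show ?thesis by (simp add: field_automorphism_def power_mult_distrib)
  qed
  have w5: "\<omega> ^ 5 = \<omega> + 1"
  proof -
    have "\<omega> ^ 5 = \<omega> + 1 + 2 * (2 * \<omega> + 1)" using w2 by algebra
    then show ?thesis by (simp only: two mult_zero_left add_0_right)
  qed
  show ?thesis
  proof (rule classification_model[OF max, where m = 2])
    fix c :: 'a assume "frob c = c"
    then have "c ^ 4 = c" by (simp add: frob_def)
    \<comment> \<open>Non-zero c satisfy c ^ 3 = 1, and 2 * 5 = 10 leaves remainder 1 modulo 3;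
      hence m = 2 here, in contrast to the other three fields.\<close>
    moreover have "c ^ 10 = (c ^ 4 - c) * (c ^ 6 + c ^ 3 + 1) + c" by algebra
    ultimately have "c ^ 10 = c" by simp
    then show "(c ^ 2) ^ 5 = c" by (simp flip: power_mult)
  next
    fix x :: gf4 and v assume "x \<noteq> 0"
    then consider "x = I4" | "x = W4" | "x = X4" by (cases x) (simp_all add: zero_gf4_def)
    then show "dependent_pair (\<phi> x) (ev v) \<or> \<phi> x * ev v = 1 \<and> \<phi> x ^ 5 \<noteq> - 1 \<or> LP_pair (\<phi> x) (ev v)"
    proof cases
      case 1
      then show ?thesis using ex_pair_check_sound[OF pair_complete_I4, of v] by simp
    next
      case 2
      show ?thesis
      proof (cases "v = V X4 O4 O4 O4 O4")
        case True
        then show ?thesis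
          using 2 \<omega> by (simp add: \<phi> w5 neg1[symmetric] algebra_simps w2' dbl)
      next
        case False
        then show ?thesis using ex_pair_check_sound[OF pair_complete_W4, of v] 2 by simp
      qed
    next
      case 3
      \<comment> \<open>As x ^ 1024 = x, the power with exponent 512 inverts squaring. Since
        \<omega> + 1 is the square of \<omega>, squaring carries the pair consisting of \<omega> and
        the square root of b to the given pair.\<close>
      obtain v' where v': "ev v ^ 512 = ev v'" using ev_surj by blast
      have b: "ev v = ev v' ^ 2" using sq_root[of "ev v"] v' by simp
      show ?thesis
      proof (cases "v' = V X4 O4 O4 O4 O4")
        case True
        have "(\<omega> + 1) ^ 2 = \<omega> + 2 * (\<omega> + 1)" using w2 by algebra
        then have "(\<omega> + 1) ^ 2 = \<omega>" by (simp only: two mult_zero_left add_0_right)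
        then have "ev v = \<omega>" using b True by (simp add: \<phi>)
        moreover have "(\<omega> + 1) ^ 5 = \<omega> + 2 * (27 * \<omega> + 17)" using w2 by algebra
        then have "(\<omega> + 1) ^ 5 = \<omega>" by (simp only: two mult_zero_left add_0_right)
        ultimately show ?thesis
          using 3 \<omega> by (simp add: \<phi> neg1[symmetric] algebra_simps w2' dbl)
      next
        case False
        then have "dependent_pair \<omega> (ev v')"
          using ex_pair_check_sound[OF pair_complete_W4, of v'] by (simp add: \<phi>)
        from dependent_pair_automorphism[OF sq this] show ?thesis
          using 3 by (simp add: \<phi> b w2)
      qed
    qed
  next
    fix x :: gf4 assume "x \<noteq> 0"
    then consider "x = I4" | "x = W4" | "x = X4" by (cases x) (simp_all add: zero_gf4_def)
    then show "trace_witness 1 (1 / \<phi> x) \<or> LP_trace (\<phi> x)"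
    proof cases
      case 1
      then show ?thesis using unit[of I4] by (simp add: \<phi>)
    next
      case 2
      then show ?thesis using LP_trace_char2[OF two w2 \<omega>(1)] by (simp add: \<phi>)
    next
      case 3
      have "(\<omega> + 1) ^ 2 = \<omega> + 1 + 1"
        using w2 by (simp add: power2_sum two)
      moreover have "frob (\<omega> + 1) = \<omega> + 1" by (simp add: \<omega>)
      ultimately show ?thesis using LP_trace_char2[OF two] 3 by (simp add: \<phi>)
    qed
  next
    show "\<exists>t w. pair_check 0 (V x 0 0 0 0) t w" if "x \<noteq> 0" for x :: gf4
      using that unfolding zero_gf4_def by (rule pair_complete_O4)
    show "trace_witness (ev (V a b c d 1)) (\<phi> \<tau>)" "trace_witness (ev (V a b c 1 0)) (\<phi> \<tau>)"
      "trace_witness (ev (V a b 1 0 0)) (\<phi> \<tau>)" "trace_witness (ev (V a 1 0 0 0)) (\<phi> \<tau>)" for a b c d \<tau>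
      unfolding one_gf4_def zero_gf4_def
      by (rule ex_trace_check_sound[OF trace_complete_4], blast)+
    show "trace_witness 1 0" using unit[of O4] by (simp add: \<phi>)
    show "cubic_check (V O4 I4 I4 O4 O4)" by (rule cubic_certificate_4)
  qed
qed

section \<open>The case q = 5\<close>

lemma gf5_translation_invariance:
  assumes step: "\<And>x. Q (x + k) \<Longrightarrow> Q x" and "Q O5" "k \<noteq> O5"
  shows "Q x"
proof -
  \<comment> \<open>A non-zero k generates the additive group of order 5, so one of these translates
    of x is 0; from there the property is pulled back one step at a time.\<close>
  have "x = O5 \<or> x + k = O5 \<or> x + k + k = O5 \<or> x + k + k + k = O5 \<or> x + k + k + k + k = O5"
    using assms(3) by (cases x; cases k) simp_all
  then show ?thesis using assms(2) step by metis
qed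

text \<open>For \<open>q = 5\<close> the Frobenius map is the substitution \<open>\<theta> \<mapsto> \<theta> + 1\<close>, so a polynomial of positive degree
  in \<open>\<theta>\<close> has a conjugate in which the coefficient below the leading one vanishes.\<close>

lemma shift_invariance_cases:
  assumes step: "\<And>v :: gf5 v5. P (vfrob v) \<Longrightarrow> P v"
  shows "(\<And>a b c. P (V a b c O5 e)) \<Longrightarrow> e \<noteq> O5 \<Longrightarrow> P (V a b c d e)"
    "(\<And>a b. P (V a b O5 d O5)) \<Longrightarrow> d \<noteq> O5 \<Longrightarrow> P (V a b c d O5)"
    "(\<And>a. P (V a O5 c O5 O5)) \<Longrightarrow> c \<noteq> O5 \<Longrightarrow> P (V a b c O5 O5)"
    "P (V O5 b O5 O5 O5) \<Longrightarrow> b \<noteq> O5 \<Longrightarrow> P (V a b O5 O5 O5)"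
proof -
  have 0: "k * O5 = O5" "x + O5 = x" for k x by (cases k; simp) (cases x; simp)
  have nz: "k * x \<noteq> O5" if "k \<noteq> O5" "x \<noteq> O5" for k x using that by (cases k; cases x) simp_all
  show "P (V a b c d e)" if "\<And>a b c. P (V a b c O5 e)" "e \<noteq> O5"
  proof -
    have "\<forall>a b c. P (V a b c d e)"
    \<comment> \<open>The amount by which \<open>vfrob\<close> moves the coefficient below the
      leading one: the degree times the leading coefficient, here 4 e, and in the later cases 3 d, 2
      c and b. It is non-zero because the degree is prime to 5.\<close>
    proof (rule gf5_translation_invariance[where k = "F5 * e" and Q = "\<lambda>d. \<forall>a b c. P (V a b c d e)"])
      show "\<forall>a b c. P (V a b c x e)" if "\<forall>a b c. P (V a b c (x + F5 * e) e)" for x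
        by (intro allI, rule step) (use that in \<open>simp add: 0\<close>)
      show "\<forall>a b c. P (V a b c O5 e)" using that(1) by blast
      show "F5 * e \<noteq> O5" by (rule nz) (use that(2) in simp_all)
    qed
    then show ?thesis by blast
  qed
  show "P (V a b c d O5)" if "\<And>a b. P (V a b O5 d O5)" "d \<noteq> O5"
  proof -
    have "\<forall>a b. P (V a b c d O5)"
    proof (rule gf5_translation_invariance[where k = "H5 * d" and Q = "\<lambda>d'. \<forall>a b. P (V a b d' d O5)"])
      show "\<forall>a b. P (V a b x d O5)" if "\<forall>a b. P (V a b (x + H5 * d) d O5)" for x
        by (intro allI, rule step) (use that in \<open>simp add: 0\<close>)
      show "\<forall>a b. P (V a b O5 d O5)" using that(1) by blast
      show "H5 * d \<noteq> O5" by (rule nz) (use that(2) in simp_all)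
    qed
    then show ?thesis by blast
  qed
  show "P (V a b c O5 O5)" if "\<And>a. P (V a O5 c O5 O5)" "c \<noteq> O5"
  proof -
    have "\<forall>a. P (V a b c O5 O5)"
    proof (rule gf5_translation_invariance[where k = "T5 * c" and Q = "\<lambda>d'. \<forall>a. P (V a d' c O5 O5)"])
      show "\<forall>a. P (V a x c O5 O5)" if "\<forall>a. P (V a (x + T5 * c) c O5 O5)" for x
        by (intro allI, rule step) (use that in \<open>simp add: 0\<close>)
      show "\<forall>a. P (V a O5 c O5 O5)" using that(1) by blast
      show "T5 * c \<noteq> O5" by (rule nz) (use that(2) in simp_all)
    qed
    then show ?thesis by blast
  qed
  show "P (V a b O5 O5 O5)" if "P (V O5 b O5 O5 O5)" "b \<noteq> O5"
  proof (rule gf5_translation_invariance[where k = b and Q = "\<lambda>a. P (V a b O5 O5 O5)"])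
    show "P (V x b O5 O5 O5)" if "P (V (x + b) b O5 O5 O5)" for x
      by (rule step) (use that in \<open>simp add: 0\<close>)
  qed (rule that)+
qed

text \<open>Representatives of the Frobenius orbits of non-constant vectors. The coefficient below
  the leading one runs through all five values along an orbit, so exactly one member is
  reduced.\<close>

fun reduced :: "gf5 v5 \<Rightarrow> bool" where
  "reduced (V a b c d e) \<longleftrightarrow> (e \<noteq> O5 \<and> d = O5) \<or> (e = O5 \<and> d \<noteq> O5 \<and> c = O5) \<or>
     (e = O5 \<and> d = O5 \<and> c \<noteq> O5 \<and> b = O5) \<or> (e = O5 \<and> d = O5 \<and> c = O5 \<and> b \<noteq> O5 \<and> a = O5)"

lemma shift_invariance:
  assumes step: "\<And>v. P (vfrob v) \<Longrightarrow> P v" and red: "\<And>v. reduced v \<Longrightarrow> P v"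
    and v: "\<nexists>k. v = V k O5 O5 O5 O5"
  shows "P v"
proof (cases v)
  case (V a b c d e)
  consider "e \<noteq> O5" | "e = O5" "d \<noteq> O5" | "e = O5" "d = O5" "c \<noteq> O5" | "e = O5" "d = O5" "c = O5" "b \<noteq> O5"
    using v V by blast
  then show ?thesis
    using shift_invariance_cases[of P, OF step] red unfolding V by cases auto
qed

text \<open>Pairs (a, b) of constants without a certificate. In (1, 1), (2, 3), (3, 2) the entries
  are inverse to each other and a ^ 5 \<noteq> -1, which gives pseudoregulus type; (2, 4), (3, 3),
  (4, 2) are of LP type.\<close>

definition exceptions :: "(gf5 \<times> gf5) set" where
  "exceptions = {(I5, I5), (T5, H5), (T5, F5), (H5, T5), (H5, H5), (F5, T5)}"

lemma pair_complete_5: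
  assumes "x \<noteq> O5" "reduced v \<or> v = V k O5 O5 O5 O5 \<and> (x, k) \<notin> exceptions"
  shows "\<exists>t w. pair_check x v t w"
  using assms certified_rowsD[OF pair_certificate_I5, of v]
    certified_rowsD[OF pair_certificate_T5, of v]
    certified_rowsD[OF pair_certificate_H5, of v]
    certified_rowsD[OF pair_certificate_F5, of v]
  by (cases v; cases x; cases k) (auto simp: certified_simps exceptions_def)

lemma pair_complete_O5:
  assumes "x \<noteq> O5"
  shows "\<exists>t w. pair_check O5 (V x O5 O5 O5 O5) t w"
  by (rule certified_rowsD[OF pair_certificate_O5]) (use assms in \<open>cases x; simp add: certified_simps\<close>)

lemma trace_complete_5:
  assumes "v = V a b c O5 I5 \<or> v = V a b O5 I5 O5 \<or> v = V a O5 I5 O5 O5 \<or> v = V O5 I5 O5 O5 O5"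
  shows "\<exists>z s. trace_check \<tau> v z s"
  using assms certified_rowsD[OF trace_certificate_O5, of v]
    certified_rowsD[OF trace_certificate_I5, of v]
    certified_rowsD[OF trace_certificate_T5, of v]
    certified_rowsD[OF trace_certificate_H5, of v]
    certified_rowsD[OF trace_certificate_F5, of v]
  by (cases \<tau>) (auto simp: certified_simps)

lemma trace_unit_5: "\<exists>z s. trace_check \<tau> (V I5 O5 O5 O5 O5) z s"
  using certified_rowsD[OF trace_certificate_O5, of "V I5 O5 O5 O5 O5"]
    certified_rowsD[OF trace_certificate_I5, of "V I5 O5 O5 O5 O5"]
    certified_rowsD[OF trace_certificate_T5, of "V I5 O5 O5 O5 O5"]
    certified_rowsD[OF trace_certificate_H5, of "V I5 O5 O5 O5 O5"]
    certified_rowsD[OF trace_certificate_F5, of "V I5 O5 O5 O5 O5"]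
  by (cases \<tau>) (auto simp: certified_simps)

theorem classification_5:
  fixes L :: "('a::{field,finite} ^ 2) set set"
  assumes card: "CARD('a) = 5 ^ 5" and max: "maximum_scattered 5 L"
  shows "pseudoregulus_type 5 L \<or> LP_type 5 L"
proof -
  interpret quintic_field 5 "TYPE('a)"
    by unfold_locales (use card in auto)
  have five: "(5::'a) = 0" using of_nat_char_0[of 5 1] by simp
  note n = char5_numerals[OF five]
  note nz = n
  have "(4::'a) = 5 - 1" by simp
  then have neg1: "(4::'a) = - 1" by (simp only: five diff_0)
  \<comment> \<open>The trace of 1 is 5 = 0, so the description of the trace kernel yields a root of
    the Artin-Schreier equation \<theta> ^ 5 = \<theta> + 1 directly.\<close>
  have "tr 1 = 0" by (simp add: tr_def five)
  then obtain \<theta> where "1 = frob \<theta> - \<theta>" using tr_zero_imp_ex by blast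
  then have \<theta>: "\<theta> ^ 5 = \<theta> + 1" by (simp add: frob_def algebra_simps)
  define \<phi> :: "gf5 \<Rightarrow> 'a" where "\<phi> = case_gf5 0 1 2 3 4"
  have \<phi>: "\<phi> O5 = 0" "\<phi> I5 = 1" "\<phi> T5 = 2" "\<phi> H5 = 3" "\<phi> F5 = 4" by (simp_all add: \<phi>_def)
  have add: "\<phi> (x + y) = \<phi> x + \<phi> y" for x y by (cases x; cases y) (simp_all add: \<phi> five n)
  have mult: "\<phi> (x * y) = \<phi> x * \<phi> y" for x y by (cases x; cases y) (simp_all add: \<phi> n)
  have Fq: "frob (\<phi> x) = \<phi> x" for x by (cases x) (simp_all add: \<phi> frob_numeral)
  interpret quintic_model 5 "TYPE('a)" \<phi> \<theta>
  proof (rule quintic_modelI)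
    show "card (UNIV :: gf5 set) = 5" by (rule card_gf5)
    show "\<phi> 0 = 0" "\<phi> 1 = 1" by (simp_all add: \<phi> zero_gf5_def one_gf5_def)
    show "\<phi> minus1 = - 1" unfolding minus1_gf5_def \<phi> by (rule neg1)
    show "frob (\<phi> x) = \<phi> x" for x by (rule Fq)
    show "\<phi> x \<noteq> 0" if "x \<noteq> 0" for x using that by (cases x) (simp_all add: \<phi> zero_gf5_def nz)
    show "x = y" if "x + minus1 * y = 0" for x y :: gf5
      using that by (cases x; cases y) (simp_all add: zero_gf5_def minus1_gf5_def)
    show "frob \<theta> \<noteq> \<theta>"
    proof
      assume "frob \<theta> = \<theta>"
      then have "\<theta> ^ 5 = \<theta>" by (simp add: frob_def)
      with \<theta> show False by simp
    qed
    show "ev5 \<phi> \<theta> (vmul u v) = ev5 \<phi> \<theta> u * ev5 \<phi> \<theta> v" for u v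
      unfolding vmul_gf5_def by (rule ev5_convolve_reduce1[OF add mult \<theta>])
    show "ev5 \<phi> \<theta> (vfrob u) = frob (ev5 \<phi> \<theta> u)" for u
    proof (cases u)
      case (V a b c d e)
      have fr: "frob \<theta> = \<theta> + 1" using \<theta> by (simp add: frob_def)
      have "(\<theta> + 1) ^ 2 = \<theta> ^ 2 + 2 * \<theta> + 1" "(\<theta> + 1) ^ 3 = \<theta> ^ 3 + 3 * \<theta> ^ 2 + 3 * \<theta> + 1"
        "(\<theta> + 1) ^ 4 = \<theta> ^ 4 + 4 * \<theta> ^ 3 + 6 * \<theta> ^ 2 + 4 * \<theta> + 1"
        by algebra+
      then show ?thesis by (simp add: V \<phi> add mult frob_power fr Fq n algebra_simps)
    qed
  qed (simp_all add: add mult)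
  have unit: "trace_witness 1 (\<phi> \<tau>)" for \<tau>
  proof -
    have "\<exists>z s. trace_check \<tau> (V I5 O5 O5 O5 O5) z s"
      by (rule trace_unit_5)
    then have "trace_witness (ev (V I5 O5 O5 O5 O5)) (\<phi> \<tau>)" by (rule ex_trace_check_sound)
    then show ?thesis by (simp add: \<phi>)
  qed
  show ?thesis
  proof (rule classification_model[OF max, where m = 1])
    show "(c ^ 1) ^ 5 = c" if "frob c = c" for c :: 'a
      using that by (simp add: frob_def)
  next
    fix x :: gf5 and v assume x: "x \<noteq> 0"
    have step: "dependent_pair (\<phi> y) (ev (vfrob v)) \<Longrightarrow> dependent_pair (\<phi> y) (ev v)" for y v
      unfolding ev_vfrob by (rule dependent_pair_frobD[OF Fq])
    have x5: "x \<noteq> O5" using x by (simp add: zero_gf5_def)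
    show "dependent_pair (\<phi> x) (ev v) \<or> \<phi> x * ev v = 1 \<and> \<phi> x ^ 5 \<noteq> - 1 \<or> LP_pair (\<phi> x) (ev v)"
    proof (cases "\<exists>k. v = V k O5 O5 O5 O5")
      case True
      then obtain k where v: "v = V k O5 O5 O5 O5" by blast
      show ?thesis
      proof (cases "(x, k) \<in> exceptions")
        case True
        then show ?thesis
          using v LP_pair_2_4[OF five] LP_pair_3_3[OF five] LP_pair_4_2[OF five]
          by (auto simp: exceptions_def \<phi> n neg1[symmetric])
      next
        case False
        then show ?thesis using ex_pair_check_sound[OF pair_complete_5, of x v k] v x5 by simp
      qed
    next
      case False
      have "dependent_pair (\<phi> x) (ev v)"
        by (rule shift_invariance[of "\<lambda>v. dependent_pair (\<phi> x) (ev v)"];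
            (erule step | rule False | (rule ex_pair_check_sound, rule pair_complete_5[OF x5], erule disjI1)))
      then show ?thesis ..
    qed
  next
    show "trace_witness 1 (1 / \<phi> x) \<or> LP_trace (\<phi> x)" if "x \<noteq> 0" for x
    proof -
      \<comment> \<open>Every target has a witness for \<psi> = 1, so the first alternative always
        holds.\<close>
      obtain y where "1 / \<phi> x = \<phi> y" using \<phi>_surj[of "1 / \<phi> x"] Fq by auto
      then show ?thesis using unit[of y] by simp
    qed
    show "\<exists>t w. pair_check 0 (V x 0 0 0 0) t w" if "x \<noteq> 0" for x :: gf5
      using that unfolding zero_gf5_def by (rule pair_complete_O5)
    have step: "trace_witness (ev v) (\<phi> \<tau>)" if "trace_witness (ev (vfrob v)) (\<phi> \<tau>)" for v \<tau>
      using that trace_witness_frobD[OF Fq] by (simp add: ev_vfrob)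
    show "trace_witness (ev (V a b c d 1)) (\<phi> \<tau>)" for a b c d \<tau>
      unfolding one_gf5_def zero_gf5_def
      by (rule shift_invariance_cases(1)[of "\<lambda>v. trace_witness (ev v) (\<phi> \<tau>)"];
          (erule step | (rule ex_trace_check_sound, rule trace_complete_5, blast) | simp))
    show "trace_witness (ev (V a b c 1 0)) (\<phi> \<tau>)" for a b c \<tau>
      unfolding one_gf5_def zero_gf5_def
      by (rule shift_invariance_cases(2)[of "\<lambda>v. trace_witness (ev v) (\<phi> \<tau>)"];
          (erule step | (rule ex_trace_check_sound, rule trace_complete_5, blast) | simp))
    show "trace_witness (ev (V a b 1 0 0)) (\<phi> \<tau>)" for a b \<tau>
      unfolding one_gf5_def zero_gf5_def
      by (rule shift_invariance_cases(3)[of "\<lambda>v. trace_witness (ev v) (\<phi> \<tau>)"];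
          (erule step | (rule ex_trace_check_sound, rule trace_complete_5, blast) | simp))
    show "trace_witness (ev (V a 1 0 0 0)) (\<phi> \<tau>)" for a \<tau>
      unfolding one_gf5_def zero_gf5_def
      by (rule shift_invariance_cases(4)[of "\<lambda>v. trace_witness (ev v) (\<phi> \<tau>)"];
          (erule step | (rule ex_trace_check_sound, rule trace_complete_5, blast) | simp))
    show "trace_witness 1 0" using unit[of O5] by (simp add: \<phi>)
    show "cubic_check (V I5 O5 O5 O5 O5)" by (rule cubic_certificate_5)
  qed
qed

theorem theorem2p11:
  fixes q :: nat and L :: "('a::{field,finite} ^ 2) set set"
  assumes "primepow q" and "q \<le> 5" and "CARD('a) = q ^ 5"
    and "maximum_scattered q L"
  shows "pseudoregulus_type q L \<or> LP_type q L"
proof -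
  have "q > 1" using assms(1) by (simp add: primepow_gt_Suc_0)
  then consider "q = 2" | "q = 3" | "q = 4" | "q = 5" using assms(2) by linarith
  then show ?thesis
    using assms(3,4) classification_2 classification_3 classification_4 classification_5 by cases auto
qed

end
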